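(* Let $g\geq 3$. There exist minimal actions of $\pi_1\Sigma_g$ on $\mathbb{R}$-trees by isometries, which are in $\partial\overline{m_{g}^u(3)}$ but not in $\partial\overline{m_g^u(2)}$.
   Context: Let $\Sigma_g$ be the closed oriented surface of genus $g\ge 2$, $\Gamma=\pi_1\Sigma_g=\langle a_1,b_1,\ldots,a_g,b_g\mid \prod_i[a_i,b_i]=1\rangle$, $S=\{a_i^{\pm1},b_i^{\pm1}\}$. For $n\ge2$ let $R_g(n)=\mathrm{Hom}(\Gamma,\mathrm{Isom}^+(\mathbb H^n))$, topologized as a subset of $\mathrm{Isom}^+(\mathbb H^n)^S$. $m_g^o(n)\subset R_g(n)/\mathrm{Isom}^+(\mathbb H^n)$ is the subspace (induced topology) of conjugacy classes of representations having either no, or at least two, global fixed points in $\partial\mathbb H^n$. $m_g^u(n)$ is the quotient of $m_g^o(n)$ by conjugation by $\mathrm{Isom}(\mathbb H^n)$. Compactification. For $[\rho]\in m_g^u(n)$ put $d(\rho)=\min_{x\in\mathbb H^n}\max_{s\in S}d(x,\rho(s)x)$, $\ell(\rho)=\max(1,d(\rho))$, and regard $[\rho]$ as the equivariant isometry class of the action $\rho$ on $(\mathbb H^n,d_{\mathbb H^n}/\ell(\rho))$. Let $\mathcal T(\Gamma)$ be the set of equivariant isometry classes of minimal isometric actions (no proper nonempty invariant subtree) of $\Gamma$ on $\mathbb R$-trees $T$ not reduced to a point, with $\min_{x\in T}\max_{s\in S}d(x,s x)=1$, and such that either $T$ is a line or $\Gamma$ fixes no end of $T$. For a Gromov hyperbolic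 space $X$, $\delta(X)$ is its best hyperbolicity constant (least $\delta$ such that in each geodesic triangle each side lies in the $\delta$-neighbourhood of the two others; so $\delta=0$ for trees). Equip $m_g^u(n)\cup\mathcal T(\Gamma)$ with the topology having as basis the sets $U'_{K,\varepsilon,P}(\rho,X,d)$, where $\varepsilon>0$, $K=\{x_1,\dots,x_p\}\subset X$ and $P\subset\Gamma$ are finite: it consists of those $(\rho',X',d')$ for which there are $x_1',\dots,x_p'\in X'$ with $|d(\rho(\gamma)x_i,\rho(\eta)x_j)-d'(\rho'(\gamma)x_i',\rho'(\eta)x_j')|<\varepsilon$ for all $\gamma,\eta\in P$ and all $i,j$, and $|\delta(X)-\delta(X')|<\varepsilon$. Then $\overline{m_g^u(n)}$ is the closure of $m_g^u(n)$ in this space (a compactification of $m_g^u(n)$), and $\partial\overline{m_g^u(n)}=\overline{m_g^u(n)}\smallsetminus m_g^u(n)\subset\mathcal T(\Gamma)$. *)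

theory Defs
  imports "HOL-Analysis.Analysis" "HOL-Algebra.Group_Action"
begin

section \<open>The surface group\<close>

datatype surface_gen = Gen_a nat | Gen_b nat

text \<open>A letter is a generator with a sign, \<open>True\<close> standing for the formal inverse.
  The generators are indexed by \<open>0, \<dots>, g - 1\<close>.\<close>

type_synonym letter = "surface_gen \<times> bool"
type_synonym word = "letter list"

definition letters :: "nat \<Rightarrow> letter set" where
  "letters g = (Gen_a ` {..<g} \<union> Gen_b ` {..<g}) \<times> UNIV"

fun inv_letter :: "letter \<Rightarrow> letter" where
  "inv_letter (x, e) = (x, \<not> e)"

definition commutator_word :: "nat \<Rightarrow> word" where
  "commutator_word i = [(Gen_a i, False), (Gen_b i, False), (Gen_a i, True), (Gen_b i, True)]"

definition surface_relator :: "nat \<Rightarrow> word" where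
  "surface_relator g = concat (map commutator_word [0..<g])"

inductive_set word_rel :: "nat \<Rightarrow> (word \<times> word) set" for g :: nat where
  refl: "u \<in> lists (letters g) \<Longrightarrow> (u, u) \<in> word_rel g"
| sym: "(u, v) \<in> word_rel g \<Longrightarrow> (v, u) \<in> word_rel g"
| trans: "(u, v) \<in> word_rel g \<Longrightarrow> (v, w) \<in> word_rel g \<Longrightarrow> (u, w) \<in> word_rel g"
| cancel: "u \<in> lists (letters g) \<Longrightarrow> v \<in> lists (letters g) \<Longrightarrow> x \<in> letters g \<Longrightarrow>
    (u @ [x, inv_letter x] @ v, u @ v) \<in> word_rel g"
| relator: "u \<in> lists (letters g) \<Longrightarrow> v \<in> lists (letters g) \<Longrightarrow>
    (u @ surface_relator g @ v, u @ v) \<in> word_rel g"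

text \<open>\<open>\<langle>a\<^sub>1, b\<^sub>1, \<dots>, a\<^sub>g, b\<^sub>g | [a\<^sub>1, b\<^sub>1] \<cdots> [a\<^sub>g, b\<^sub>g] = 1\<rangle>\<close>, as words modulo the congruence
  generated by the relations.\<close>

definition surface_group :: "nat \<Rightarrow> word set monoid" where
  "surface_group g =
     \<lparr>carrier = lists (letters g) // word_rel g,
      mult = (\<lambda>X Y. \<Union>u\<in>X. \<Union>v\<in>Y. word_rel g `` {u @ v}),
      one = word_rel g `` {[]}\<rparr>"

definition surface_gens :: "nat \<Rightarrow> word set set" where
  "surface_gens g = (\<lambda>x. word_rel g `` {[x]}) ` letters g"

lemma relator_in_lists: "surface_relator g \<in> lists (letters g)"
  by (auto simp: surface_relator_def commutator_word_def letters_def)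

lemma inv_letter_in: "x \<in> letters g \<Longrightarrow> inv_letter x \<in> letters g"
  by (cases x) (auto simp: letters_def)

lemma inv_letter_inv [simp]: "inv_letter (inv_letter x) = x"
  by (cases x) auto

lemma rev_inv_letter_in:
  "w \<in> lists (letters g) \<Longrightarrow> rev (map inv_letter w) \<in> lists (letters g)"
  by (induction w) (simp_all add: inv_letter_in del: inv_letter.simps)

lemma word_rel_lists:
  "(u, v) \<in> word_rel g \<Longrightarrow> u \<in> lists (letters g) \<and> v \<in> lists (letters g)"
proof (induction rule: word_rel.induct)
  case (cancel u v x)
  then show ?case using inv_letter_in[of x g] by auto
next
  case (relator u v)
  then show ?case using relator_in_lists[of g] by auto
qed auto

lemma equiv_word_rel: "equiv (lists (letters g)) (word_rel g)"
proof (rule equivI)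
  show "word_rel g \<subseteq> lists (letters g) \<times> lists (letters g)"
    using word_rel_lists by fast
  show "refl_on (lists (letters g)) (word_rel g)"
    by (rule refl_onI) (rule word_rel.refl)
  show "Relation.sym (word_rel g)" by (rule symI) (rule word_rel.sym)
  show "Relation.trans (word_rel g)" by (rule transI) (rule word_rel.trans)
qed

lemma word_rel_context:
  assumes "(u, v) \<in> word_rel g" "p \<in> lists (letters g)" "q \<in> lists (letters g)"
  shows "(p @ u @ q, p @ v @ q) \<in> word_rel g"
  using assms(1)
proof (induction rule: word_rel.induct)
  case (refl u)
  then show ?case using assms(2,3) by (auto intro!: word_rel.refl)
next
  case (sym u v)
  show ?case by (rule word_rel.sym) (rule sym.IH)
next
  case (trans u v w)
  show ?case by (rule word_rel.trans) (rule trans.IH)+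
next
  case (cancel u v x)
  then show ?case
    using word_rel.cancel[of "p @ u" g "v @ q" x] assms(2,3) by auto
next
  case (relator u v)
  then show ?case
    using word_rel.relator[of "p @ u" g "v @ q"] assms(2,3) by auto
qed

lemma word_rel_append:
  assumes "(u, u') \<in> word_rel g" "(v, v') \<in> word_rel g"
  shows "(u @ v, u' @ v') \<in> word_rel g"
proof (rule word_rel.trans)
  show "(u @ v, u' @ v) \<in> word_rel g"
    using word_rel_context[OF assms(1), of "[]" v] word_rel_lists[OF assms(2)] by simp
  show "(u' @ v, u' @ v') \<in> word_rel g"
    using word_rel_context[OF assms(2), of u' "[]"] word_rel_lists[OF assms(1)] by simp
qed

lemma surface_mult:
  assumes "u \<in> lists (letters g)" "v \<in> lists (letters g)"
  shows "word_rel g `` {u} \<otimes>\<^bsub>surface_group g\<^esub> word_rel g `` {v} = word_rel g `` {u @ v}"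
proof -
  have eq: "word_rel g `` {u' @ v'} = word_rel g `` {u @ v}"
    if "u' \<in> word_rel g `` {u}" "v' \<in> word_rel g `` {v}" for u' v'
    using that by (intro equiv_class_eq[OF equiv_word_rel] word_rel.sym[OF word_rel_append]) simp_all
  have "u \<in> word_rel g `` {u}" "v \<in> word_rel g `` {v}"
    using assms by (simp_all only: Image_singleton_iff word_rel.refl)
  then have "(\<Union>u'\<in>word_rel g `` {u}. \<Union>v'\<in>word_rel g `` {v}. word_rel g `` {u' @ v'}) =
      word_rel g `` {u @ v}"
    using eq by blast
  then show ?thesis by (simp add: surface_group_def)
qed

lemma word_rel_inverse:
  assumes "w \<in> lists (letters g)"
  shows "(rev (map inv_letter w) @ w, []) \<in> word_rel g"
  using assms
proof (induction rule: lists.induct)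
  case Nil
  show ?case by (simp add: word_rel.refl)
next
  case (Cons x w)
  let ?r = "rev (map inv_letter w)"
  have x: "inv_letter x \<in> letters g" by (rule inv_letter_in[OF Cons.hyps(1)])
  have r: "?r \<in> lists (letters g)" by (rule rev_inv_letter_in[OF Cons.hyps(2)])
  have "(?r @ [inv_letter x, inv_letter (inv_letter x)] @ w, ?r @ w) \<in> word_rel g"
    by (rule word_rel.cancel[OF r Cons.hyps(2) x])
  from word_rel.trans[OF this Cons.IH] show ?case by simp
qed

lemma surface_group_group: "group (surface_group g)"
proof (rule groupI)
  let ?G = "surface_group g" and ?L = "lists (letters g)"
  have car: "carrier ?G = ?L // word_rel g" and one: "\<one>\<^bsub>?G\<^esub> = word_rel g `` {[]}"
    by (auto simp: surface_group_def)
  note m = surface_mult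
  have rep: "\<exists>w\<in>?L. x = word_rel g `` {w}" if "x \<in> carrier ?G" for x
    using that unfolding car by (elim quotientE) (rule bexI)
  have cl: "word_rel g `` {w} \<in> carrier ?G" if "w \<in> ?L" for w
    using that unfolding car by (rule quotientI)
  have app: "u @ v \<in> ?L" if "u \<in> ?L" "v \<in> ?L" for u v using that by simp
  show "x \<otimes>\<^bsub>?G\<^esub> y \<in> carrier ?G" if xy: "x \<in> carrier ?G" "y \<in> carrier ?G" for x y
  proof -
    obtain u where u: "u \<in> ?L" "x = word_rel g `` {u}" using rep[OF xy(1)] by (rule bexE)
    obtain v where v: "v \<in> ?L" "y = word_rel g `` {v}" using rep[OF xy(2)] by (rule bexE)
    show ?thesis unfolding u(2) v(2) m[OF u(1) v(1)] by (rule cl[OF app[OF u(1) v(1)]])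
  qed
  show "\<one>\<^bsub>?G\<^esub> \<in> carrier ?G" unfolding one by (rule cl[OF lists.Nil])
  show "x \<otimes>\<^bsub>?G\<^esub> y \<otimes>\<^bsub>?G\<^esub> z = x \<otimes>\<^bsub>?G\<^esub> (y \<otimes>\<^bsub>?G\<^esub> z)"
    if xyz: "x \<in> carrier ?G" "y \<in> carrier ?G" "z \<in> carrier ?G" for x y z
  proof -
    obtain u where u: "u \<in> ?L" "x = word_rel g `` {u}" using rep[OF xyz(1)] by (rule bexE)
    obtain v where v: "v \<in> ?L" "y = word_rel g `` {v}" using rep[OF xyz(2)] by (rule bexE)
    obtain w where w: "w \<in> ?L" "z = word_rel g `` {w}" using rep[OF xyz(3)] by (rule bexE)
    show ?thesis
      unfolding u(2) v(2) w(2) m[OF u(1) v(1)] m[OF v(1) w(1)]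
        m[OF app[OF u(1) v(1)] w(1)] m[OF u(1) app[OF v(1) w(1)]] append_assoc
      by (rule HOL.refl)
  qed
  show "\<one>\<^bsub>?G\<^esub> \<otimes>\<^bsub>?G\<^esub> x = x" if x: "x \<in> carrier ?G" for x
  proof -
    obtain u where u: "u \<in> ?L" "x = word_rel g `` {u}" using rep[OF x] by (rule bexE)
    show ?thesis unfolding one u(2) m[OF lists.Nil u(1)] append_Nil by (rule HOL.refl)
  qed
  show "\<exists>y\<in>carrier ?G. y \<otimes>\<^bsub>?G\<^esub> x = \<one>\<^bsub>?G\<^esub>" if x: "x \<in> carrier ?G" for x
  proof -
    obtain w where w: "w \<in> ?L" "x = word_rel g `` {w}" using rep[OF x] by (rule bexE)
    let ?r = "rev (map inv_letter w)"
    have r: "?r \<in> ?L" by (rule rev_inv_letter_in[OF w(1)])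
    have "word_rel g `` {?r} \<otimes>\<^bsub>?G\<^esub> x = word_rel g `` {?r @ w}"
      unfolding w(2) by (rule m[OF r w(1)])
    also have "\<dots> = \<one>\<^bsub>?G\<^esub>" unfolding one
      by (rule equiv_class_eq[OF equiv_word_rel word_rel_inverse[OF w(1)]])
    finally show ?thesis using cl[OF r] by (rule bexI)
  qed
qed

section \<open>Hyperbolic space, in the ball model\<close>

text \<open>\<open>\<bbbH>\<^sup>n\<close> is the open unit ball of \<open>\<real>\<^sup>n\<close> with the metric of curvature \<open>-1\<close>, and
  \<open>\<partial>\<bbbH>\<^sup>n\<close> is the unit sphere.\<close>

definition hyp_space :: "(real ^ 'n) set" where
  "hyp_space = ball 0 1"

definition hyp_boundary :: "(real ^ 'n) set" where
  "hyp_boundary = sphere 0 1"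

definition hyp_dist :: "real ^ 'n \<Rightarrow> real ^ 'n \<Rightarrow> real" where
  "hyp_dist x y = arcosh (1 + 2 * (norm (x - y))\<^sup>2 / ((1 - (norm x)\<^sup>2) * (1 - (norm y)\<^sup>2)))"

definition hyp_isom :: "(real ^ 'n \<Rightarrow> real ^ 'n) set" where
  "hyp_isom = {f \<in> Bij hyp_space. \<forall>x\<in>hyp_space. \<forall>y\<in>hyp_space. hyp_dist (f x) (f y) = hyp_dist x y}"

definition hyp_isom_plus :: "(real ^ 'n \<Rightarrow> real ^ 'n) set" where
  "hyp_isom_plus = {f \<in> hyp_isom. \<forall>x\<in>hyp_space. \<exists>f'. (f has_derivative f') (at x) \<and> det (matrix f') > 0}"

definition hyp_isom_plus_group :: "(real ^ 'n \<Rightarrow> real ^ 'n) monoid" where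
  "hyp_isom_plus_group = (BijGroup hyp_space)\<lparr>carrier := hyp_isom_plus\<rparr>"

text \<open>An isometry of the ball extends to a homeomorphism of the closed ball; the limit below says that
  this extension fixes \<open>\<xi>\<close>.\<close>

definition fixes_boundary_point :: "(real ^ 'n \<Rightarrow> real ^ 'n) \<Rightarrow> real ^ 'n \<Rightarrow> bool" where
  "fixes_boundary_point f \<xi> \<longleftrightarrow> \<xi> \<in> hyp_boundary \<and> (f \<longlongrightarrow> \<xi>) (at \<xi> within hyp_space)"

section \<open>Actions on metric spaces\<close>

text \<open>Triples \<open>(\<rho>, X, d)\<close>. Only the values of \<open>d\<close> and of the maps \<open>\<rho> \<gamma>\<close> on \<open>X\<close> are meaningful.\<close>

record ('c, 'a) space_action =
  act :: "'c \<Rightarrow> 'a \<Rightarrow> 'a"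
  pts :: "'a set"
  dst :: "'a \<Rightarrow> 'a \<Rightarrow> real"

definition isometric_action :: "('c, 'm) monoid_scheme \<Rightarrow> ('c, 'a) space_action \<Rightarrow> bool" where
  "isometric_action G A \<longleftrightarrow> Metric_space (pts A) (dst A) \<and> group_action G (pts A) (act A) \<and>
     (\<forall>\<gamma>\<in>carrier G. \<forall>x\<in>pts A. \<forall>y\<in>pts A. dst A (act A \<gamma> x) (act A \<gamma> y) = dst A x y)"

definition equivariantly_isometric ::
  "('c, 'm) monoid_scheme \<Rightarrow> ('c, 'a) space_action \<Rightarrow> ('c, 'b) space_action \<Rightarrow> bool" where
  "equivariantly_isometric G A B \<longleftrightarrow> (\<exists>f. bij_betw f (pts A) (pts B) \<and>
     (\<forall>x\<in>pts A. \<forall>y\<in>pts A. dst B (f x) (f y) = dst A x y) \<and>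
     (\<forall>\<gamma>\<in>carrier G. \<forall>x\<in>pts A. f (act A \<gamma> x) = act B \<gamma> (f x)))"

text \<open>To compare actions on spaces of different types, equivariant isometry classes are taken inside
  one fixed type with as many elements as the continuum. No class is lost: \<open>\<bbbH>\<^sup>n\<close> has the
  cardinality of the continuum, and a minimal \<open>\<real>\<close>-tree of a countable group is a countable union
  of segments.\<close>

type_synonym universe = "nat \<Rightarrow> real"

definition iso_class ::
  "('c, 'm) monoid_scheme \<Rightarrow> ('c, 'a) space_action \<Rightarrow> ('c, universe) space_action set" where
  "iso_class G A = {B. equivariantly_isometric G A B}"

definition displacement :: "'c set \<Rightarrow> ('c, 'a) space_action \<Rightarrow> 'a \<Rightarrow> real" where
  "displacement S A x = Max ((\<lambda>s. dst A x (act A s x)) ` S)"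

definition geodesic_segment :: "'a set \<Rightarrow> ('a \<Rightarrow> 'a \<Rightarrow> real) \<Rightarrow> 'a \<Rightarrow> 'a \<Rightarrow> 'a set \<Rightarrow> bool" where
  "geodesic_segment X d x y \<sigma> \<longleftrightarrow> (\<exists>c. c ` {0..d x y} = \<sigma> \<and> \<sigma> \<subseteq> X \<and> c 0 = x \<and> c (d x y) = y \<and>
     (\<forall>s\<in>{0..d x y}. \<forall>t\<in>{0..d x y}. d (c s) (c t) = \<bar>s - t\<bar>))"

text \<open>Quantifying over all labellings of a triangle, it is enough to bound one of its sides.\<close>

definition thin_triangles :: "'a set \<Rightarrow> ('a \<Rightarrow> 'a \<Rightarrow> real) \<Rightarrow> real \<Rightarrow> bool" where
  "thin_triangles X d \<delta> \<longleftrightarrow> (\<forall>x\<in>X. \<forall>y\<in>X. \<forall>z\<in>X. \<forall>\<sigma> \<tau> \<upsilon>.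
     geodesic_segment X d x y \<sigma> \<and> geodesic_segment X d y z \<tau> \<and> geodesic_segment X d z x \<upsilon> \<longrightarrow>
     (\<forall>p\<in>\<sigma>. \<exists>q\<in>\<tau> \<union> \<upsilon>. d p q \<le> \<delta>))"

text \<open>The infimum is attained, sides of triangles being compact.\<close>

definition hyperbolicity_constant :: "'a set \<Rightarrow> ('a \<Rightarrow> 'a \<Rightarrow> real) \<Rightarrow> real" where
  "hyperbolicity_constant X d = Inf {\<delta>. thin_triangles X d \<delta>}"

section \<open>Representations in \<open>Isom\<^sup>+(\<bbbH>\<^sup>n)\<close>\<close>

text \<open>Two elements of \<open>representations g\<close> that agree on \<open>\<Gamma>\<close> are the same representation.\<close>

definition representations :: "nat \<Rightarrow> (word set \<Rightarrow> real ^ 'n \<Rightarrow> real ^ 'n) set" where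
  "representations g = hom (surface_group g) hyp_isom_plus_group"

definition global_fixed_points :: "nat \<Rightarrow> (word set \<Rightarrow> real ^ 'n \<Rightarrow> real ^ 'n) \<Rightarrow> (real ^ 'n) set" where
  "global_fixed_points g \<rho> = {\<xi>. \<forall>\<gamma>\<in>carrier (surface_group g). fixes_boundary_point (\<rho> \<gamma>) \<xi>}"

definition admissible_reps :: "nat \<Rightarrow> (word set \<Rightarrow> real ^ 'n \<Rightarrow> real ^ 'n) set" where
  "admissible_reps g = {\<rho> \<in> representations g. global_fixed_points g \<rho> = {} \<or>
     (\<exists>\<xi>\<in>global_fixed_points g \<rho>. \<exists>\<eta>\<in>global_fixed_points g \<rho>. \<xi> \<noteq> \<eta>)}"

definition hyp_action ::
  "(word set \<Rightarrow> real ^ 'n \<Rightarrow> real ^ 'n) \<Rightarrow> (word set, real ^ 'n) space_action" where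
  "hyp_action \<rho> = \<lparr>act = \<rho>, pts = hyp_space, dst = hyp_dist\<rparr>"

text \<open>On \<open>admissible_reps\<close> the infimum is a minimum.\<close>

definition rep_displacement :: "nat \<Rightarrow> (word set \<Rightarrow> real ^ 'n \<Rightarrow> real ^ 'n) \<Rightarrow> real" where
  "rep_displacement g \<rho> = (INF x\<in>hyp_space. displacement (surface_gens g) (hyp_action \<rho>) x)"

definition rep_scale :: "nat \<Rightarrow> (word set \<Rightarrow> real ^ 'n \<Rightarrow> real ^ 'n) \<Rightarrow> real" where
  "rep_scale g \<rho> = max 1 (rep_displacement g \<rho>)"

definition rescaled_action ::
  "nat \<Rightarrow> (word set \<Rightarrow> real ^ 'n \<Rightarrow> real ^ 'n) \<Rightarrow> (word set, real ^ 'n) space_action" where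
  "rescaled_action g \<rho> = \<lparr>act = \<rho>, pts = hyp_space, dst = (\<lambda>x y. hyp_dist x y / rep_scale g \<rho>)\<rparr>"

type_synonym point = "(word set, universe) space_action set"

text \<open>\<open>m\<^sub>g\<^sup>u(n)\<close>: an element \<open>[\<rho>]\<close> is regarded as the equivariant isometry class of the rescaled action.
  An equivariant isometry between two rescaled actions preserves the curvature, hence the scale, and so
  is an isometry of \<open>\<bbbH>\<^sup>n\<close> conjugating the representations; the converse is \<open>rescaled_class_conj\<close>
  below. The argument \<open>TYPE('n)\<close> carries the dimension \<open>n\<close>.\<close>

definition moduli_u :: "'n::finite itself \<Rightarrow> nat \<Rightarrow> point set" where
  "moduli_u _ g = {iso_class (surface_group g) (rescaled_action g \<rho>) | \<rho>.
     \<rho> \<in> (admissible_reps g :: (word set \<Rightarrow> real ^ 'n \<Rightarrow> real ^ 'n) set)}"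

lemma equivariantly_isometric_sym:
  assumes G: "\<And>\<gamma> x. \<gamma> \<in> carrier G \<Longrightarrow> x \<in> pts A \<Longrightarrow> act A \<gamma> x \<in> pts A"
    and "equivariantly_isometric G A B"
  shows "equivariantly_isometric G B A"
proof -
  obtain f where f: "bij_betw f (pts A) (pts B)"
    "\<And>x y. x \<in> pts A \<Longrightarrow> y \<in> pts A \<Longrightarrow> dst B (f x) (f y) = dst A x y"
    "\<And>\<gamma> x. \<gamma> \<in> carrier G \<Longrightarrow> x \<in> pts A \<Longrightarrow> f (act A \<gamma> x) = act B \<gamma> (f x)"
    using assms(2) unfolding equivariantly_isometric_def by blast
  let ?h = "inv_into (pts A) f"
  have h: "?h y \<in> pts A" "f (?h y) = y" if "y \<in> pts B" for y
    using that f(1) by (auto simp: bij_betw_def inv_into_into f_inv_into_f)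
  have hf: "?h (f x) = x" if "x \<in> pts A" for x
    using that f(1) by (auto simp: bij_betw_def)
  have "dst A (?h x) (?h y) = dst B x y" if "x \<in> pts B" "y \<in> pts B" for x y
    using f(2)[of "?h x" "?h y"] h that by simp
  moreover have "?h (act B \<gamma> y) = act A \<gamma> (?h y)" if "\<gamma> \<in> carrier G" "y \<in> pts B" for \<gamma> y
    using f(3)[of \<gamma> "?h y"] h that hf[of "act A \<gamma> (?h y)"] G[of \<gamma> "?h y"] by simp
  ultimately show ?thesis
    unfolding equivariantly_isometric_def using bij_betw_inv_into[OF f(1)] by blast
qed

lemma equivariantly_isometric_trans:
  assumes "equivariantly_isometric G A B" "equivariantly_isometric G B C"
  shows "equivariantly_isometric G A C"
proof -
  obtain f where f: "bij_betw f (pts A) (pts B)"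
    "\<And>x y. x \<in> pts A \<Longrightarrow> y \<in> pts A \<Longrightarrow> dst B (f x) (f y) = dst A x y"
    "\<And>\<gamma> x. \<gamma> \<in> carrier G \<Longrightarrow> x \<in> pts A \<Longrightarrow> f (act A \<gamma> x) = act B \<gamma> (f x)"
    using assms(1) unfolding equivariantly_isometric_def by blast
  obtain h where h: "bij_betw h (pts B) (pts C)"
    "\<And>x y. x \<in> pts B \<Longrightarrow> y \<in> pts B \<Longrightarrow> dst C (h x) (h y) = dst B x y"
    "\<And>\<gamma> x. \<gamma> \<in> carrier G \<Longrightarrow> x \<in> pts B \<Longrightarrow> h (act B \<gamma> x) = act C \<gamma> (h x)"
    using assms(2) unfolding equivariantly_isometric_def by blast
  have fB: "f x \<in> pts B" if "x \<in> pts A" for x using f(1) that by (auto simp: bij_betw_def)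
  show ?thesis unfolding equivariantly_isometric_def
    by (rule exI[of _ "h \<circ> f"])
       (use f h fB bij_betw_trans[OF f(1) h(1)] in auto)
qed

lemma rescaled_class_conj:
  fixes \<rho> \<rho>' :: "word set \<Rightarrow> real ^ 'n \<Rightarrow> real ^ 'n"
  assumes rep: "\<rho> \<in> representations g" and \<phi>: "\<phi> \<in> hyp_isom"
    and conj: "\<And>\<gamma> x. \<gamma> \<in> carrier (surface_group g) \<Longrightarrow> x \<in> hyp_space \<Longrightarrow> \<rho>' \<gamma> (\<phi> x) = \<phi> (\<rho> \<gamma> x)"
  shows "iso_class (surface_group g) (rescaled_action g \<rho>) =
         iso_class (surface_group g) (rescaled_action g \<rho>')"
proof -
  let ?G = "surface_group g"
  have bij: "bij_betw \<phi> hyp_space hyp_space"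
    and iso: "\<And>x y. x \<in> hyp_space \<Longrightarrow> y \<in> hyp_space \<Longrightarrow> hyp_dist (\<phi> x) (\<phi> y) = hyp_dist x y"
    using \<phi> by (auto simp: hyp_isom_def Bij_def)
  have inv: "\<rho> \<gamma> x \<in> hyp_space" if "\<gamma> \<in> carrier ?G" "x \<in> hyp_space" for \<gamma> x
  proof -
    have "\<rho> \<gamma> \<in> hyp_isom_plus"
      using rep that(1) by (auto simp: representations_def hom_def hyp_isom_plus_group_def)
    then have "bij_betw (\<rho> \<gamma>) hyp_space hyp_space"
      by (auto simp: hyp_isom_plus_def hyp_isom_def Bij_def)
    then show ?thesis using that(2) by (auto simp: bij_betw_def)
  qed
  have S: "surface_gens g \<subseteq> carrier ?G"
    by (auto simp: surface_gens_def surface_group_def intro!: quotientI)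
  have disp: "displacement (surface_gens g) (hyp_action \<rho>') (\<phi> x) =
              displacement (surface_gens g) (hyp_action \<rho>) x" if x: "x \<in> hyp_space" for x
  proof -
    have "hyp_dist (\<phi> x) (\<rho>' s (\<phi> x)) = hyp_dist x (\<rho> s x)" if "s \<in> surface_gens g" for s
      using that S conj[of s x] inv[of s x] iso[of x "\<rho> s x"] x by auto
    then show ?thesis by (simp add: displacement_def hyp_action_def)
  qed
  have "rep_displacement g \<rho>' =
        (INF x\<in>\<phi> ` hyp_space. displacement (surface_gens g) (hyp_action \<rho>') x)"
    using bij by (simp add: rep_displacement_def bij_betw_def)
  also have "\<dots> = rep_displacement g \<rho>"
    unfolding image_image rep_displacement_def using disp by simp
  finally have scale: "rep_scale g \<rho>' = rep_scale g \<rho>" by (simp add: rep_scale_def)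
  have ei: "equivariantly_isometric ?G (rescaled_action g \<rho>) (rescaled_action g \<rho>')"
    unfolding equivariantly_isometric_def rescaled_action_def
    by (rule exI[of _ \<phi>]) (use bij iso conj scale in auto)
  have "equivariantly_isometric ?G (rescaled_action g \<rho>') (rescaled_action g \<rho>)"
    by (rule equivariantly_isometric_sym[OF _ ei]) (use inv in \<open>simp add: rescaled_action_def\<close>)
  note ei' = this
  have "equivariantly_isometric ?G (rescaled_action g \<rho>) B \<longleftrightarrow>
        equivariantly_isometric ?G (rescaled_action g \<rho>') B"
    for B :: "(word set, universe) space_action"
    using equivariantly_isometric_trans[OF ei, of B] equivariantly_isometric_trans[OF ei', of B]
    by iprover
  then show ?thesis unfolding iso_class_def by (intro Collect_cong)
qed

section \<open>Actions on \<open>\<real>\<close>-trees\<close>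

definition R_tree :: "'a set \<Rightarrow> ('a \<Rightarrow> 'a \<Rightarrow> real) \<Rightarrow> bool" where
  "R_tree T d \<longleftrightarrow> Metric_space T d \<and>
     (\<forall>x\<in>T. \<forall>y\<in>T. (\<exists>\<sigma>. geodesic_segment T d x y \<sigma>) \<and>
       (\<forall>p q. pathin (Metric_space.mtopology T d) p \<and> inj_on p {0..1} \<and> p 0 = x \<and> p 1 = y \<and>
              pathin (Metric_space.mtopology T d) q \<and> inj_on q {0..1} \<and> q 0 = x \<and> q 1 = y \<longrightarrow>
              p ` {0..1} = q ` {0..1}))"

definition R_tree_action :: "('c, 'm) monoid_scheme \<Rightarrow> ('c, 'a) space_action \<Rightarrow> bool" where
  "R_tree_action G A \<longleftrightarrow> isometric_action G A \<and> R_tree (pts A) (dst A)"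

definition minimal_action :: "('c, 'm) monoid_scheme \<Rightarrow> ('c, 'a) space_action \<Rightarrow> bool" where
  "minimal_action G A \<longleftrightarrow> (\<forall>Y\<subseteq>pts A. Y \<noteq> {} \<and> R_tree Y (dst A) \<and>
     (\<forall>\<gamma>\<in>carrier G. \<forall>y\<in>Y. act A \<gamma> y \<in> Y) \<longrightarrow> Y = pts A)"

definition is_line :: "'a set \<Rightarrow> ('a \<Rightarrow> 'a \<Rightarrow> real) \<Rightarrow> bool" where
  "is_line T d \<longleftrightarrow> (\<exists>c::real \<Rightarrow> 'a. bij_betw c UNIV T \<and> (\<forall>s t. d (c s) (c t) = \<bar>s - t\<bar>))"

definition geodesic_ray :: "'a set \<Rightarrow> ('a \<Rightarrow> 'a \<Rightarrow> real) \<Rightarrow> (real \<Rightarrow> 'a) \<Rightarrow> bool" where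
  "geodesic_ray T d r \<longleftrightarrow> r ` {0..} \<subseteq> T \<and> (\<forall>s\<ge>0. \<forall>t\<ge>0. d (r s) (r t) = \<bar>s - t\<bar>)"

text \<open>Two rays of a tree define the same end when they share a subray.\<close>

definition same_end :: "(real \<Rightarrow> 'a) \<Rightarrow> (real \<Rightarrow> 'a) \<Rightarrow> bool" where
  "same_end r r' \<longleftrightarrow> (\<exists>a\<ge>0. \<exists>b\<ge>0. \<forall>t\<ge>0. r (a + t) = r' (b + t))"

definition fixes_an_end :: "('c, 'm) monoid_scheme \<Rightarrow> ('c, 'a) space_action \<Rightarrow> bool" where
  "fixes_an_end G A \<longleftrightarrow> (\<exists>r. geodesic_ray (pts A) (dst A) r \<and>
     (\<forall>\<gamma>\<in>carrier G. same_end (\<lambda>t. act A \<gamma> (r t)) r))"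

definition tree_space :: "nat \<Rightarrow> point set" where
  "tree_space g = {iso_class (surface_group g) A | A :: (word set, universe) space_action.
     R_tree_action (surface_group g) A \<and> minimal_action (surface_group g) A \<and>
     (\<exists>x\<in>pts A. \<exists>y\<in>pts A. x \<noteq> y) \<and>
     (\<exists>x\<in>pts A. displacement (surface_gens g) A x = 1) \<and>
     (\<forall>x\<in>pts A. displacement (surface_gens g) A x \<ge> 1) \<and>
     (is_line (pts A) (dst A) \<or> \<not> fixes_an_end (surface_group g) A)}"

section \<open>The compactification\<close>

definition close_actions ::
  "'a set \<Rightarrow> real \<Rightarrow> 'c set \<Rightarrow> ('c, 'a) space_action \<Rightarrow> ('c, 'b) space_action \<Rightarrow> bool" where
  "close_actions K \<epsilon> P A B \<longleftrightarrow>
     (\<exists>f \<in> K \<rightarrow> pts B. \<forall>\<gamma>\<in>P. \<forall>\<eta>\<in>P. \<forall>x\<in>K. \<forall>y\<in>K.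
        \<bar>dst A (act A \<gamma> x) (act A \<eta> y) - dst B (act B \<gamma> (f x)) (act B \<eta> (f y))\<bar> < \<epsilon>) \<and>
     \<bar>hyperbolicity_constant (pts A) (dst A) - hyperbolicity_constant (pts B) (dst B)\<bar> < \<epsilon>"

definition basic_nbhd :: "'n::finite itself \<Rightarrow> nat \<Rightarrow> universe set \<Rightarrow> real \<Rightarrow> word set set \<Rightarrow>
    (word set, universe) space_action \<Rightarrow> point set" where
  "basic_nbhd n g K \<epsilon> P A =
     {C \<in> moduli_u n g \<union> tree_space g. \<exists>B\<in>C. close_actions K \<epsilon> P A B}"

text \<open>The sets \<open>basic_nbhd\<close> are a basis of the topology they generate.\<close>

definition ambient_topology :: "'n::finite itself \<Rightarrow> nat \<Rightarrow> point topology" where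
  "ambient_topology n g = topology_generated_by
     {basic_nbhd n g K \<epsilon> P A | K \<epsilon> P A. A \<in> \<Union> (moduli_u n g \<union> tree_space g) \<and> 0 < \<epsilon> \<and>
        finite K \<and> K \<subseteq> pts A \<and> finite P \<and> P \<subseteq> carrier (surface_group g)}"

definition compactification :: "'n::finite itself \<Rightarrow> nat \<Rightarrow> point set" where
  "compactification n g = ambient_topology n g closure_of moduli_u n g"

definition compactification_boundary :: "'n::finite itself \<Rightarrow> nat \<Rightarrow> point set" where
  "compactification_boundary n g = compactification n g - moduli_u n g"

end

theory Submission
  imports Defs
begin

text \<open>Let \<open>W\<close> be the free product of three groups of order two, generated by involutions \<open>c\<^sub>0\<close>,
  \<open>c\<^sub>1\<close>, \<open>c\<^sub>2\<close>. It acts on the trivalent tree of reduced words, and so does the involution \<open>s\<close>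
  that exchanges the letters \<open>1\<close> and \<open>2\<close>. Mapping \<open>a\<^sub>1\<close>, \<open>a\<^sub>2\<close>, \<open>a\<^sub>3\<close> to \<open>s\<close>, \<open>c\<^sub>0\<close>,
  \<open>c\<^sub>1\<close> and all other generators to \<open>1\<close> yields the action of the surface group.

  In \<open>\<bbbH>\<^sup>3\<close>, let \<open>s\<close> be the half-turn about the first axis, and \<open>c\<^sub>0\<close>, \<open>c\<^sub>1\<close>, \<open>c\<^sub>2\<close> the half-turns
  that exchange the origin with the points at distance \<open>L\<close> in the directions \<open>e\<^sub>1\<close>, \<open>e\<^sub>2\<close>, \<open>-e\<^sub>2\<close>.
  The equivariant map from the tree to \<open>\<bbbH>\<^sup>3\<close> multiplies distances by \<open>L\<close>, up to an error that is small
  compared to \<open>L\<close>, because broken geodesics with long sides and angles at least \<open>\<pi>/2\<close> are almost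
  geodesic. Hence the rescaled actions converge to the tree.

  In \<open>\<bbbH>\<^sup>2\<close> this is impossible: \<open>s\<close> fixes the end of one leg of a tripod and exchanges the ends of the
  other two, whereas an orientation preserving isometry of the plane preserves the cyclic order of the
  ends of a large tripod, even up to small errors.\<close>

section \<open>Four-point metric spaces\<close>

text \<open>Gromov's four-point inequality serves both sides of the comparison: it mentions no
  geodesics and survives limits; it holds in hyperbolic space with a constant that rescaling drives
  to zero; and with constant zero it gives unique arcs. The tree metric is therefore an explicit
  formula identified with the limit of rescaled distances, and its triangle inequality, its
  zero-hyperbolicity and its invariance under the involutions are inherited from hyperbolic space.
  Only definiteness and the existence of geodesics are left to the combinatorics of words.

  The normalisation is prescribed by the minimal displacement, not by \<open>L\<close>. The same
  inequality shows that the two differ by a bounded amount.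

  The two dimensions differ by one sign: fixing one leg of a planar tripod and exchanging the others
  reverses the orientation of the plane, and in space the third coordinate can compensate for it.
  The involution c_2 need not be the image of a generator, being the conjugate of c_1 by s; three
  handles therefore suffice.\<close>

definition four_point :: "'a set \<Rightarrow> ('a \<Rightarrow> 'a \<Rightarrow> real) \<Rightarrow> real \<Rightarrow> bool" where
  "four_point X d \<delta> \<longleftrightarrow> (\<forall>x\<in>X. \<forall>y\<in>X. \<forall>z\<in>X. \<forall>w\<in>X.
     d x y + d z w \<le> max (d x z + d y w) (d x w + d y z) + \<delta>)"

lemma four_pointD:
  assumes "four_point X d \<delta>" "x \<in> X" "y \<in> X" "z \<in> X" "w \<in> X"
  shows "d x y + d z w \<le> max (d x z + d y w) (d x w + d y z) + \<delta>"
  using assms unfolding four_point_def by blast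

lemma geodesic_segment_point:
  assumes "geodesic_segment X d x y \<sigma>" "0 \<le> r" "r \<le> d x y"
  obtains q where "q \<in> \<sigma>" "q \<in> X" "d x q = r" "d q y = d x y - r"
proof -
  obtain c where c: "c ` {0..d x y} = \<sigma>" "\<sigma> \<subseteq> X" "c 0 = x" "c (d x y) = y"
    "\<And>s t. s \<in> {0..d x y} \<Longrightarrow> t \<in> {0..d x y} \<Longrightarrow> d (c s) (c t) = \<bar>s - t\<bar>"
    using assms(1) unfolding geodesic_segment_def by blast
  show ?thesis
  proof (rule that)
    show "c r \<in> \<sigma>" using c(1) assms by auto
    then show "c r \<in> X" using c(2) by auto
    show "d x (c r) = r" using c(5)[of 0 r] c(3) assms by auto
    show "d (c r) y = d x y - r" using c(5)[of r "d x y"] c(4) assms by auto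
  qed
qed

lemma geodesic_segment_between:
  assumes "geodesic_segment X d x y \<sigma>" "p \<in> \<sigma>"
  shows "p \<in> X" "d x p + d p y = d x y" "x \<in> X" "y \<in> X"
proof -
  obtain c where c: "c ` {0..d x y} = \<sigma>" "\<sigma> \<subseteq> X" "c 0 = x" "c (d x y) = y"
    "\<And>s t. s \<in> {0..d x y} \<Longrightarrow> t \<in> {0..d x y} \<Longrightarrow> d (c s) (c t) = \<bar>s - t\<bar>"
    using assms(1) unfolding geodesic_segment_def by blast
  obtain r where r: "r \<in> {0..d x y}" "p = c r" using assms(2) c(1) by auto
  show "p \<in> X" using assms(2) c(2) by auto
  show "d x p + d p y = d x y" using c(5)[of 0 r] c(5)[of r "d x y"] c(3,4) r by auto
  have "c 0 \<in> \<sigma>" "c (d x y) \<in> \<sigma>" using c(1) r(1) by auto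
  then show "x \<in> X" "y \<in> X" using c(2-4) by auto
qed

lemma geodesic_segment_trivial:
  assumes "x \<in> X" "d x x = 0"
  shows "geodesic_segment X d x x {x}"
  using assms unfolding geodesic_segment_def by (intro exI[of _ "\<lambda>_. x"]) auto

text \<open>A point almost between \<open>y\<close> and \<open>z\<close> is compared with the point
  of the segment at the same distance from \<open>y\<close>. One \<delta> is lost in the four-point
  inequality and one through \<open>close\<close>.\<close>

lemma four_point_thin_side:
  assumes M: "Metric_space X d" and F: "four_point X d \<delta>" and \<delta>: "0 \<le> \<delta>"
    and X: "p \<in> X" "z \<in> X" "y \<in> X"
    and close: "d p y + d p z \<le> d y z + \<delta>"
    and \<sigma>: "geodesic_segment X d y z \<sigma>"
  shows "\<exists>q\<in>\<sigma>. d p q \<le> 2 * \<delta>"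
proof -
  interpret Metric_space X d by fact
  \<comment> \<open>The minimum keeps \<open>?r\<close> within the segment when \<open>p\<close> is
    farther from \<open>y\<close> than \<open>z\<close> is; \<open>q\<close> is then
    \<open>z\<close>.\<close>
  let ?r = "min (d y p) (d y z)"
  obtain q where q: "q \<in> \<sigma>" "q \<in> X" "d y q = ?r" "d q z = d y z - ?r"
    using geodesic_segment_point[OF \<sigma>, of ?r] by auto
  have "d p q \<le> 2 * \<delta>"
  proof (cases "d y p \<le> d y z")
    case True
    then show ?thesis
      using four_pointD[OF F X(1) q(2) X(3) X(2)] q close commute[of y p] commute[of y q] \<delta> by linarith
  next
    case False
    then have "q = z" using q X by simp
    then show ?thesis using close False commute[of y p] \<delta> by simp
  qed
  then show ?thesis using q(1) by blast
qed

lemma geodesic_segment_commute: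
  assumes "Metric_space X d" "geodesic_segment X d x y \<sigma>"
  shows "geodesic_segment X d y x \<sigma>"
proof -
  interpret Metric_space X d by fact
  obtain c where c: "c ` {0..d x y} = \<sigma>" "\<sigma> \<subseteq> X" "c 0 = x" "c (d x y) = y"
    "\<And>s t. s \<in> {0..d x y} \<Longrightarrow> t \<in> {0..d x y} \<Longrightarrow> d (c s) (c t) = \<bar>s - t\<bar>"
    using assms(2) unfolding geodesic_segment_def by blast
  have "(\<lambda>t. d x y - t) ` {0..d x y} = {0..d x y}"
  proof -
    have "t \<in> (\<lambda>t. d x y - t) ` {0..d x y}" if "t \<in> {0..d x y}" for t
      using that by (intro image_eqI[of _ _ "d x y - t"]) auto
    then show ?thesis by auto
  qed
  then have "(\<lambda>t. c (d x y - t)) ` {0..d x y} = \<sigma>"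
    using c(1) by (metis image_image)
  then show ?thesis unfolding geodesic_segment_def commute[of y x]
    using c by (intro exI[of _ "\<lambda>t. c (d x y - t)"]) auto
qed

text \<open>The four-point inequality for the ends of a side, a point \<open>p\<close> on it and the
  opposite vertex \<open>z\<close> says that \<open>p\<close> lies, up to \<delta>, between
  \<open>z\<close> and one of the ends.\<close>

lemma four_point_thin_triangles:
  assumes M: "Metric_space X d" and F: "four_point X d \<delta>" and \<delta>: "0 \<le> \<delta>"
  shows "thin_triangles X d (2 * \<delta>)"
  unfolding thin_triangles_def
proof (intro ballI allI impI, elim conjE)
  fix x y z \<sigma> \<tau> \<upsilon> p
  assume X: "x \<in> X" "y \<in> X" "z \<in> X"
    and s: "geodesic_segment X d x y \<sigma>" "geodesic_segment X d y z \<tau>" "geodesic_segment X d z x \<upsilon>"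
    and p: "p \<in> \<sigma>"
  interpret Metric_space X d by fact
  note b = geodesic_segment_between[OF s(1) p]
  have "d p y + d p z \<le> d y z + \<delta> \<or> d p x + d p z \<le> d x z + \<delta>"
    using four_pointD[OF F X(1,2) b(1) X(3)] b(2) commute[of x p] commute[of y p] by linarith
  then show "\<exists>q\<in>\<tau> \<union> \<upsilon>. d p q \<le> 2 * \<delta>"
    using four_point_thin_side[OF M F \<delta> b(1) X(3,2) _ s(2)]
      four_point_thin_side[OF M F \<delta> b(1) X(3,1) _ geodesic_segment_commute[OF M s(3)]]
    by blast
qed

lemma hyperbolicity_constant_bounds:
  assumes M: "Metric_space X d" and F: "four_point X d \<delta>" and \<delta>: "0 \<le> \<delta>" and ne: "X \<noteq> {}"
  shows "0 \<le> hyperbolicity_constant X d" "hyperbolicity_constant X d \<le> 2 * \<delta>"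
proof -
  interpret Metric_space X d by fact
  obtain x where x: "x \<in> X" using ne by blast
  \<comment> \<open>The one-point triangle rules out negative bounds, so that the infimum is over a
    set bounded below.\<close>
  have seg: "geodesic_segment X d x x {x}" using x by (simp add: geodesic_segment_trivial)
  have nonneg: "0 \<le> e" if "thin_triangles X d e" for e
    using that x seg unfolding thin_triangles_def by fastforce
  have mem: "2 * \<delta> \<in> {e. thin_triangles X d e}"
    using four_point_thin_triangles[OF M F \<delta>] by simp
  show "0 \<le> hyperbolicity_constant X d" unfolding hyperbolicity_constant_def
    by (rule cInf_greatest) (use mem nonneg in auto)
  show "hyperbolicity_constant X d \<le> 2 * \<delta>" unfolding hyperbolicity_constant_def
    by (rule cInf_lower[OF mem]) (use nonneg in \<open>auto intro!: bdd_belowI\<close>)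
qed

text \<open>A point \<open>c\<close> between \<open>u\<close> and \<open>v\<close> separates them:
  the points that are strictly closer to \<open>u\<close> than the way through \<open>c\<close>, and
  the points other than \<open>c\<close> that are not, form two disjoint open sets.\<close>

lemma zero_hyp_path_meets:
  assumes M: "Metric_space X d" and F: "four_point X d 0"
    and path: "connectedin (Metric_space.mtopology X d) S" and uv: "u \<in> S" "v \<in> S"
    and c: "c \<in> X" "d u c + d c v = d u v"
  shows "c \<in> S"
proof (rule ccontr)
  assume nc: "c \<notin> S"
  interpret Metric_space X d by fact
  have SX: "S \<subseteq> X" using connectedin_subset_topspace[OF path] by simp
  define C where "C = {w \<in> X. d u w < d u c + d c w}"
  define D where "D = {w \<in> X. w \<noteq> c \<and> d u c + d c w \<le> d u w}"
  have uX: "u \<in> X" "v \<in> X" using uv SX by auto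
  text \<open>Two points of a zero-hyperbolic space closer to each other than to \<open>c\<close> lie on the same side of \<open>c\<close>.\<close>
  have step: "d u w' < d u c + d c w'"
    if "d u w < d u c + d c w" "d w w' < d c w" "w \<in> X" "w' \<in> X" for w w'
    using four_pointD[OF F uX(1) that(4) that(3) c(1)] that commute[of w c] commute[of w' c] commute[of w w'] nonneg[of c w']
    by linarith
  have "openin mtopology C"
    unfolding openin_mtopology
  proof (intro conjI ballI allI impI)
    show "C \<subseteq> X" by (auto simp: C_def)
    fix w assume w: "w \<in> C"
    then have "0 < d c w" using triangle[of u c w] uX c(1) by (auto simp: C_def)
    then show "\<exists>r>0. mball w r \<subseteq> C"
      using w step[of w] by (intro exI[of _ "d c w"]) (auto simp: C_def)
  qed
  moreover have "openin mtopology D"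
    unfolding openin_mtopology
  proof (intro conjI ballI allI impI)
    show "D \<subseteq> X" by (auto simp: D_def)
    fix w assume w: "w \<in> D"
    then have pos: "0 < d c w" using c(1) by (auto simp: D_def)
    \<comment> \<open>Half the radius makes \<open>w\<close> closer to \<open>w'\<close> than
      \<open>c\<close> is, so that \<open>step\<close> from \<open>w'\<close> to \<open>w\<close>
      would put \<open>w\<close> into \<open>C\<close> if \<open>w'\<close> were there.\<close>
    have "w' \<in> D" if w': "w' \<in> X" "d w w' < d c w / 2" for w'
    proof -
      have "d w' w < d c w'" using triangle[of c w' w] w w' c(1) pos commute[of w w'] by (auto simp: D_def)
      moreover have "w' \<noteq> c" using w' pos commute[of w c] by auto
      ultimately show ?thesis using step[of w' w] w w' by (force simp: D_def)
    qed
    then show "\<exists>r>0. mball w r \<subseteq> D"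
      using pos by (intro exI[of _ "d c w / 2"]) auto
  qed
  moreover have "S \<subseteq> C \<union> D" using SX nc by (auto simp: C_def D_def)
  moreover have "C \<inter> D = {}" by (auto simp: C_def D_def)
  moreover have "u \<in> C" using uX nc uv c(1) by (auto simp: C_def commute)
  moreover have "v \<in> D" using uX nc uv c by (auto simp: D_def)
  ultimately show False using path uv unfolding connectedin by blast
qed

lemma zero_hyp_median:
  assumes M: "Metric_space X d" and F: "four_point X d 0"
    and X: "x \<in> X" "y \<in> X" "u \<in> X" and \<sigma>: "geodesic_segment X d x y \<sigma>"
  obtains c where "c \<in> \<sigma>" "d x c + d c u = d x u" "d u c + d c y = d u y"
proof -
  interpret Metric_space X d by fact
  \<comment> \<open>The Gromov product of \<open>y\<close> and \<open>u\<close> at \<open>x\<close>: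
    the distance from \<open>x\<close> at which the ways to \<open>y\<close> and to \<open>u\<close>
    part.\<close>
  let ?r = "(d x y + d x u - d u y) / 2"
  have r: "0 \<le> ?r" "?r \<le> d x y"
    using triangle[of u x y] triangle[of x y u] X commute[of y u] commute[of u x] by auto
  obtain c where c: "c \<in> \<sigma>" "c \<in> X" "d x c = ?r" "d c y = d x y - ?r"
    using geodesic_segment_point[OF \<sigma> r] .
  have "d x y + d c u \<le> max (d x c + d y u) (d x u + d y c)"
    using four_pointD[OF F X(1,2) c(2) X(3)] by simp
  then have "d x c + d c u = d x u" "d u c + d c y = d u y"
    using c commute[of y u] commute[of y c] commute[of c u] triangle[of x c u] triangle[of u c y] X
    by (auto simp: field_simps)
  with c(1) that show ?thesis by blast
qed

text \<open>The segment lies on the arc because its points separate the ends. Conversely, the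
  projection \<open>c\<close> of a point \<open>p t\<close> to the segment is met by the path both
  up to time \<open>t\<close> and from time \<open>t\<close> on; injectivity makes \<open>t\<close>
  the only possible time, so \<open>p t = c\<close>.\<close>

lemma zero_hyp_arc:
  assumes M: "Metric_space X d" and F: "four_point X d 0"
    and \<sigma>: "geodesic_segment X d x y \<sigma>"
    and p: "pathin (Metric_space.mtopology X d) p" "inj_on p {0..1}" "p 0 = x" "p 1 = y"
  shows "p ` {0..1} = \<sigma>"
proof -
  interpret Metric_space X d by fact
  have cont: "connectedin mtopology (p ` {a..b})" if "0 \<le> a" "b \<le> 1" for a b
  proof -
    have "continuous_map (top_of_set {0..1}) mtopology p" using p(1) by (simp add: pathin_def)
    then show ?thesis
      by (rule connectedin_continuous_map_image)
         (use that in \<open>auto simp: connectedin_subtopology connectedin_absolute\<close>)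
  qed
  have pX: "p t \<in> X" if "t \<in> {0..1}" for t
    using path_image_subset_topspace[OF p(1)] that by (auto simp: image_subset_iff)
  have xy: "x \<in> X" "y \<in> X" using pX[of 0] pX[of 1] p by auto
  have meet: "c \<in> p ` {a..b}"
    if "0 \<le> a" "a \<le> b" "b \<le> 1" "c \<in> X" "d (p a) c + d c (p b) = d (p a) (p b)" for a b c
    by (rule zero_hyp_path_meets[OF M F cont[OF that(1,3)] imageI imageI that(4,5)])
       (use that in simp_all)
  show ?thesis
  proof
    show "\<sigma> \<subseteq> p ` {0..1}"
    proof
      fix c assume "c \<in> \<sigma>"
      from geodesic_segment_between[OF \<sigma> this] show "c \<in> p ` {0..1}"
        using meet[of 0 1 c] p(3,4) by simp
    qed
    show "p ` {0..1} \<subseteq> \<sigma>"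
    proof
      fix u assume "u \<in> p ` {0..1}"
      then obtain t where t: "t \<in> {0..1}" and u: "u = p t" ..
      obtain c where c: "c \<in> \<sigma>" "d x c + d c (p t) = d x (p t)" "d (p t) c + d c y = d (p t) y"
        using zero_hyp_median[OF M F xy pX[OF t] \<sigma>] .
      have cX: "c \<in> X" using geodesic_segment_between(1)[OF \<sigma> c(1)] .
      have "c \<in> p ` {0..t}" using meet[of 0 t c] p(3) c(2) cX t by simp
      moreover have "c \<in> p ` {t..1}" using meet[of t 1 c] p(4) c(3) cX t by simp
      ultimately obtain a b where ab: "a \<in> {0..t}" "b \<in> {t..1}" "p a = c" "p b = c" by (metis imageE)
      then have "a = b" by (intro inj_onD[OF p(2)]) (use t in auto)
      then show "u \<in> \<sigma>" using ab c(1) u by auto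
    qed
  qed
qed

lemma zero_hyp_R_tree:
  assumes M: "Metric_space X d" and F: "four_point X d 0"
    and geo: "\<And>x y. x \<in> X \<Longrightarrow> y \<in> X \<Longrightarrow> \<exists>\<sigma>. geodesic_segment X d x y \<sigma>"
  shows "R_tree X d"
  unfolding R_tree_def
proof (intro conjI ballI allI impI M)
  fix x y assume "x \<in> X" "y \<in> X"
  then show "\<exists>\<sigma>. geodesic_segment X d x y \<sigma>" by (rule geo)
  then obtain \<sigma> where \<sigma>: "geodesic_segment X d x y \<sigma>" ..
  fix p q
  assume "pathin (Metric_space.mtopology X d) p \<and> inj_on p {0..1} \<and> p 0 = x \<and> p 1 = y \<and>
    pathin (Metric_space.mtopology X d) q \<and> inj_on q {0..1} \<and> q 0 = x \<and> q 1 = y"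
  then show "p ` {0..1} = q ` {0..1}"
    using zero_hyp_arc[OF M F \<sigma>, of p] zero_hyp_arc[OF M F \<sigma>, of q] by simp
qed

text \<open>The point of the segment at the same distance from \<open>x\<close> is at distance zero
  from \<open>p\<close>. In the proof of minimality this makes a subtree, which contains some
  segment between any two of its points, convex in the whole tree.\<close>

lemma zero_hyp_between_mem:
  assumes M: "Metric_space X d" and F: "four_point X d 0"
    and \<sigma>: "geodesic_segment X d x y \<sigma>" and p: "p \<in> X" "d x p + d p y = d x y"
  shows "p \<in> \<sigma>"
proof -
  interpret Metric_space X d by fact
  have xX: "x \<in> X" "y \<in> X"
    using \<sigma> geodesic_segment_point[OF \<sigma>, of 0] geodesic_segment_between(3,4)[OF \<sigma>] nonneg[of x y] by blast+
  obtain q where q: "q \<in> \<sigma>" "q \<in> X" "d x q = d x p" "d q y = d x y - d x p"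
    using geodesic_segment_point[OF \<sigma>, of "d x p"] p(2) nonneg[of x p] nonneg[of p y] by (metis add_increasing2 le_add_same_cancel1)
  have "d p q \<le> 0"
    using four_pointD[OF F p(1) q(2) xX] q p(2) commute[of x p] commute[of x q] by auto
  then show ?thesis using q p(1) nonneg[of p q] by simp
qed

section \<open>Hyperbolic geometry of the ball\<close>

lemma hyp_spaceD: "x \<in> hyp_space \<Longrightarrow> 0 < 1 - (norm x)\<^sup>2"
  by (simp add: hyp_space_def abs_square_less_1)

lemma cosh_hyp_dist:
  assumes "x \<in> hyp_space" "y \<in> hyp_space"
  shows "cosh (hyp_dist x y) = 1 + 2 * (norm (x - y))\<^sup>2 / ((1 - (norm x)\<^sup>2) * (1 - (norm y)\<^sup>2))"
  unfolding hyp_dist_def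
  using hyp_spaceD[OF assms(1)] hyp_spaceD[OF assms(2)] by (intro cosh_arcosh_real) simp

lemma cosh_hyp_dist_inner:
  assumes "x \<in> hyp_space" "y \<in> hyp_space"
  shows "cosh (hyp_dist x y) =
    ((1 + (norm x)\<^sup>2) * (1 + (norm y)\<^sup>2) - 4 * (x \<bullet> y)) / ((1 - (norm x)\<^sup>2) * (1 - (norm y)\<^sup>2))"
  unfolding cosh_hyp_dist[OF assms] using hyp_spaceD[OF assms(1)] hyp_spaceD[OF assms(2)]
  by (simp add: divide_simps power2_norm_eq_inner) (simp add: algebra_simps inner_commute)

lemma hyp_dist_nonneg:
  assumes "x \<in> hyp_space" "y \<in> hyp_space"
  shows "0 \<le> hyp_dist x y"
  unfolding hyp_dist_def
  using hyp_spaceD[OF assms(1)] hyp_spaceD[OF assms(2)] by (simp add: arcosh_nonneg_real)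

lemma cosh_le_cosh: "0 \<le> b \<Longrightarrow> cosh a \<le> cosh b \<Longrightarrow> a \<le> b" for a b :: real
  by (metis abs_ge_self abs_of_nonneg cosh_real_abs cosh_real_nonneg_le_iff abs_ge_zero order_trans)

lemma cosh_eq_imp_eq: "0 \<le> a \<Longrightarrow> 0 \<le> b \<Longrightarrow> cosh a = cosh b \<Longrightarrow> a = b" for a b :: real
  using cosh_le_cosh[of b a] cosh_le_cosh[of a b] by linarith

lemma hyp_dist_commute: "hyp_dist x y = hyp_dist y x"
  by (simp add: hyp_dist_def norm_minus_commute mult.commute)

lemma hyp_dist_eq_0_iff:
  assumes "x \<in> hyp_space" "y \<in> hyp_space"
  shows "hyp_dist x y = 0 \<longleftrightarrow> x = y"
proof
  assume "hyp_dist x y = 0"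
  then have "cosh (hyp_dist x y) = 1" by simp
  then show "x = y"
    unfolding cosh_hyp_dist[OF assms] using hyp_spaceD[OF assms(1)] hyp_spaceD[OF assms(2)] by auto
qed (simp add: hyp_dist_def)

section \<open>Hyperbolic reflections as inversions, and the triangle inequality\<close>

text \<open>Inversion in the sphere about \<open>c\<close> of radius
  \<open>sqrt ((norm c)^2 - 1)\<close>. For \<open>norm c > 1\<close> this sphere is orthogonal to
  the unit sphere, so that the inversion is a reflection of hyperbolic space in a
  hyperplane.\<close>

definition reflect :: "real ^ 'n \<Rightarrow> real ^ 'n \<Rightarrow> real ^ 'n" where
  "reflect c x = c + (((norm c)\<^sup>2 - 1) / (norm (x - c))\<^sup>2) *\<^sub>R (x - c)"

lemma reflect_diff:
  assumes "x \<noteq> c" "y \<noteq> c"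
  shows "(norm (reflect c x - reflect c y))\<^sup>2 =
    ((norm c)\<^sup>2 - 1)\<^sup>2 * (norm (x - y))\<^sup>2 / ((norm (x - c))\<^sup>2 * (norm (y - c))\<^sup>2)"
proof -
  define a b r where "a = x - c" and "b = y - c" and "r = (norm c)\<^sup>2 - 1"
  have ab: "a \<noteq> 0" "b \<noteq> 0" "x - y = a - b" using assms by (auto simp: a_def b_def)
  have "reflect c x - reflect c y = (r / (norm a)\<^sup>2) *\<^sub>R a - (r / (norm b)\<^sup>2) *\<^sub>R b"
    by (simp add: reflect_def a_def b_def r_def)
  moreover have "(norm ((r / (norm a)\<^sup>2) *\<^sub>R a - (r / (norm b)\<^sup>2) *\<^sub>R b))\<^sup>2 =
      r\<^sup>2 * (norm (a - b))\<^sup>2 / ((norm a)\<^sup>2 * (norm b)\<^sup>2)"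
  proof -
    have "(r / u) * ((r / u) * u - (r / v) * s) - (r / v) * ((r / u) * s - (r / v) * v) =
        r\<^sup>2 * (u - s - (s - v)) / (u * v)" if "u \<noteq> 0" "v \<noteq> 0" for u v s
      using that by (simp add: divide_simps power2_eq_square) (simp add: algebra_simps)
    from this[of "a \<bullet> a" "b \<bullet> b" "a \<bullet> b"] show ?thesis
      using ab(1,2) by (simp only: power2_norm_eq_inner inner_diff_left inner_diff_right inner_scaleR_left
        inner_scaleR_right inner_commute[of b a] inner_eq_zero_iff simp_thms)
  qed
  ultimately show ?thesis unfolding ab(3)[symmetric] by (simp only: a_def b_def r_def)
qed

lemma reflect_norm:
  assumes "x \<noteq> c"
  shows "1 - (norm (reflect c x))\<^sup>2 = ((norm c)\<^sup>2 - 1) * (1 - (norm x)\<^sup>2) / (norm (x - c))\<^sup>2"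
proof -
  define a r where "a = x - c" and "r = (norm c)\<^sup>2 - 1"
  have a: "a \<noteq> 0" "x = a + c" using assms by (auto simp: a_def)
  have c: "c \<bullet> c = r + 1" by (simp add: r_def power2_norm_eq_inner)
  define k where "k = r / (norm a)\<^sup>2"
  have "k * (norm a)\<^sup>2 = r" using a(1) by (simp add: k_def)
  then have k: "k * (a \<bullet> a) = r" by (simp add: power2_norm_eq_inner)
  have "reflect c x = c + k *\<^sub>R a" by (simp add: reflect_def a_def r_def k_def)
  then have "1 - (norm (reflect c x))\<^sup>2 = 1 - (c \<bullet> c + 2 * k * (c \<bullet> a) + k * (k * (a \<bullet> a)))"
    by (simp only: power2_norm_eq_inner inner_add_left inner_add_right inner_scaleR_left
        inner_scaleR_right inner_commute[of a c]) (simp add: algebra_simps)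
  also have "\<dots> = - r - 2 * k * (c \<bullet> a) - k * r" unfolding c k by simp
  also have "\<dots> = k * (1 - (a \<bullet> a + 2 * (c \<bullet> a) + c \<bullet> c))" using k unfolding c by (simp add: algebra_simps)
  also have "\<dots> = k * (1 - (norm x)\<^sup>2)"
    by (simp only: a(2) power2_norm_eq_inner inner_add_left inner_add_right inner_commute[of a c] mult_2 add.assoc)
  finally show ?thesis by (simp add: a_def r_def k_def)
qed

lemma reflect_in:
  assumes "1 < norm c" "x \<in> hyp_space"
  shows "reflect c x \<in> hyp_space"
proof -
  have "x \<noteq> c" using assms by (auto simp: hyp_space_def)
  then have "0 < 1 - (norm (reflect c x))\<^sup>2"
    unfolding reflect_norm[OF \<open>x \<noteq> c\<close>] using assms hyp_spaceD[OF assms(2)]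
    by (intro divide_pos_pos mult_pos_pos) (auto simp: power_gt1 one_less_power)
  then show ?thesis by (simp add: hyp_space_def abs_square_less_1)
qed

lemma reflect_involution:
  assumes "1 < norm c" "x \<noteq> c"
  shows "reflect c (reflect c x) = x"
proof -
  define a r where "a = x - c" and "r = (norm c)\<^sup>2 - 1"
  have a: "a \<noteq> 0" using assms by (auto simp: a_def)
  have r: "r \<noteq> 0" using assms(1) by (simp add: r_def power2_eq_1_iff)
  have "reflect c x - c = (r / (norm a)\<^sup>2) *\<^sub>R a" by (simp add: reflect_def a_def r_def)
  then have "reflect c (reflect c x) =
      c + (r / (norm ((r / (norm a)\<^sup>2) *\<^sub>R a))\<^sup>2) *\<^sub>R (r / (norm a)\<^sup>2) *\<^sub>R a"
    by (simp only: reflect_def[of c "reflect c x"] r_def)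
  also have "\<dots> = c + a" using a r by (simp add: power_mult_distrib power2_eq_square)
  finally show ?thesis by (simp add: a_def)
qed

lemma hyp_dist_reflect:
  assumes c: "1 < norm c" and x: "x \<in> hyp_space" and y: "y \<in> hyp_space"
  shows "hyp_dist (reflect c x) (reflect c y) = hyp_dist x y"
proof -
  have ne: "x \<noteq> c" "y \<noteq> c" using assms by (auto simp: hyp_space_def)
  have r: "(norm c)\<^sup>2 - 1 \<noteq> 0" using c by (simp add: power2_eq_1_iff)
  have "2 * (r\<^sup>2 * N / (p * q)) / (r * a / p * (r * b / q)) = 2 * N / (a * b)"
    if "r \<noteq> 0" "p \<noteq> 0" "q \<noteq> 0" for r N p q a b :: real
    using that by (simp add: power2_eq_square)
  from this[of "(norm c)\<^sup>2 - 1" "(norm (x - c))\<^sup>2" "(norm (y - c))\<^sup>2"] show ?thesis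
    unfolding hyp_dist_def reflect_diff[OF ne] reflect_norm[OF ne(1)] reflect_norm[OF ne(2)]
    using ne r by (simp del: times_divide_eq_left times_divide_eq_right divide_divide_eq_left divide_divide_eq_right)
qed

text \<open>The centre is the inverse of \<open>y\<close> in the unit sphere. Any point can thus be
  moved to the origin, where distances are explicit.\<close>

lemma reflect_to_0:
  assumes "y \<in> hyp_space" "y \<noteq> 0"
  obtains c where "1 < norm c" "reflect c y = 0" "reflect c 0 = y"
proof -
  define c where "c = (1 / (norm y)\<^sup>2) *\<^sub>R y"
  have n: "norm c = 1 / norm y" using assms by (simp add: c_def power2_eq_square)
  have y: "norm y < 1" "0 < norm y" using assms by (auto simp: hyp_space_def)
  then have c1: "1 < norm c" by (simp add: n field_simps)
  have 0: "reflect c 0 = y"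
  proof -
    have "((norm c)\<^sup>2 - 1) / (norm c)\<^sup>2 = 1 - (norm y)\<^sup>2" using y by (simp add: n field_simps)
    then show ?thesis using y
      by (simp add: reflect_def scaleR_left_diff_distrib) (simp add: c_def)
  qed
  moreover have "reflect c y = 0"
    using reflect_involution[OF c1, of 0] 0 c1 by fastforce
  ultimately show ?thesis using that c1 by blast
qed

lemma zero_in_hyp_space [simp]: "0 \<in> hyp_space"
  by (simp add: hyp_space_def)

text \<open>The middle point is moved to the origin. There Cauchy-Schwarz replaces
  \<open>u \<bullet> v\<close> by \<open>- norm u * norm v\<close>, the value for opposite
  directions, and the addition formula for \<open>cosh\<close> takes over.\<close>

lemma hyp_dist_triangle:
  assumes x: "x \<in> hyp_space" and y: "y \<in> hyp_space" and z: "z \<in> hyp_space"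
  shows "hyp_dist x z \<le> hyp_dist x y + hyp_dist y z"
proof -
  have origin: "hyp_dist u v \<le> hyp_dist u 0 + hyp_dist 0 v" if u: "u \<in> hyp_space" and v: "v \<in> hyp_space" for u v :: "real ^ 'n"
  proof (rule cosh_le_cosh)
    let ?a = "1 - (norm u)\<^sup>2" and ?b = "1 - (norm v)\<^sup>2"
    note pos = hyp_spaceD[OF u] hyp_spaceD[OF v]
    show "0 \<le> hyp_dist u 0 + hyp_dist 0 v" using u v by (intro add_nonneg_nonneg hyp_dist_nonneg) auto
    have c: "cosh (hyp_dist u 0) = (1 + (norm u)\<^sup>2) / ?a" "cosh (hyp_dist 0 v) = (1 + (norm v)\<^sup>2) / ?b"
      using u v by (simp_all add: cosh_hyp_dist_inner)
    have sinh: "sinh t = 2 * n / (1 - n\<^sup>2)" if "0 \<le> t" "cosh t = (1 + n\<^sup>2) / (1 - n\<^sup>2)" "0 < 1 - n\<^sup>2" "0 \<le> n" for t n :: real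
    proof -
      have "(sinh t)\<^sup>2 = (2 * n / (1 - n\<^sup>2))\<^sup>2"
      proof -
        have "((1 + m) / (1 - m))\<^sup>2 - 1 = 4 * m / (1 - m)\<^sup>2" if "1 - m \<noteq> 0" for m :: real
          using that by (simp add: divide_simps power2_eq_square) (simp add: algebra_simps)
        then show ?thesis using that(3) by (simp add: sinh_square_eq that(2) power_divide power_mult_distrib)
      qed
      then show ?thesis using that by (simp add: power2_eq_iff_nonneg)
    qed
    have s: "sinh (hyp_dist u 0) = 2 * norm u / ?a" "sinh (hyp_dist 0 v) = 2 * norm v / ?b"
      using sinh u v c pos hyp_dist_nonneg[of u 0] hyp_dist_nonneg[of 0 v] by simp_all
    have "cosh (hyp_dist u v) \<le> ((1 + (norm u)\<^sup>2) * (1 + (norm v)\<^sup>2) + 4 * (norm u * norm v)) / (?a * ?b)"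
      unfolding cosh_hyp_dist_inner[OF u v] using pos Cauchy_Schwarz_ineq2[of u v]
      by (intro divide_right_mono) auto
    also have "\<dots> = cosh (hyp_dist u 0 + hyp_dist 0 v)"
      unfolding cosh_add c s times_divide_times_eq add_divide_distrib[symmetric] by (simp add: algebra_simps)
    finally show "cosh (hyp_dist u v) \<le> cosh (hyp_dist u 0 + hyp_dist 0 v)" .
  qed
  show ?thesis
  proof (cases "y = 0")
    case True
    then show ?thesis using origin[OF x z] by simp
  next
    case False
    obtain c where c: "1 < norm c" "reflect c y = 0" using reflect_to_0[OF y False] .
    show ?thesis
      using origin[OF reflect_in[OF c(1) x] reflect_in[OF c(1) z]]
        hyp_dist_reflect[OF c(1) x z] hyp_dist_reflect[OF c(1) x y]
        hyp_dist_reflect[OF c(1) y z] c(2) by simp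
  qed
qed


section \<open>Gromov hyperbolicity of hyperbolic space\<close>

text \<open>A multiplicative four-point inequality. In the cycle \<open>x\<close>, \<open>z\<close>,
  \<open>y\<close>, \<open>w\<close> the shortest side is at most each of its two neighbours; going
  through it bounds each of the two diagonals \<open>p x y\<close> and \<open>p z w\<close> by four
  times one of these neighbours, whence 16.\<close>

lemma quasi_metric_ptolemy:
  fixes p :: "'a \<Rightarrow> 'a \<Rightarrow> real"
  assumes sym: "\<And>x y. p x y = p y x" and nonneg: "\<And>x y. x \<in> X \<Longrightarrow> y \<in> X \<Longrightarrow> 0 \<le> p x y"
    and quasi: "\<And>x y z. x \<in> X \<Longrightarrow> y \<in> X \<Longrightarrow> z \<in> X \<Longrightarrow> p x y \<le> 2 * (p x z + p z y)"
    and X: "x \<in> X" "y \<in> X" "z \<in> X" "w \<in> X"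
  shows "p x y * p z w \<le> 16 * max (p x z * p y w) (p x w * p y z)"
proof -
  have q: "p x y \<le> 2 * (p x z + p y z)" "p x y \<le> 2 * (p x w + p y w)"
    "p z w \<le> 2 * (p x z + p x w)" "p z w \<le> 2 * (p y z + p y w)"
    using quasi[OF X(1,2,3)] quasi[OF X(1,2,4)] quasi[OF X(3,4,1)] quasi[OF X(3,4,2)]
    by (simp_all only: sym[of z y] sym[of z x] sym[of w y])
  consider "p x z \<le> p y z" "p x z \<le> p x w" | "p y w \<le> p x w" "p y w \<le> p y z"
    | "p x w \<le> p y w" "p x w \<le> p x z" | "p y z \<le> p x z" "p y z \<le> p y w"
    by linarith
  then have "p x y \<le> 4 * p y z \<and> p z w \<le> 4 * p x w \<or> p x y \<le> 4 * p x w \<and> p z w \<le> 4 * p y z \<or>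
        p x y \<le> 4 * p y w \<and> p z w \<le> 4 * p x z \<or> p x y \<le> 4 * p x z \<and> p z w \<le> 4 * p y w"
    by cases (use q in \<open>smt (verit)\<close>)+
  moreover have prod: "p x y * p z w \<le> 16 * (a * b)" if "p x y \<le> 4 * a" "p z w \<le> 4 * b" for a b
    using mult_mono[OF that] nonneg[OF X(1,2)] nonneg[OF X(3,4)] that(1) by simp
  ultimately have "p x y * p z w \<le> 16 * (p x z * p y w) \<or> p x y * p z w \<le> 16 * (p x w * p y z)"
    using prod[of "p y z" "p x w"] prod[of "p x w" "p y z"] prod[of "p y w" "p x z"] prod[of "p x z" "p y w"]
    by (auto simp: mult.commute)
  then show ?thesis by (simp add: max_def) linarith
qed

text \<open>Up to a factor depending on each point separately, this is \<open>cosh (hyp_dist x y / 2)\<close>.\<close>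

definition half_cosh :: "real ^ 'n \<Rightarrow> real ^ 'n \<Rightarrow> real" where
  "half_cosh x y = sqrt ((norm (x - y))\<^sup>2 + (1 - (norm x)\<^sup>2) * (1 - (norm y)\<^sup>2))"

lemma half_cosh_nonneg: "x \<in> hyp_space \<Longrightarrow> y \<in> hyp_space \<Longrightarrow> 0 \<le> half_cosh x y"
  unfolding half_cosh_def using hyp_spaceD[of x] hyp_spaceD[of y] by simp

text \<open>Call \<open>1 - (norm x)^2\<close> the height of \<open>x\<close>. Then
  \<open>half_cosh x y\<close> is at least the Euclidean distance and at most that distance plus the
  mean of the two heights; half a height is in turn at most \<open>half_cosh\<close> to any third
  point. One factor pays for the distance, the other for the heights.\<close>

lemma half_cosh_quasi_metric:
  fixes x y z :: "real ^ 'n"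
  assumes X: "x \<in> hyp_space" "y \<in> hyp_space" "z \<in> hyp_space"
  shows "half_cosh x y \<le> 2 * (half_cosh x z + half_cosh z y)"
proof -
  \<comment> \<open>Either \<open>z\<close> is far from \<open>u\<close> in the Euclidean sense, or
    its own height is comparable to that of \<open>u\<close>; completing a square combines the
    two.\<close>
  have height: "(1 - (norm u)\<^sup>2) / 2 \<le> half_cosh u z" if u: "u \<in> hyp_space" for u :: "real ^ 'n"
    unfolding half_cosh_def
  proof (rule real_le_rsqrt)
    let ?a = "1 - (norm u)\<^sup>2" and ?c = "1 - (norm z)\<^sup>2" and ?t = "norm (u - z)"
    have n: "norm u < 1" "norm z < 1" using u X by (auto simp: hyp_space_def)
    have "?a = (1 - norm u) * (1 + norm u)" by (simp add: algebra_simps power2_eq_square)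
    also have "\<dots> \<le> (1 - norm u) * 2" using n by (intro mult_left_mono) auto
    finally have "?a / 2 \<le> 1 - norm u" by simp
    moreover have "(norm z)\<^sup>2 \<le> norm z" using n by (simp add: power2_eq_square mult_left_le)
    moreover have "norm z \<le> norm u + ?t" using norm_triangle_ineq4[of u "u - z"] by simp
    ultimately have "?a / 2 - ?t \<le> ?c" by linarith
    then have "?a * (?a / 2 - ?t) \<le> ?a * ?c" using hyp_spaceD[OF u] by (intro mult_left_mono) auto
    moreover have "(a / 2)\<^sup>2 + (t - a / 2)\<^sup>2 = t\<^sup>2 + a * (a / 2 - t)" for a t :: real
      by (simp add: power2_eq_square field_simps)
    from this[of ?a ?t] have "(?a / 2)\<^sup>2 + (?t - ?a / 2)\<^sup>2 = ?t\<^sup>2 + ?a * (?a / 2 - ?t)" .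
    ultimately show "(?a / 2)\<^sup>2 \<le> ?t\<^sup>2 + ?a * ?c" using zero_le_power2[of "?t - ?a / 2"] by linarith
  qed
  have diff: "norm (u - v) \<le> half_cosh u v" if "u \<in> hyp_space" "v \<in> hyp_space" for u v :: "real ^ 'n"
    unfolding half_cosh_def using hyp_spaceD[OF that(1)] hyp_spaceD[OF that(2)] by (intro real_le_rsqrt) simp
  let ?a = "1 - (norm x)\<^sup>2" and ?b = "1 - (norm y)\<^sup>2"
  have pos: "0 < ?a" "0 < ?b" using hyp_spaceD X by auto
  have "half_cosh x y \<le> sqrt ((norm (x - y))\<^sup>2) + sqrt (?a * ?b)"
    unfolding half_cosh_def using pos by (intro sqrt_add_le_add_sqrt) auto
  also have "\<dots> \<le> norm (x - y) + (?a + ?b) / 2" using arith_geo_mean_sqrt[of ?a ?b] pos by simp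
  also have "\<dots> \<le> (norm (x - z) + norm (z - y)) + (half_cosh x z + half_cosh y z)"
    using height[OF X(1)] height[OF X(2)] norm_triangle_ineq[of "x - z" "z - y"]
    by (simp add: add_divide_distrib diff_divide_distrib)
  also have "\<dots> \<le> 2 * (half_cosh x z + half_cosh z y)"
    using diff[OF X(1,3)] diff[OF X(3,2)] by (simp add: half_cosh_def norm_minus_commute mult.commute)
  finally show ?thesis .
qed

lemma cosh_half_hyp_dist:
  assumes "x \<in> hyp_space" "y \<in> hyp_space"
  shows "cosh (hyp_dist x y / 2) = half_cosh x y / (sqrt (1 - (norm x)\<^sup>2) * sqrt (1 - (norm y)\<^sup>2))"
proof -
  let ?a = "1 - (norm x)\<^sup>2" and ?b = "1 - (norm y)\<^sup>2"
  have pos: "0 < ?a" "0 < ?b" using hyp_spaceD assms by auto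
  have "cosh (hyp_dist x y) = 2 * (cosh (hyp_dist x y / 2))\<^sup>2 - 1"
    using cosh_double_cosh[of "hyp_dist x y / 2"] by simp
  then have "(cosh (hyp_dist x y / 2))\<^sup>2 = ((norm (x - y))\<^sup>2 + ?a * ?b) / (?a * ?b)"
    using pos unfolding cosh_hyp_dist[OF assms] by (simp add: add_divide_distrib)
  then have "cosh (hyp_dist x y / 2) = sqrt (((norm (x - y))\<^sup>2 + ?a * ?b) / (?a * ?b))"
    by (metis cosh_real_nonneg real_sqrt_abs abs_of_nonneg)
  then show ?thesis by (simp add: half_cosh_def real_sqrt_divide real_sqrt_mult)
qed

text \<open>The number 64 is the 16 of \<open>quasi_metric_ptolemy\<close> times 4, from using
  \<open>exp t \<le> 2 * cosh t\<close> for two distances; the factor 2 undoes the halving of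
  distances.\<close>

definition hyp_delta :: real where "hyp_delta = 2 * ln 64"

lemma hyp_delta_nonneg: "0 \<le> hyp_delta"
  by (simp add: hyp_delta_def)

text \<open>Each of the three products of opposite sides involves every point once. The weights
  relating \<open>half_cosh\<close> to the \<open>cosh\<close> of half the distance are therefore
  the same \<open>?N\<close> in all three, and cancel; logarithms give the additive form.\<close>

lemma four_point_hyp: "four_point (hyp_space :: (real ^ 'n) set) hyp_dist hyp_delta"
  unfolding four_point_def
proof (intro ballI)
  fix x y z w :: "real ^ 'n"
  assume X: "x \<in> hyp_space" "y \<in> hyp_space" "z \<in> hyp_space" "w \<in> hyp_space"
  let ?k = "\<lambda>x y. cosh (hyp_dist x y / 2)"
  let ?s = "\<lambda>x::real^'n. sqrt (1 - (norm x)\<^sup>2)"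
  have pos: "0 < ?s u" if "u \<in> hyp_space" for u using hyp_spaceD[OF that] by simp
  let ?N = "?s x * ?s y * (?s z * ?s w)"
  have N: "0 < ?N" using pos X by simp
  have *: "half_cosh x y * half_cosh z w \<le> 16 * max (half_cosh x z * half_cosh y w) (half_cosh x w * half_cosh y z)"
  proof (rule quasi_metric_ptolemy[of half_cosh hyp_space])
    show "half_cosh u v = half_cosh v u" for u v :: "real ^ 'n"
      by (simp add: half_cosh_def norm_minus_commute mult.commute)
    show "half_cosh u v \<le> 2 * (half_cosh u t + half_cosh t v)"
      if "u \<in> hyp_space" "v \<in> hyp_space" "t \<in> hyp_space" for u v t :: "real ^ 'n"
      using that by (rule half_cosh_quasi_metric)
  qed (use X half_cosh_nonneg in auto)
  have "?k x y * ?k z w = half_cosh x y * half_cosh z w / ?N"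
    using X by (simp add: cosh_half_hyp_dist mult_ac)
  also have "\<dots> \<le> 16 * max (half_cosh x z * half_cosh y w) (half_cosh x w * half_cosh y z) / ?N"
    using N * by (intro divide_right_mono) auto
  also have "\<dots> = 16 * max (half_cosh x z * half_cosh y w / ?N) (half_cosh x w * half_cosh y z / ?N)"
    using divide_right_mono[OF _ less_imp_le[OF N]] by (auto simp: max_def dest: antisym)
  also have "half_cosh x z * half_cosh y w / ?N = ?k x z * ?k y w"
    using X by (simp add: cosh_half_hyp_dist mult_ac)
  also have "half_cosh x w * half_cosh y z / ?N = ?k x w * ?k y z"
    using X by (simp add: cosh_half_hyp_dist mult_ac)
  finally have K: "?k x y * ?k z w \<le> 16 * max (?k x z * ?k y w) (?k x w * ?k y z)" .
  have lower: "exp t \<le> 2 * cosh t" for t :: real by (simp add: cosh_def)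
  have upper: "cosh t \<le> exp t" if "0 \<le> t" for t :: real using that by (simp add: cosh_def)
  have up: "?k a b * ?k c d \<le> exp ((hyp_dist a b + hyp_dist c d) / 2)"
    if "a \<in> hyp_space" "b \<in> hyp_space" "c \<in> hyp_space" "d \<in> hyp_space" for a b c d :: "real ^ 'n"
    unfolding add_divide_distrib exp_add using that hyp_dist_nonneg
    by (intro mult_mono upper) auto
  let ?m = "max (hyp_dist x z + hyp_dist y w) (hyp_dist x w + hyp_dist y z)"
  have "exp ((hyp_dist x y + hyp_dist z w) / 2) \<le> (2 * ?k x y) * (2 * ?k z w)"
    unfolding add_divide_distrib exp_add by (intro mult_mono lower) auto
  also have "\<dots> \<le> 64 * max (?k x z * ?k y w) (?k x w * ?k y z)" using K by simp
  also have "\<dots> \<le> 64 * exp (?m / 2)"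
  proof -
    have "?k x z * ?k y w \<le> exp (?m / 2)" "?k x w * ?k y z \<le> exp (?m / 2)"
      using up[OF X(1,3,2,4)] up[OF X(1,4,2,3)]
      by (meson order_trans exp_le_cancel_iff divide_right_mono max.cobounded1 max.cobounded2 zero_le_numeral)+
    then show ?thesis by simp
  qed
  also have "\<dots> = exp (ln 64 + ?m / 2)" by (simp add: exp_add)
  finally show "hyp_dist x y + hyp_dist z w \<le> ?m + hyp_delta"
    unfolding exp_le_cancel_iff hyp_delta_def by (simp add: field_simps)
qed

section \<open>Points on rays from the origin\<close>

definition ray_point :: "real \<Rightarrow> real ^ 'n \<Rightarrow> real ^ 'n" where
  "ray_point a v = tanh (a / 2) *\<^sub>R v"

lemma ray_point_0 [simp]: "ray_point 0 v = 0"
  by (simp add: ray_point_def)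

lemma ray_point_in: "norm v = 1 \<Longrightarrow> ray_point a v \<in> hyp_space"
  using tanh_real_bounds[of "a / 2"] by (auto simp: ray_point_def hyp_space_def)

lemma tanh_half_formulas:
  fixes a :: real
  shows "(1 + (tanh (a / 2))\<^sup>2) / (1 - (tanh (a / 2))\<^sup>2) = cosh a"
    "2 * tanh (a / 2) / (1 - (tanh (a / 2))\<^sup>2) = sinh a"
proof -
  define c s where "c = cosh (a / 2)" and "s = sinh (a / 2)"
  have c: "c \<noteq> 0" "c\<^sup>2 - s\<^sup>2 = 1" by (simp_all add: c_def s_def cosh_square_eq)
  have t: "tanh (a / 2) = s / c" by (simp add: tanh_def c_def s_def)
  have d: "1 - (s / c)\<^sup>2 = 1 / c\<^sup>2" using c by (simp add: power_divide divide_simps)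
  show "(1 + (tanh (a / 2))\<^sup>2) / (1 - (tanh (a / 2))\<^sup>2) = cosh a"
    using cosh_double[of "a / 2"] c(1) unfolding t d by (simp add: c_def s_def power_divide field_simps)
  show "2 * tanh (a / 2) / (1 - (tanh (a / 2))\<^sup>2) = sinh a"
    using sinh_double[of "a / 2"] c(1) unfolding t d by (simp add: c_def s_def power2_eq_square)
qed

text \<open>The hyperbolic law of cosines for a triangle with a vertex at the origin.\<close>

lemma cosh_hyp_dist_ray_point:
  assumes "norm v = 1" "norm w = 1"
  shows "cosh (hyp_dist (ray_point a v) (ray_point b w)) = cosh a * cosh b - sinh a * sinh b * (v \<bullet> w)"
proof -
  let ?s = "tanh (a / 2)" and ?t = "tanh (b / 2)"
  have "cosh (hyp_dist (ray_point a v) (ray_point b w)) =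
      ((1 + ?s\<^sup>2) * (1 + ?t\<^sup>2) - 4 * (?s * ?t * (v \<bullet> w))) / ((1 - ?s\<^sup>2) * (1 - ?t\<^sup>2))"
    using assms by (simp add: cosh_hyp_dist_inner ray_point_in) (simp add: ray_point_def assms)
  also have "\<dots> = (1 + ?s\<^sup>2) / (1 - ?s\<^sup>2) * ((1 + ?t\<^sup>2) / (1 - ?t\<^sup>2)) -
      2 * ?s / (1 - ?s\<^sup>2) * (2 * ?t / (1 - ?t\<^sup>2)) * (v \<bullet> w)"
    by (simp add: diff_divide_distrib)
  also have "\<dots> = cosh a * cosh b - sinh a * sinh b * (v \<bullet> w)" by (simp only: tanh_half_formulas)
  finally show ?thesis .
qed

lemma hyp_dist_ray_point_same:
  assumes "norm v = 1"
  shows "hyp_dist (ray_point a v) (ray_point b v) = \<bar>a - b\<bar>"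
proof (rule cosh_eq_imp_eq)
  show "cosh (hyp_dist (ray_point a v) (ray_point b v)) = cosh \<bar>a - b\<bar>"
    using assms by (simp add: cosh_hyp_dist_ray_point cosh_diff norm_eq_1)
qed (use assms in \<open>auto intro!: hyp_dist_nonneg ray_point_in\<close>)

lemma hyp_dist_0_ray_point: "norm v = 1 \<Longrightarrow> 0 \<le> a \<Longrightarrow> hyp_dist 0 (ray_point a v) = a"
  using hyp_dist_ray_point_same[of v 0 a] by simp

text \<open>An angle of at least \<pi>/2 leaves \<open>cosh a * cosh b\<close> as a lower bound for
  the \<open>cosh\<close> of the distance. The detour through the origin is thus shortest up to
  \<open>ln 4\<close>, however long the sides are.\<close>

lemma hyp_dist_ray_point_obtuse:
  assumes v: "norm v = 1" "norm w = 1" "v \<bullet> w \<le> 0" and ab: "0 \<le> a" "0 \<le> b"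
  shows "a + b - ln 4 \<le> hyp_dist (ray_point a v) (ray_point b w)"
proof -
  let ?d = "hyp_dist (ray_point a v) (ray_point b w)"
  have d: "0 \<le> ?d" using v by (intro hyp_dist_nonneg ray_point_in)
  have "exp (a + b) \<le> (2 * cosh a) * (2 * cosh b)"
    unfolding exp_add by (intro mult_mono) (auto simp: cosh_def)
  also have "\<dots> \<le> 4 * cosh ?d"
    using v ab by (simp add: cosh_hyp_dist_ray_point mult_nonneg_nonpos)
  also have "\<dots> \<le> 4 * exp ?d" using d by (simp add: cosh_def)
  also have "\<dots> = exp (ln 4 + ?d)" by (simp add: exp_add)
  finally show ?thesis by simp
qed

text \<open>The centre is the inverse of \<open>ray_point L v\<close> in the unit sphere: this is
  the reflection in the perpendicular bisector of the segment from the origin to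
  \<open>ray_point L v\<close>.\<close>

lemma reflect_ray_point:
  assumes v: "norm v = 1" and L: "0 < L"
  shows "reflect ((1 / tanh (L / 2)) *\<^sub>R v) (ray_point a v) = ray_point (L - a) v"
proof -
  let ?u = "tanh (a / 2)" and ?t = "tanh (L / 2)"
  have u: "\<bar>?u\<bar> < 1" and t: "0 < ?t" "?t < 1"
    using tanh_real_bounds[of "a / 2"] tanh_real_bounds[of "L / 2"] L by auto
  have "?u * ?t < 1" using u t by (smt (verit) mult_left_le mult_less_cancel_right2 mult_nonneg_nonpos2)
  then have ne: "?u * ?t \<noteq> 1" "?u \<noteq> 1 / ?t" using t by (auto simp: field_simps)
  have "reflect ((1 / ?t) *\<^sub>R v) (?u *\<^sub>R v) =
      (1 / ?t) *\<^sub>R v + (((1 / ?t)\<^sup>2 - 1) / (?u - 1 / ?t)\<^sup>2) *\<^sub>R ((?u - 1 / ?t) *\<^sub>R v)"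
    using v t by (simp add: reflect_def scaleR_left_diff_distrib[symmetric] power_mult_distrib)
  also have "\<dots> = (1 / ?t + ((1 / ?t)\<^sup>2 - 1) / (?u - 1 / ?t)) *\<^sub>R v"
    using ne by (simp add: scaleR_left_distrib power2_eq_square)
  also have "1 / ?t + ((1 / ?t)\<^sup>2 - 1) / (?u - 1 / ?t) = (?t - ?u) / (1 - ?t * ?u)"
    using ne t by (simp add: divide_simps power2_eq_square) (simp add: algebra_simps)
  also have "\<dots> = tanh ((L - a) / 2)"
    using tanh_add[of "L / 2" "- (a / 2)"] by (simp add: diff_divide_distrib)
  finally show ?thesis by (simp add: ray_point_def)
qed

section \<open>Reflections and half-turns\<close>

lemma hyp_isom_plus_Bij: "f \<in> hyp_isom_plus \<Longrightarrow> f \<in> Bij hyp_space"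
  by (simp add: hyp_isom_plus_def hyp_isom_def)

lemma Bij_mem: "f \<in> Bij S \<Longrightarrow> x \<in> S \<Longrightarrow> f x \<in> S"
  by (auto simp: Bij_def bij_betw_def)

lemma open_hyp_space: "open hyp_space"
  by (simp add: hyp_space_def)

lemma has_derivative_restrict_hyp:
  assumes "x \<in> hyp_space" "(f has_derivative f') (at x)"
  shows "(restrict f hyp_space has_derivative f') (at x)"
  by (rule has_derivative_transform_within_open[OF assms(2) open_hyp_space assms(1)]) simp

lemma hyp_isom_plus_compose:
  assumes f: "f \<in> hyp_isom_plus" and h: "h \<in> hyp_isom_plus"
  shows "compose hyp_space f h \<in> hyp_isom_plus"
proof -
  have B: "f \<in> Bij hyp_space" "h \<in> Bij hyp_space" using f h by (auto intro: hyp_isom_plus_Bij)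
  have "\<exists>D. (compose hyp_space f h has_derivative D) (at x) \<and> det (matrix D) > 0" if x: "x \<in> hyp_space" for x
  proof -
    obtain h' where h': "(h has_derivative h') (at x)" "det (matrix h') > 0"
      using h x by (auto simp: hyp_isom_plus_def)
    obtain f' where f': "(f has_derivative f') (at (h x))" "det (matrix f') > 0"
      using f Bij_mem[OF B(2) x] by (auto simp: hyp_isom_plus_def)
    have "(f \<circ> h has_derivative f' \<circ> h') (at x)" using diff_chain_at[OF h'(1) f'(1)] .
    then have "(compose hyp_space f h has_derivative f' \<circ> h') (at x)"
      using has_derivative_restrict_hyp[OF x, of "f \<circ> h"] by (simp add: compose_def o_def)
    moreover have "det (matrix (f' \<circ> h')) = det (matrix f') * det (matrix h')"
      using h'(1) f'(1) by (simp add: matrix_compose has_derivative_linear det_mul)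
    ultimately show ?thesis using h' f' by (auto intro!: exI[of _ "f' \<circ> h'"])
  qed
  moreover have "compose hyp_space f h \<in> Bij hyp_space" by (rule compose_Bij) (use B in auto)
  moreover have "hyp_dist (compose hyp_space f h x) (compose hyp_space f h y) = hyp_dist x y"
    if "x \<in> hyp_space" "y \<in> hyp_space" for x y
    using f h that Bij_mem[OF B(2)] by (simp add: compose_def hyp_isom_plus_def hyp_isom_def)
  ultimately show ?thesis by (simp add: hyp_isom_plus_def hyp_isom_def)
qed

lemma involution_restrict_Bij:
  assumes "\<And>x. x \<in> S \<Longrightarrow> f x \<in> S" "\<And>x. x \<in> S \<Longrightarrow> f (f x) = x"
  shows "restrict f S \<in> Bij S"
proof -
  have "bij_betw (restrict f S) S S"
    by (rule bij_betwI[where g = f]) (use assms in auto)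
  then show ?thesis by (simp add: Bij_def)
qed

lemma involution_hyp_isom_plus:
  assumes "\<And>x. x \<in> hyp_space \<Longrightarrow> f x \<in> hyp_space" "\<And>x. x \<in> hyp_space \<Longrightarrow> f (f x) = x"
    and "\<And>x y. x \<in> hyp_space \<Longrightarrow> y \<in> hyp_space \<Longrightarrow> hyp_dist (f x) (f y) = hyp_dist x y"
    and "\<And>x. x \<in> hyp_space \<Longrightarrow> \<exists>f'. (f has_derivative f') (at x) \<and> det (matrix f') > 0"
  shows "restrict f hyp_space \<in> hyp_isom_plus"
  using assms(3,4) involution_restrict_Bij[of hyp_space f, OF assms(1,2)] has_derivative_restrict_hyp
  by (fastforce simp: hyp_isom_plus_def hyp_isom_def)

lemma id_hyp_isom_plus: "restrict (\<lambda>x. x) hyp_space \<in> (hyp_isom_plus :: (real ^ 'n \<Rightarrow> real ^ 'n) set)"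
proof (rule involution_hyp_isom_plus)
  fix x :: "real ^ 'n"
  have "matrix (\<lambda>x::real^'n. x) = mat 1" by (simp add: matrix_def mat_def axis_def vec_eq_iff)
  then have "det (matrix (\<lambda>x::real^'n. x)) = 1" by simp
  then show "\<exists>f'. ((\<lambda>x. x) has_derivative f') (at x) \<and> det (matrix f') > 0"
    by (intro exI[of _ "\<lambda>x. x"]) simp
qed auto

text \<open>A scalar times the orthogonal reflection along \<open>x - c\<close>; the scalar is the
  conformal factor of the inversion, positive for \<open>norm c > 1\<close>.\<close>

definition reflection_deriv :: "real ^ 'n \<Rightarrow> real ^ 'n \<Rightarrow> real ^ 'n \<Rightarrow> real ^ 'n" where
  "reflection_deriv c x h = (((norm c)\<^sup>2 - 1) / (norm (x - c))\<^sup>2) *\<^sub>R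
     (h - (2 * ((x - c) \<bullet> h) / (norm (x - c))\<^sup>2) *\<^sub>R (x - c))"

lemma has_derivative_reflect:
  assumes "x \<noteq> c"
  shows "(reflect c has_derivative reflection_deriv c x) (at x)"
proof -
  define r where "r = (norm c)\<^sup>2 - 1"
  have "((\<lambda>x. c + (r / ((x - c) \<bullet> (x - c))) *\<^sub>R (x - c)) has_derivative reflection_deriv c x) (at x)"
    using assms
    apply (auto intro!: derivative_eq_intros)
    apply (rule ext)
    apply (simp add: reflection_deriv_def r_def power2_norm_eq_inner inner_commute algebra_simps)
    done
  moreover have "reflect c = (\<lambda>x. c + (r / ((x - c) \<bullet> (x - c))) *\<^sub>R (x - c))"
    by (simp add: fun_eq_iff reflect_def r_def power2_norm_eq_inner)
  ultimately show ?thesis by simp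
qed


lemma matrix_reflection_deriv:
  "matrix (reflection_deriv c x) $ i $ j = ((norm c)\<^sup>2 - 1) / (norm (x - c))\<^sup>2 *
     ((if i = j then 1 else 0) - 2 / (norm (x - c))\<^sup>2 * ((x - c) $ i * (x - c) $ j))"
  by (simp add: matrix_def reflection_deriv_def axis_def inner_axis[unfolded axis_def] mult_ac)

text \<open>With \<open>a = x - c\<close>, the matrix I - m a a^T has determinant 1 - m |a|^2, and m
  |a|^2 = 2.\<close>

lemma det_reflection_deriv_3:
  fixes c x :: "real ^ 3"
  assumes "1 < norm c" "x \<noteq> c"
  shows "det (matrix (reflection_deriv c x)) < 0"
proof -
  define k m a where "k = ((norm c)\<^sup>2 - 1) / (norm (x - c))\<^sup>2" and "m = 2 / (norm (x - c))\<^sup>2" and "a = x - c"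
  have k: "0 < k" using assms by (simp add: k_def one_less_power)
  have n: "(norm a)\<^sup>2 = a $ 1 * a $ 1 + a $ 2 * a $ 2 + a $ 3 * a $ 3"
    by (simp add: power2_norm_eq_inner inner_vec_def sum_3)
  have M: "matrix (reflection_deriv c x) $ i $ j = k * ((if i = j then 1 else 0) - m * (a $ i * a $ j))" for i j
    by (simp only: matrix_reflection_deriv k_def m_def a_def)
  have "det (matrix (reflection_deriv c x)) = k ^ 3 * (1 - m * (a $ 1 * a $ 1 + a $ 2 * a $ 2 + a $ 3 * a $ 3))"
    unfolding det_3 M
    by (simp add: power3_eq_cube algebra_simps)
  also have "m * (a $ 1 * a $ 1 + a $ 2 * a $ 2 + a $ 3 * a $ 3) = 2"
    unfolding n[symmetric] using assms(2) by (simp add: m_def a_def)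
  finally show ?thesis using k by simp
qed

lemma det_reflection_deriv_2:
  fixes c x :: "real ^ 2"
  assumes "1 < norm c" "x \<noteq> c"
  shows "det (matrix (reflection_deriv c x)) < 0"
proof -
  define k m a where "k = ((norm c)\<^sup>2 - 1) / (norm (x - c))\<^sup>2" and "m = 2 / (norm (x - c))\<^sup>2" and "a = x - c"
  have k: "0 < k" using assms by (simp add: k_def one_less_power)
  have n: "(norm a)\<^sup>2 = a $ 1 * a $ 1 + a $ 2 * a $ 2"
    by (simp add: power2_norm_eq_inner inner_vec_def sum_2)
  have M: "matrix (reflection_deriv c x) $ i $ j = k * ((if i = j then 1 else 0) - m * (a $ i * a $ j))" for i j
    by (simp only: matrix_reflection_deriv k_def m_def a_def)
  have "det (matrix (reflection_deriv c x)) = k\<^sup>2 * (1 - m * (a $ 1 * a $ 1 + a $ 2 * a $ 2))"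
    unfolding det_2 M
    by (simp add: power2_eq_square algebra_simps)
  also have "m * (a $ 1 * a $ 1 + a $ 2 * a $ 2) = 2"
    unfolding n[symmetric] using assms(2) by (simp add: m_def a_def)
  finally show ?thesis using k by simp
qed

section \<open>Rotations of hyperbolic 3-space acting on the tripod\<close>

text \<open>The reflection in the plane that contains all the directions \<open>dir i\<close>. It
  restores the orientation that an inversion reverses, without moving the tripod.\<close>

definition flip3 :: "real ^ 3 \<Rightarrow> real ^ 3" where
  "flip3 x = vector [x $ 1, x $ 2, - x $ 3]"

text \<open>Negating the second coordinate exchanges two legs of the tripod; negating the third as
  well makes the determinant positive.\<close>

definition turn1 :: "real ^ 3 \<Rightarrow> real ^ 3" where
  "turn1 x = vector [x $ 1, - x $ 2, - x $ 3]"

lemma orthogonal_flip3: "orthogonal_transformation flip3"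
  by (auto simp: orthogonal_transformation_def flip3_def inner_vec_def sum_3 vec_eq_iff forall_3
      algebra_simps intro!: linearI)

lemma orthogonal_turn1: "orthogonal_transformation turn1"
  by (auto simp: orthogonal_transformation_def turn1_def inner_vec_def sum_3 vec_eq_iff forall_3
      algebra_simps intro!: linearI)

lemmas linear_flip3 = orthogonal_transformation_linear[OF orthogonal_flip3]
lemmas linear_turn1 = orthogonal_transformation_linear[OF orthogonal_turn1]

lemma flip3_flip3 [simp]: "flip3 (flip3 x) = x"
  by (simp add: flip3_def vec_eq_iff forall_3)

lemma turn1_turn1 [simp]: "turn1 (turn1 x) = x"
  by (simp add: turn1_def vec_eq_iff forall_3)

lemma flip3_turn1: "flip3 (turn1 x) = turn1 (flip3 x)"
  by (simp add: turn1_def flip3_def vec_eq_iff forall_3)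

lemma det_flip3: "det (matrix flip3) = - 1"
  by (simp add: det_3 matrix_def flip3_def axis_def)

lemma det_turn1: "det (matrix turn1) = 1"
  by (simp add: det_3 matrix_def turn1_def axis_def)

lemma orthogonal_hyp_dist:
  assumes "orthogonal_transformation R"
  shows "hyp_dist (R x) (R y) = hyp_dist x y"
  using orthogonal_transformation_norm[OF assms] orthogonal_transformation_linear[OF assms]
  by (simp add: hyp_dist_def linear_diff[symmetric])

lemma orthogonal_hyp_space:
  assumes "orthogonal_transformation R" "x \<in> hyp_space"
  shows "R x \<in> hyp_space"
  using orthogonal_transformation_norm[OF assms(1)] assms(2) by (simp add: hyp_space_def)

lemma orthogonal_reflect:
  assumes "orthogonal_transformation R"
  shows "R (reflect c x) = reflect (R c) (R x)"
  using orthogonal_transformation_norm[OF assms] orthogonal_transformation_linear[OF assms]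
  by (simp add: reflect_def linear_diff[symmetric] linear_add linear_scale)


text \<open>Boundary fixed points are defined by a limit from inside the ball. When the formula for
  the isometry is continuous at the boundary point, they are fixed points of the formula.\<close>

lemma fixes_boundary_point_isCont:
  fixes f :: "real ^ 'n \<Rightarrow> real ^ 'n"
  assumes "isCont f \<xi>" "fixes_boundary_point (restrict f hyp_space) \<xi>"
  shows "f \<xi> = \<xi>"
proof -
  have "(f \<longlongrightarrow> f \<xi>) (at \<xi> within hyp_space)"
    using assms(1) by (simp add: continuous_at tendsto_within_subset[of _ _ _ UNIV])
  moreover have "(f \<longlongrightarrow> \<xi>) (at \<xi> within hyp_space)"
    using assms(2) unfolding fixes_boundary_point_def
    by (auto elim!: Lim_transform_eventually simp: eventually_at_filter)
  moreover have "at \<xi> within hyp_space \<noteq> bot"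
    using assms(2) by (simp add: fixes_boundary_point_def hyp_boundary_def hyp_space_def trivial_limit_within islimpt_ball)
  ultimately show ?thesis using tendsto_unique by blast
qed

fun dir :: "bool option \<Rightarrow> real ^ 3" where
  "dir None = axis 1 1"
| "dir (Some b) = (if b then axis 2 1 else - axis 2 1)"

lemma norm_dir [simp]: "norm (dir i) = 1"
  by (cases i) auto

lemma flip3_dir: "flip3 (dir i) = dir i"
  by (cases i) (auto simp: flip3_def vec_eq_iff forall_3 axis_def)

lemma turn1_dir: "turn1 (dir i) = dir (map_option Not i)"
  by (cases i) (auto simp: turn1_def vec_eq_iff forall_3 axis_def)

lemma dir_obtuse: "i \<noteq> j \<Longrightarrow> dir i \<bullet> dir j \<le> 0"
  by (cases i; cases j) (auto simp: inner_axis_axis)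

definition turn_centre :: "real \<Rightarrow> bool option \<Rightarrow> real ^ 3" where
  "turn_centre L i = (1 / tanh (L / 2)) *\<^sub>R dir i"

text \<open>The centre lies in the plane fixed by \<open>flip3\<close>, so the two reflections are
  in perpendicular planes and commute: their product is the half-turn about the common line.\<close>

definition half_turn :: "real \<Rightarrow> bool option \<Rightarrow> real ^ 3 \<Rightarrow> real ^ 3" where
  "half_turn L i x = flip3 (reflect (turn_centre L i) x)"

context
  fixes L :: real
  assumes L: "0 < L"
begin

lemma half_turn_centre: "1 < norm (turn_centre L i)"
  using L tanh_real_bounds[of "L / 2"] by (simp add: turn_centre_def field_simps)

lemma half_turn_centre_ne: "norm x \<le> 1 \<Longrightarrow> x \<noteq> turn_centre L i"
  using half_turn_centre[of i] by auto

lemma hyp_space_norm_le: "x \<in> hyp_space \<Longrightarrow> norm x \<le> 1"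
  by (simp add: hyp_space_def)

lemma half_turn_in: "x \<in> hyp_space \<Longrightarrow> half_turn L i x \<in> hyp_space"
  unfolding half_turn_def
  by (rule orthogonal_hyp_space[OF orthogonal_flip3 reflect_in[OF half_turn_centre]])

lemma flip3_reflect:
  "flip3 (reflect (turn_centre L i) x) =
   reflect (turn_centre L i) (flip3 x)"
  using orthogonal_reflect[OF orthogonal_flip3]
    linear_flip3
  by (simp add: turn_centre_def linear_scale flip3_dir)

lemma half_turn_half_turn: "x \<in> hyp_space \<Longrightarrow> half_turn L i (half_turn L i x) = x"
  unfolding half_turn_def flip3_reflect flip3_flip3
  by (rule reflect_involution[OF half_turn_centre half_turn_centre_ne[OF hyp_space_norm_le]])

lemma hyp_dist_half_turn:
  "x \<in> hyp_space \<Longrightarrow> y \<in> hyp_space \<Longrightarrow> hyp_dist (half_turn L i x) (half_turn L i y) = hyp_dist x y"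
  unfolding half_turn_def
  by (simp add: orthogonal_hyp_dist orthogonal_flip3 hyp_dist_reflect half_turn_centre)

lemma half_turn_ray_point: "half_turn L i (ray_point a (dir i)) = ray_point (L - a) (dir i)"
  unfolding half_turn_def turn_centre_def reflect_ray_point[OF norm_dir L]
  using linear_flip3
  by (simp add: ray_point_def linear_scale flip3_dir)

lemma half_turn_0: "half_turn L i 0 = ray_point L (dir i)"
  using half_turn_ray_point[of i 0] by simp

lemma turn1_half_turn: "turn1 (half_turn L i x) = half_turn L (map_option Not i) (turn1 x)"
  unfolding half_turn_def flip3_turn1[symmetric]
  using orthogonal_reflect[OF orthogonal_turn1]
    linear_turn1 by (simp add: turn_centre_def linear_scale turn1_dir)

lemma half_turn_has_derivative:
  assumes "norm x \<le> 1"
  shows "(half_turn L i has_derivative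
    flip3 \<circ> reflection_deriv (turn_centre L i) x) (at x)"
proof -
  have "(flip3 has_derivative flip3) (at y)" for y
    using linear_flip3
    by (intro bounded_linear_imp_has_derivative) (simp add: linear_conv_bounded_linear)
  moreover have "half_turn L i = flip3 \<circ> reflect (turn_centre L i)"
    by (simp add: half_turn_def fun_eq_iff)
  ultimately show ?thesis
    using diff_chain_at[OF has_derivative_reflect[OF half_turn_centre_ne[OF assms]]] by metis
qed

lemma half_turn_isom: "restrict (half_turn L i) hyp_space \<in> hyp_isom_plus"
proof (rule involution_hyp_isom_plus)
  fix x :: "real ^ 3" assume x: "x \<in> hyp_space"
  let ?c = "turn_centre L i"
  have ne: "x \<noteq> ?c" using half_turn_centre_ne[OF hyp_space_norm_le[OF x]] .
  have "linear (reflection_deriv ?c x)"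
    using has_derivative_linear[OF has_derivative_reflect[OF ne]] .
  then have "det (matrix (flip3 \<circ> reflection_deriv ?c x)) = - det (matrix (reflection_deriv ?c x))"
    using linear_flip3
    by (simp add: matrix_compose det_mul det_flip3)
  then show "\<exists>f'. (half_turn L i has_derivative f') (at x) \<and> det (matrix f') > 0"
    using det_reflection_deriv_3[OF half_turn_centre ne] half_turn_has_derivative[OF hyp_space_norm_le[OF x], of i]
    by (intro exI[of _ "flip3 \<circ> reflection_deriv (turn_centre L i) x"]) simp
qed (auto simp: half_turn_in half_turn_half_turn hyp_dist_half_turn)

lemma half_turn_fixes_boundary:
  assumes "fixes_boundary_point (restrict (half_turn L i) hyp_space) \<xi>"
  shows "half_turn L i \<xi> = \<xi>"
proof (rule fixes_boundary_point_isCont[OF _ assms])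
  show "isCont (half_turn L i) \<xi>"
    using half_turn_has_derivative[of \<xi> i] assms
    by (intro has_derivative_continuous) (auto simp: fixes_boundary_point_def hyp_boundary_def)
qed

end

lemma turn1_isom: "restrict turn1 hyp_space \<in> hyp_isom_plus"
proof (rule involution_hyp_isom_plus)
  fix x :: "real ^ 3"
  have "(turn1 has_derivative turn1) (at x)"
    using linear_turn1
    by (intro bounded_linear_imp_has_derivative) (simp add: linear_conv_bounded_linear)
  then show "\<exists>f'. (turn1 has_derivative f') (at x) \<and> det (matrix f') > 0"
    using det_turn1 by (intro exI[of _ turn1]) simp
qed (auto simp: orthogonal_hyp_space orthogonal_hyp_dist orthogonal_turn1)

lemma turn1_fixes_boundary:
  assumes "fixes_boundary_point (restrict turn1 hyp_space) \<xi>"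
  shows "turn1 \<xi> = \<xi>"
  using linear_turn1
  by (intro fixes_boundary_point_isCont[OF _ assms])
     (simp add: linear_continuous_at linear_conv_bounded_linear)

text \<open>On the sphere \<open>turn1\<close> fixes only the two ends of the first axis, and the
  half-turn with direction \<open>dir None\<close> exchanges these. This makes the approximating
  representations admissible.\<close>

lemma no_common_boundary_fixed_point:
  assumes L: "0 < L"
    and fix1: "fixes_boundary_point (restrict turn1 hyp_space) \<xi>"
    and fix2: "fixes_boundary_point (restrict (half_turn L None) hyp_space) \<xi>"
  shows False
proof -
  let ?k = "1 / tanh (L / 2)" and ?e = "axis 1 1 :: real ^ 3"
  have k: "1 < ?k" using L tanh_real_bounds[of "L / 2"] by simp
  have n: "norm \<xi> = 1" using fix1 by (simp add: fixes_boundary_point_def hyp_boundary_def)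
  obtain s where s: "\<xi> = s *\<^sub>R ?e"
  proof
    show "\<xi> = (\<xi> $ 1) *\<^sub>R ?e"
      using turn1_fixes_boundary[OF fix1] by (simp add: turn1_def vec_eq_iff forall_3 axis_def)
  qed
  have s1: "s = 1 \<or> s = - 1" using n s by auto
  have "reflect (?k *\<^sub>R ?e) (s *\<^sub>R ?e) = ?k *\<^sub>R ?e + ((?k\<^sup>2 - 1) / (s - ?k)\<^sup>2) *\<^sub>R ((s - ?k) *\<^sub>R ?e)"
    using k tanh_real_bounds[of "L / 2"] L
    by (simp add: reflect_def scaleR_left_diff_distrib[symmetric] power_mult_distrib)
  also have "\<dots> = (?k + (?k\<^sup>2 - 1) / (s - ?k)) *\<^sub>R ?e"
    by (simp add: scaleR_left_distrib power2_eq_square)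
  also have "?k + (?k\<^sup>2 - 1) / (s - ?k) = - s"
  proof -
    have "k + (k\<^sup>2 - 1) / (s - k) = - s" if "1 < k" for k
      using that s1 by (auto simp: field_simps power2_eq_square)
    then show ?thesis using k .
  qed
  finally have "half_turn L None \<xi> = (- s) *\<^sub>R flip3 ?e"
    using linear_flip3
    by (simp add: half_turn_def turn_centre_def s linear_scale linear_neg)
  also have "flip3 ?e = ?e" using flip3_dir[of None] by simp
  finally have "(- s) *\<^sub>R ?e = s *\<^sub>R ?e" using half_turn_fixes_boundary[OF L fix2] s by simp
  then have "((- s) *\<^sub>R ?e) $ 1 = (s *\<^sub>R ?e) $ 1" by (simp only:)
  then show False using s1 by auto
qed

section \<open>Homomorphisms out of the surface group\<close>

definition word_eval :: "('h, 'm) monoid_scheme \<Rightarrow> (letter \<Rightarrow> 'h) \<Rightarrow> word \<Rightarrow> 'h" where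
  "word_eval H h w = foldr (\<lambda>l x. h l \<otimes>\<^bsub>H\<^esub> x) w \<one>\<^bsub>H\<^esub>"

definition surface_lift :: "('h, 'm) monoid_scheme \<Rightarrow> (letter \<Rightarrow> 'h) \<Rightarrow> word set \<Rightarrow> 'h" where
  "surface_lift H h X = word_eval H h (SOME w. w \<in> X)"

lemma surface_group_carrierE:
  assumes "\<gamma> \<in> carrier (surface_group g)"
  obtains w where "w \<in> lists (letters g)" "\<gamma> = word_rel g `` {w}"
  using assms unfolding surface_group_def by (auto elim!: quotientE)

lemma word_class_in_carrier: "w \<in> lists (letters g) \<Longrightarrow> word_rel g `` {w} \<in> carrier (surface_group g)"
  by (simp add: surface_group_def quotientI)

lemma (in group) word_eval_closed: "(\<And>l. l \<in> set w \<Longrightarrow> h l \<in> carrier G) \<Longrightarrow> word_eval G h w \<in> carrier G"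
  unfolding word_eval_def by (induction w) auto

lemma (in group) word_eval_append:
  "(\<And>l. l \<in> set u \<union> set v \<Longrightarrow> h l \<in> carrier G) \<Longrightarrow> word_eval G h (u @ v) = word_eval G h u \<otimes> word_eval G h v"
proof (induction u)
  case Nil
  then show ?case using word_eval_closed[of v h] by (simp add: word_eval_def)
next
  case (Cons l u)
  then show ?case
    using word_eval_closed[of v h] word_eval_closed[of u h] by (simp add: word_eval_def m_assoc)
qed

text \<open>The hypotheses of von Dyck's theorem for the presentation of the surface group.\<close>

locale surface_assignment = group H for H (structure) +
  fixes g :: nat and h :: "letter \<Rightarrow> 'a"
  assumes in_carrier: "l \<in> letters g \<Longrightarrow> h l \<in> carrier H"
    and inv_letter_value: "l \<in> letters g \<Longrightarrow> h l \<otimes> h (inv_letter l) = \<one>"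
    and relator_value: "word_eval H h (surface_relator g) = \<one>"
begin

lemma eval_closed: "w \<in> lists (letters g) \<Longrightarrow> word_eval H h w \<in> carrier H"
  by (rule word_eval_closed) (auto simp: in_carrier)

lemma eval_append: "u \<in> lists (letters g) \<Longrightarrow> v \<in> lists (letters g) \<Longrightarrow>
    word_eval H h (u @ v) = word_eval H h u \<otimes> word_eval H h v"
  by (rule word_eval_append) (auto simp: in_carrier)

lemma word_eval_rel: "(u, v) \<in> word_rel g \<Longrightarrow> word_eval H h u = word_eval H h v"
proof (induction rule: word_rel.induct)
  case (cancel u v x)
  then have x: "[x, inv_letter x] \<in> lists (letters g)" by (simp add: inv_letter_in del: inv_letter.simps)
  have "word_eval H h [x, inv_letter x] = \<one>"
    using cancel in_carrier inv_letter_value inv_letter_in[of x g]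
    by (simp add: word_eval_def del: inv_letter.simps)
  then show ?case
    using cancel x eval_closed
    by (simp add: eval_append del: append_Cons inv_letter.simps lists.simps)
next
  case (relator u v)
  then show ?case
    using relator_in_lists[of g] eval_closed relator_value
    by (simp add: eval_append)
qed auto

lemma surface_lift_class:
  assumes "w \<in> lists (letters g)"
  shows "surface_lift H h (word_rel g `` {w}) = word_eval H h w"
proof -
  have "w \<in> word_rel g `` {w}" using assms word_rel.refl by blast
  then have "(SOME w'. w' \<in> word_rel g `` {w}) \<in> word_rel g `` {w}" by (rule someI)
  then show ?thesis using word_eval_rel unfolding surface_lift_def by (metis Image_singleton_iff)
qed

lemma surface_lift_hom: "surface_lift H h \<in> hom (surface_group g) H"
proof (rule homI)
  fix x y assume "x \<in> carrier (surface_group g)" "y \<in> carrier (surface_group g)"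
  then obtain u v where uv: "u \<in> lists (letters g)" "x = word_rel g `` {u}"
    "v \<in> lists (letters g)" "y = word_rel g `` {v}" by (meson surface_group_carrierE)
  then have "u @ v \<in> lists (letters g)" by simp
  with uv show "surface_lift H h x \<in> carrier H"
    and "surface_lift H h (x \<otimes>\<^bsub>surface_group g\<^esub> y) = surface_lift H h x \<otimes> surface_lift H h y"
    by (simp_all add: surface_mult surface_lift_class eval_append eval_closed del: append_in_lists_conv in_lists_conv_set)
qed

end

text \<open>The three handles \<open>a\<^sub>1\<close>, \<open>a\<^sub>2\<close>, \<open>a\<^sub>3\<close> can be sent to arbitrary elements when all
  other generators are killed: every commutator in the relator then dies. For involutions, the letter
  and its formal inverse have the same image.\<close>

fun gen_letters :: "'h \<Rightarrow> 'h \<Rightarrow> 'h \<Rightarrow> 'h \<Rightarrow> letter \<Rightarrow> 'h" where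
  "gen_letters e p q r (Gen_a i, _) = (if i = 0 then p else if i = 1 then q else if i = 2 then r else e)"
| "gen_letters e p q r (Gen_b i, _) = e"

lemma gen_letters_cases:
  obtains "gen_letters e p q r l = e" | "gen_letters e p q r l = p"
  | "gen_letters e p q r l = q" | "gen_letters e p q r l = r"
proof -
  have "gen_letters e p q r l \<in> {e, p, q, r}"
    by (cases "(e, p, q, r, l)" rule: gen_letters.cases) auto
  then show thesis using that by auto
qed

lemma (in group) involution_surface_assignment:
  assumes c: "p \<in> carrier G" "q \<in> carrier G" "r \<in> carrier G"
    and i: "p \<otimes> p = \<one>" "q \<otimes> q = \<one>" "r \<otimes> r = \<one>"
  shows "surface_assignment G g (gen_letters \<one> p q r)"
proof
  let ?h = "gen_letters \<one> p q r"
  have car: "?h l \<in> carrier G" for l by (rule gen_letters_cases[of \<one> p q r l]) (use c in auto)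
  then show "?h l \<in> carrier G" for l .
  have inv: "?h l \<otimes> ?h l = \<one>" for l by (rule gen_letters_cases[of \<one> p q r l]) (use i in auto)
  moreover have same: "?h (x, s) = ?h (x, t)" for x s t by (cases x) auto
  ultimately show "?h l \<otimes> ?h (inv_letter l) = \<one>" for l
    by (cases l) (metis inv_letter.simps)
  have eval: "word_eval G ?h (u @ v) = word_eval G ?h v" if "word_eval G ?h u = \<one>" for u v
    using that word_eval_append[of u v ?h, OF car] word_eval_closed[of v ?h, OF car] by simp
  have "word_eval G ?h (commutator_word k) = \<one>" for k
  proof -
    have "word_eval G ?h (commutator_word k) = ?h (Gen_a k, False) \<otimes> ?h (Gen_a k, True)"
      using car by (simp add: word_eval_def commutator_word_def del: gen_letters.simps(1))
    then show ?thesis using inv same by metis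
  qed
  then have "word_eval G ?h (concat (map commutator_word ks)) = \<one>" for ks
    by (induction ks) (simp_all add: eval, simp add: word_eval_def)
  then show "word_eval G ?h (surface_relator g) = \<one>" by (simp add: surface_relator_def)
qed

lemma BijGroup_mult: "f \<in> Bij S \<Longrightarrow> h \<in> Bij S \<Longrightarrow> f \<otimes>\<^bsub>BijGroup S\<^esub> h = compose S f h"
  by (simp add: BijGroup_def)

lemma BijGroup_one: "\<one>\<^bsub>BijGroup S\<^esub> = restrict (\<lambda>x. x) S"
  by (simp add: BijGroup_def)

lemma BijGroup_carrier: "carrier (BijGroup S) = Bij S"
  by (simp add: BijGroup_def)

lemma word_eval_BijGroup:
  assumes "\<And>l. h l \<in> Bij S"
  shows "word_eval (BijGroup S) h w \<in> Bij S \<and>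
    (\<forall>x\<in>S. word_eval (BijGroup S) h w x = foldr h w x \<and> foldr h w x \<in> S)"
proof (induction w)
  case Nil
  then show ?case
    using monoid.one_closed[OF group.is_monoid[OF group_BijGroup[of S]]]
    by (simp add: word_eval_def BijGroup_one BijGroup_carrier restrict_def)
next
  case (Cons l w)
  have "word_eval (BijGroup S) h (l # w) = compose S (h l) (word_eval (BijGroup S) h w)"
    using Cons assms by (simp add: word_eval_def BijGroup_mult)
  moreover have "compose S (h l) (word_eval (BijGroup S) h w) \<in> Bij S"
    by (rule compose_Bij) (use Cons assms in auto)
  moreover have "h l y \<in> S" if "y \<in> S" for y
    using assms[of l] that by (auto simp: Bij_def bij_betw_def)
  ultimately show ?case using Cons by (simp add: compose_eq)
qed

lemma involution_BijGroup:
  assumes "\<And>x. x \<in> S \<Longrightarrow> f x \<in> S" "\<And>x. x \<in> S \<Longrightarrow> f (f x) = x"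
  shows "restrict f S \<in> Bij S" "restrict f S \<otimes>\<^bsub>BijGroup S\<^esub> restrict f S = \<one>\<^bsub>BijGroup S\<^esub>"
proof -
  show B: "restrict f S \<in> Bij S" using assms by (rule involution_restrict_Bij)
  show "restrict f S \<otimes>\<^bsub>BijGroup S\<^esub> restrict f S = \<one>\<^bsub>BijGroup S\<^esub>"
    using assms by (simp add: BijGroup_mult[OF B B] BijGroup_one compose_def fun_eq_iff)
qed

definition involution_action :: "'x set \<Rightarrow> ('x \<Rightarrow> 'x) \<Rightarrow> ('x \<Rightarrow> 'x) \<Rightarrow> ('x \<Rightarrow> 'x) \<Rightarrow> word set \<Rightarrow> 'x \<Rightarrow> 'x" where
  "involution_action S p q r = surface_lift (BijGroup S)
     (gen_letters \<one>\<^bsub>BijGroup S\<^esub> (restrict p S) (restrict q S) (restrict r S))"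

text \<open>The word evaluated with unrestricted maps. Elements of \<open>BijGroup S\<close> are
  normalised outside of \<open>S\<close>; on \<open>S\<close> both evaluations agree, and plain
  compositions are easier to transport along maps.\<close>

abbreviation involution_word :: "('x \<Rightarrow> 'x) \<Rightarrow> ('x \<Rightarrow> 'x) \<Rightarrow> ('x \<Rightarrow> 'x) \<Rightarrow> word \<Rightarrow> 'x \<Rightarrow> 'x" where
  "involution_word p q r w \<equiv> foldr (gen_letters (\<lambda>x. x) p q r) w"

locale three_involutions =
  fixes S :: "'x set" and p q r :: "'x \<Rightarrow> 'x"
  assumes closed: "x \<in> S \<Longrightarrow> p x \<in> S" "x \<in> S \<Longrightarrow> q x \<in> S" "x \<in> S \<Longrightarrow> r x \<in> S"
    and invol: "x \<in> S \<Longrightarrow> p (p x) = x" "x \<in> S \<Longrightarrow> q (q x) = x" "x \<in> S \<Longrightarrow> r (r x) = x"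
begin

abbreviation "h \<equiv> gen_letters \<one>\<^bsub>BijGroup S\<^esub> (restrict p S) (restrict q S) (restrict r S)"

lemma assignment: "surface_assignment (BijGroup S) g h"
  by (rule group.involution_surface_assignment[OF group_BijGroup])
     (use involution_BijGroup[of S] closed invol in \<open>auto simp: BijGroup_carrier\<close>)

lemma hom: "involution_action S p q r \<in> hom (surface_group g) (BijGroup S)"
  unfolding involution_action_def by (rule surface_assignment.surface_lift_hom[OF assignment])

lemma group_action: "group_action (surface_group g) S (involution_action S p q r)"
  using hom[of g] group_BijGroup[of S] surface_group_group[of g]
  by (simp add: group_action_def group_hom_def group_hom_axioms_def)

lemma h_Bij: "h l \<in> Bij S"
  by (rule gen_letters_cases[of "\<one>\<^bsub>BijGroup S\<^esub>" "restrict p S" "restrict q S" "restrict r S" l])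
     (use involution_BijGroup[of S] closed invol monoid.one_closed[OF group.is_monoid[OF group_BijGroup[of S]]]
       in \<open>auto simp: BijGroup_carrier\<close>)

lemma h_eq: "x \<in> S \<Longrightarrow> h l x = gen_letters (\<lambda>x. x) p q r l x"
  by (cases "(\<lambda>x::'x. x, p, q, r, l)" rule: gen_letters.cases) (auto simp: BijGroup_one)

lemma foldr_h:
  assumes "x \<in> S"
  shows "foldr h w x = involution_word p q r w x"
proof -
  have "involution_word p q r w x \<in> S \<and> foldr h w x = involution_word p q r w x"
  proof (induction w)
    case (Cons l w)
    have "gen_letters (\<lambda>x. x) p q r l y \<in> S" if "y \<in> S" for y
      by (rule gen_letters_cases[of "\<lambda>x. x" p q r l]) (use closed that in auto)
    then show ?case using Cons h_eq[of "involution_word p q r w x" l] by (simp del: restrict_apply)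
  qed (use assms in auto)
  then show ?thesis ..
qed

lemma action_class:
  assumes "w \<in> lists (letters g)" "x \<in> S"
  shows "involution_action S p q r (word_rel g `` {w}) x = involution_word p q r w x"
  using word_eval_BijGroup[of h S w, OF h_Bij] assms foldr_h
  by (simp add: involution_action_def surface_assignment.surface_lift_class[OF assignment])

end

text \<open>Serves for both equivariant maps out of the tree: its coding in \<open>universe\<close>
  and its map to hyperbolic space.\<close>

lemma involution_word_equivariant:
  fixes p q r :: "'x \<Rightarrow> 'x"
  assumes "\<And>x. x \<in> S \<Longrightarrow> p x \<in> S" "\<And>x. x \<in> S \<Longrightarrow> q x \<in> S" "\<And>x. x \<in> S \<Longrightarrow> r x \<in> S"
    and "\<And>x. x \<in> S \<Longrightarrow> F (p x) = p' (F x)" "\<And>x. x \<in> S \<Longrightarrow> F (q x) = q' (F x)"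
      "\<And>x. x \<in> S \<Longrightarrow> F (r x) = r' (F x)"
    and "x \<in> S"
  shows "F (involution_word p q r w x) = involution_word p' q' r' w (F x)"
proof -
  have "involution_word p q r w x \<in> S \<and> F (involution_word p q r w x) = involution_word p' q' r' w (F x)"
  proof (induction w)
    case (Cons l w)
    show ?case
      by (cases "(\<lambda>x::'x. x, p, q, r, l)" rule: gen_letters.cases) (use Cons assms in auto)
  qed (use assms in simp)
  then show ?thesis ..
qed

lemma gens_in:
  assumes "3 \<le> g"
  shows "(Gen_a 0, False) \<in> letters g" "(Gen_a 1, False) \<in> letters g" "(Gen_a 2, False) \<in> letters g"
  using assms by (auto simp: letters_def)

section \<open>The trivalent tree and its approximations\<close>

type_synonym tree_point = "bool option list \<times> real"

text \<open>The letters \<open>None\<close>, \<open>Some True\<close>, \<open>Some False\<close> stand for \<open>c\<^sub>0\<close>, \<open>c\<^sub>1\<close>, \<open>c\<^sub>2\<close>. The point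
  \<open>(w, s)\<close> lies at distance \<open>s\<close> from the vertex \<open>w\<close>, on the edge joining it to \<open>butlast w\<close>.\<close>

definition tree_pts :: "tree_point set" where
  "tree_pts = {(w, s). distinct_adj w \<and> 0 \<le> s \<and> s < 1 \<and> (w = [] \<longrightarrow> s = 0)}"

text \<open>Left multiplication by the letter \<open>i\<close>, followed by reduction. The edge
  between \<open>[]\<close> and \<open>[i]\<close> is reversed, hence \<open>1 - s\<close>; there
  \<open>s = 0\<close> is a case of its own, since the root has no coordinates
  \<open>([i], 1)\<close> but only \<open>([], 0)\<close>.\<close>

fun flip :: "bool option \<Rightarrow> tree_point \<Rightarrow> tree_point" where
  "flip i ([], s) = ([i], 0)"
| "flip i ([j], s) = (if i = j then if s = 0 then ([], 0) else ([i], 1 - s) else ([i, j], s))"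
| "flip i (j # k # w, s) = (if i = j then (k # w, s) else (i # j # k # w, s))"

fun tree_swap :: "tree_point \<Rightarrow> tree_point" where
  "tree_swap (w, s) = (map (map_option Not) w, s)"

fun lcp :: "'a list \<Rightarrow> 'a list \<Rightarrow> nat" where
  "lcp (x # xs) (y # ys) = (if x = y then Suc (lcp xs ys) else 0)"
| "lcp _ _ = 0"

fun height :: "tree_point \<Rightarrow> real" where
  "height (w, s) = real (length w) - s"

text \<open>The height at which the ways from the root to \<open>x\<close> and \<open>y\<close>
  part, which is their Gromov product at the root. The heights enter because a point may lie on an
  edge before its word ends.\<close>

definition meet :: "tree_point \<Rightarrow> tree_point \<Rightarrow> real" where
  "meet x y = min (min (height x) (height y)) (real (lcp (fst x) (fst y)))"

definition tree_dist :: "tree_point \<Rightarrow> tree_point \<Rightarrow> real" where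
  "tree_dist x y = height x + height y - 2 * meet x y"

text \<open>The three edges at the root go to three segments of length \<open>L\<close>;
  equivariance dictates the rest. The factor \<open>1 - s\<close> appears because \<open>s\<close>
  is measured from the far end of the edge.\<close>

fun embed :: "real \<Rightarrow> tree_point \<Rightarrow> real ^ 3" where
  "embed L ([], s) = 0"
| "embed L ([i], s) = ray_point ((1 - s) * L) (dir i)"
| "embed L (i # j # w, s) = half_turn L i (embed L (j # w, s))"

lemma flip_Cons: "w \<noteq> [] \<Longrightarrow> hd w \<noteq> i \<Longrightarrow> flip i (w, s) = (i # w, s)"
  by (cases "(i, (w, s))" rule: flip.cases) auto

lemma flip_in: "x \<in> tree_pts \<Longrightarrow> flip i x \<in> tree_pts"
  by (cases "(i, x)" rule: flip.cases) (auto simp: tree_pts_def)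

lemma flip_flip: "x \<in> tree_pts \<Longrightarrow> flip i (flip i x) = x"
  by (cases "(i, x)" rule: flip.cases) (auto simp: tree_pts_def flip_Cons)

lemma map_option_Not_inj: "inj (map_option Not)"
  by (rule option.inj_map) (simp add: inj_def)

lemma tree_swap_in: "x \<in> tree_pts \<Longrightarrow> tree_swap x \<in> tree_pts"
  using distinct_adj_map_iff[OF inj_on_subset[OF map_option_Not_inj subset_UNIV]]
  by (cases x) (auto simp: tree_pts_def)

lemma tree_swap_tree_swap: "tree_swap (tree_swap x) = x"
proof -
  have "map_option Not \<circ> map_option Not = id" by (auto simp: fun_eq_iff option.map_comp o_def map_option.identity)
  then show ?thesis by (cases x) (simp add: map_idI o_def fun_eq_iff)
qed

lemma embed_in:
  assumes "0 < L"
  shows "embed L x \<in> hyp_space"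
  using assms by (induction L x rule: embed.induct) (auto intro: ray_point_in half_turn_in)

lemma embed_flip:
  assumes L: "0 < L" and x: "x \<in> tree_pts"
  shows "embed L (flip i x) = half_turn L i (embed L x)"
proof (cases "(i, x)" rule: flip.cases)
  case (1 i s)
  then show ?thesis by (simp add: half_turn_0[OF L])
next
  case (2 i j s)
  have "L - (1 - s) * L = s * L" by (simp add: algebra_simps)
  then show ?thesis using 2 by (simp add: half_turn_ray_point[OF L])
next
  case (3 i j k w s)
  then show ?thesis using half_turn_half_turn[OF L embed_in[OF L]] by simp
qed

lemma embed_tree_swap: "embed L (tree_swap x) = turn1 (embed L x)" if "0 < L"
  using that
proof (induction L x rule: embed.induct)
  case (1 L s)
  then show ?case using linear_turn1 by (simp add: linear_0)
next
  case (2 L i s)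
  then show ?case using linear_turn1
    by (simp add: ray_point_def linear_scale turn1_dir)
qed (simp add: turn1_half_turn)

section \<open>Rescaled distances in the limit of long edges\<close>

lemma const_div_at_top: "((\<lambda>L::real. c / L) \<longlongrightarrow> 0) at_top"
  by (intro tendsto_divide_0[OF tendsto_const] filterlim_at_top_imp_at_infinity filterlim_ident)

definition asym_dist :: "(real \<Rightarrow> real ^ 'n) \<Rightarrow> (real \<Rightarrow> real ^ 'n) \<Rightarrow> real \<Rightarrow> bool" where
  "asym_dist f h r \<longleftrightarrow> ((\<lambda>L. hyp_dist (f L) (h L) / L) \<longlongrightarrow> r) at_top"

lemma asym_dist_commute: "asym_dist f h r \<Longrightarrow> asym_dist h f r"
  by (simp add: asym_dist_def hyp_dist_commute)

lemma eventually_pos: "(\<And>L. 0 < L \<Longrightarrow> P L) \<Longrightarrow> eventually P at_top" for P :: "real \<Rightarrow> bool"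
  using eventually_gt_at_top[of "0::real"] by (rule eventually_mono) simp

lemma asym_dist_cong:
  assumes "asym_dist f' h' r"
    and "\<And>L. 0 < L \<Longrightarrow> hyp_dist (f L) (h L) = hyp_dist (f' L) (h' L)"
  shows "asym_dist f h r"
  using assms(1) unfolding asym_dist_def
  by (rule Lim_transform_eventually) (rule eventually_pos, simp add: assms(2))

text \<open>Two geodesics overlapping along a segment whose length is of the order of the scale concatenate
  to a geodesic, at that scale.\<close>

lemma asym_dist_concat:
  assumes H: "\<And>L. 0 < L \<Longrightarrow> x L \<in> hyp_space" "\<And>L. 0 < L \<Longrightarrow> y L \<in> hyp_space"
      "\<And>L. 0 < L \<Longrightarrow> z L \<in> hyp_space" "\<And>L. 0 < L \<Longrightarrow> w L \<in> hyp_space"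
    and xy: "asym_dist x y a" and yz: "asym_dist y z b" and xz: "asym_dist x z (a + b)"
    and zw: "asym_dist z w c" and yw: "asym_dist y w (b + c)" and b: "0 < b"
  shows "asym_dist x w (a + b + c)"
  unfolding asym_dist_def
proof (rule tendsto_sandwich)
  let ?d = "\<lambda>f h L. hyp_dist (f L) (h L) / L"
  have lim: "(?d x y \<longlongrightarrow> a) at_top" "(?d y z \<longlongrightarrow> b) at_top" "(?d x z \<longlongrightarrow> a + b) at_top"
    "(?d z w \<longlongrightarrow> c) at_top" "(?d y w \<longlongrightarrow> b + c) at_top"
    using xy yz xz zw yw by (simp_all add: asym_dist_def)
  have "((\<lambda>L. ?d x z L + ?d y w L - ?d y z L - hyp_delta / L) \<longlongrightarrow> a + b + (b + c) - b - 0) at_top"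
    by (intro tendsto_add tendsto_diff lim const_div_at_top)
  then show "((\<lambda>L. ?d x z L + ?d y w L - ?d y z L - hyp_delta / L) \<longlongrightarrow> a + b + c) at_top"
    by (simp add: add_ac)
  show "((\<lambda>L. ?d x z L + ?d z w L) \<longlongrightarrow> a + b + c) at_top"
    by (intro tendsto_add lim)
  show "\<forall>\<^sub>F L in at_top. ?d x w L \<le> ?d x z L + ?d z w L"
  proof (rule eventually_pos)
    fix L :: real assume L: "0 < L"
    show "?d x w L \<le> ?d x z L + ?d z w L"
      using divide_right_mono[OF hyp_dist_triangle[OF H(1,3,4)], of L] L by (simp add: add_divide_distrib)
  qed
  \<comment> \<open>The limit \<open>2 * b\<close> is positive, so that the pairing of
    \<open>x y\<close> with \<open>z w\<close> eventually cannot attain the maximum in the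
    four-point inequality; the other pairing contains the distance sought.\<close>
  have "((\<lambda>L. ?d x z L + ?d y w L - ?d x y L - ?d z w L - hyp_delta / L)
      \<longlongrightarrow> a + b + (b + c) - a - c - 0) at_top"
    by (intro tendsto_add tendsto_diff lim const_div_at_top)
  then have "\<forall>\<^sub>F L in at_top. 0 < ?d x z L + ?d y w L - ?d x y L - ?d z w L - hyp_delta / L"
    by (rule order_tendstoD) (use b in simp)
  then show "\<forall>\<^sub>F L in at_top. ?d x z L + ?d y w L - ?d y z L - hyp_delta / L \<le> ?d x w L"
    using eventually_gt_at_top[of 0]
  proof eventually_elim
    case (elim L)
    have "hyp_dist (x L) (z L) + hyp_dist (y L) (w L) \<le>
        max (hyp_dist (x L) (y L) + hyp_dist (z L) (w L)) (hyp_dist (x L) (w L) + hyp_dist (z L) (y L)) + hyp_delta"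
      by (rule four_pointD[OF four_point_hyp]) (use H elim in auto)
    moreover have "hyp_dist (x L) (y L) + hyp_dist (z L) (w L) + hyp_delta < hyp_dist (x L) (z L) + hyp_dist (y L) (w L)"
      using elim by (simp add: add_divide_distrib[symmetric] diff_divide_distrib[symmetric] zero_less_divide_iff
          del: zero_less_divide_1_iff)
    ultimately have "hyp_dist (x L) (z L) + hyp_dist (y L) (w L) - hyp_dist (y L) (z L) - hyp_delta \<le> hyp_dist (x L) (w L)"
      by (simp add: hyp_dist_commute[of "z L"])
    from divide_right_mono[OF this, of L] show ?case using elim
      by (simp add: add_divide_distrib diff_divide_distrib)
  qed
qed

abbreviation scaled_ray :: "bool option \<Rightarrow> real \<Rightarrow> real \<Rightarrow> real ^ 3" where
  "scaled_ray i r \<equiv> \<lambda>L. ray_point (r * L) (dir i)"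

lemma asym_dist_exact:
  assumes "\<And>L. 0 < L \<Longrightarrow> hyp_dist (f L) (h L) = r * L"
  shows "asym_dist f h r"
  unfolding asym_dist_def
  by (rule Lim_transform_eventually[OF tendsto_const]) (rule eventually_pos, simp add: assms)

lemma asym_dist_0_ray: "0 \<le> r \<Longrightarrow> asym_dist (\<lambda>L. 0) (scaled_ray i r) r"
  by (rule asym_dist_exact) (simp add: hyp_dist_0_ray_point)

lemma asym_dist_same_ray: "asym_dist (scaled_ray i r) (scaled_ray i r') \<bar>r - r'\<bar>"
proof (rule asym_dist_exact)
  fix L :: real assume "0 < L"
  then have "\<bar>r - r'\<bar> * L = \<bar>r * L - r' * L\<bar>" by (simp add: left_diff_distrib[symmetric] abs_mult)
  then show "hyp_dist (ray_point (r * L) (dir i)) (ray_point (r' * L) (dir i)) = \<bar>r - r'\<bar> * L"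
    by (simp add: hyp_dist_ray_point_same)
qed

lemma asym_dist_distinct_rays:
  assumes "i \<noteq> j" "0 \<le> r" "0 \<le> r'"
  shows "asym_dist (scaled_ray i r) (scaled_ray j r') (r + r')"
  unfolding asym_dist_def
proof (rule tendsto_sandwich)
  let ?d = "\<lambda>L. hyp_dist (ray_point (r * L) (dir i)) (ray_point (r' * L) (dir j))"
  have "((\<lambda>L::real. r + r' - ln 4 / L) \<longlongrightarrow> r + r' - 0) at_top"
    by (intro tendsto_diff tendsto_const const_div_at_top)
  then show "((\<lambda>L::real. r + r' - ln 4 / L) \<longlongrightarrow> r + r') at_top" by simp
  show "((\<lambda>L::real. r + r') \<longlongrightarrow> r + r') at_top" by simp
  show "\<forall>\<^sub>F L in at_top. r + r' - ln 4 / L \<le> ?d L / L"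
    using eventually_gt_at_top[of 0]
  proof eventually_elim
    case (elim L)
    have "r * L + r' * L - ln 4 \<le> ?d L"
      by (rule hyp_dist_ray_point_obtuse) (use assms elim dir_obtuse in auto)
    from divide_right_mono[OF this, of L] show ?case
      using elim by (simp add: add_divide_distrib diff_divide_distrib)
  qed
  show "\<forall>\<^sub>F L in at_top. ?d L / L \<le> r + r'"
    using eventually_gt_at_top[of 0]
  proof eventually_elim
    case (elim L)
    have "?d L \<le> hyp_dist (ray_point (r * L) (dir i)) 0 + hyp_dist 0 (ray_point (r' * L) (dir j))"
      by (rule hyp_dist_triangle) (auto intro: ray_point_in)
    then have "?d L \<le> r * L + r' * L"
      using assms elim by (simp add: hyp_dist_0_ray_point hyp_dist_commute[of _ 0])
    from divide_right_mono[OF this, of L] show ?case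
      using elim by (simp add: add_divide_distrib diff_divide_distrib)
  qed
qed

lemma hyp_dist_half_turn_left:
  assumes L: "0 < L" and xy: "x \<in> hyp_space" "y \<in> hyp_space"
  shows "hyp_dist (half_turn L i x) y = hyp_dist x (half_turn L i y)"
  using hyp_dist_half_turn[OF L xy(1) half_turn_in[OF L xy(2)], of i i] half_turn_half_turn[OF L xy(2)] by simp

lemma ray_point_dir_in [simp]: "ray_point a (dir i) \<in> hyp_space"
  by (simp add: ray_point_in)

text \<open>The half-turn c_i removes the first letter. The way from the remaining point to the
  turned ray point follows the edge from 0 to c_i 0, whose length \<open>L\<close> provides the
  overlap for \<open>asym_dist_concat\<close>. Allowing all \<open>r\<close> from 0 to 1 gives the
  induction hypothesis at both ends of this edge.\<close>

lemma embed_ray_asymptotic: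
  assumes "w \<noteq> []" "distinct_adj w" "0 \<le> s" "s < 1" "j \<noteq> hd w" "0 \<le> r" "r \<le> 1"
  shows "asym_dist (\<lambda>L. embed L (w, s)) (scaled_ray j r) (real (length w) - s + r)"
  using assms
proof (induction w arbitrary: j r)
  case (Cons i w)
  note r = Cons.prems(6,7) and s = Cons.prems(3,4)
  show ?case
  proof (cases w)
    case Nil
    then show ?thesis using asym_dist_distinct_rays[of i j "1 - s" r] Cons.prems by simp
  next
    case (Cons k v)
    have k: "i \<noteq> k" "distinct_adj w" using Cons.prems(2) Cons by (auto simp: \<open>w = k # v\<close>)
    have IH: "asym_dist (\<lambda>L. embed L (w, s)) (scaled_ray i t) (real (length w) - s + t)"
      if "0 \<le> t" "t \<le> 1" for t
      using Cons.IH[of i t] k that s \<open>w = k # v\<close> by simp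
    have one: "half_turn L i 0 = ray_point L (dir i)" if "0 < L" for L
      using half_turn_0[OF that] .
    have ij: "i \<noteq> j" using Cons.prems(5) by simp
    have "asym_dist (\<lambda>L. embed L (w, s)) (\<lambda>L. half_turn L i (ray_point (r * L) (dir j)))
      ((real (length w) - s) + 1 + r)"
    proof (rule asym_dist_concat)
      show "asym_dist (\<lambda>L. embed L (w, s)) (\<lambda>L. 0) (real (length w) - s)"
        using IH[of 0] by simp
      show "asym_dist (\<lambda>L. embed L (w, s)) (scaled_ray i 1) (real (length w) - s + 1)"
        using IH[of 1] by simp
      show "asym_dist (\<lambda>L. 0) (scaled_ray i 1) 1"
        by (rule asym_dist_0_ray) simp
      show "asym_dist (scaled_ray i 1) (\<lambda>L. half_turn L i (ray_point (r * L) (dir j))) r"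
      proof (rule asym_dist_exact)
        fix L :: real assume L: "0 < L"
        show "hyp_dist (ray_point (1 * L) (dir i)) (half_turn L i (ray_point (r * L) (dir j))) = r * L"
          using hyp_dist_half_turn[OF L, of 0 "ray_point (r * L) (dir j)" i] one[OF L] L r
          by (simp add: hyp_dist_0_ray_point)
      qed
      have "hyp_dist 0 (half_turn L i (ray_point (r * L) (dir j))) =
          hyp_dist (ray_point (1 * L) (dir i)) (ray_point (r * L) (dir j))" if L: "0 < L" for L
        using hyp_dist_half_turn_left[OF L, of 0 "ray_point (r * L) (dir j)" i] one[OF L] by simp
      then show "asym_dist (\<lambda>L. 0) (\<lambda>L. half_turn L i (ray_point (r * L) (dir j))) (1 + r)"
        by (rule asym_dist_cong[OF asym_dist_distinct_rays[OF ij zero_le_one r(1)]])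
    qed (auto intro: embed_in half_turn_in)
    moreover have "hyp_dist (embed L (i # w, s)) (ray_point (r * L) (dir j)) =
        hyp_dist (embed L (w, s)) (half_turn L i (ray_point (r * L) (dir j)))" if L: "0 < L" for L
      using hyp_dist_half_turn_left[OF L embed_in[OF L], of "ray_point (r * L) (dir j)"] \<open>w = k # v\<close> by simp
    ultimately have "asym_dist (\<lambda>L. embed L (i # w, s)) (scaled_ray j r) ((real (length w) - s) + 1 + r)"
      by (rule asym_dist_cong)
    then show ?thesis by (simp add: algebra_simps)
  qed
qed simp

lemma embed_0_asymptotic:
  assumes "(w, s) \<in> tree_pts"
  shows "asym_dist (\<lambda>L. embed L (w, s)) (\<lambda>L. 0) (real (length w) - s)"
proof (cases w)
  case Nil
  then show ?thesis using assms by (intro asym_dist_exact) (simp add: tree_pts_def hyp_dist_eq_0_iff)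
next
  case (Cons i v)
  obtain j where "j \<noteq> i" by (metis option.distinct(1))
  then show ?thesis
    using embed_ray_asymptotic[of w s j 0] assms Cons by (simp add: tree_pts_def)
qed

text \<open>Here the overlap is the first edge on the way to the second point, and the half-turn c_j
  moves its far end to the origin.\<close>

lemma embed_branch_asymptotic:
  assumes x: "(w, s) \<in> tree_pts" and y: "(w', s') \<in> tree_pts"
    and ne: "w \<noteq> []" "w' \<noteq> []" "hd w \<noteq> hd w'"
  shows "asym_dist (\<lambda>L. embed L (w, s)) (\<lambda>L. embed L (w', s'))
    ((real (length w) - s) + (real (length w') - s'))"
proof -
  obtain j v where w': "w' = j # v" using ne(2) by (cases w') auto
  have ray: "asym_dist (\<lambda>L. embed L (w, s)) (scaled_ray j t) (real (length w) - s + t)"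
    if "0 \<le> t" "t \<le> 1" for t
    by (rule embed_ray_asymptotic) (use that x ne w' in \<open>auto simp: tree_pts_def\<close>)
  show ?thesis
  proof (cases v)
    case Nil
    then show ?thesis using ray[of "1 - s'"] y w' by (simp add: tree_pts_def)
  next
    case (Cons k u)
    have v: "(v, s') \<in> tree_pts" using y w' Cons by (auto simp: tree_pts_def)
    have "asym_dist (\<lambda>L. embed L (w, s)) (\<lambda>L. embed L (w', s'))
      ((real (length w) - s) + 1 + (real (length v) - s'))"
    proof (rule asym_dist_concat)
      show "asym_dist (\<lambda>L. embed L (w, s)) (\<lambda>L. 0) (real (length w) - s)"
        by (rule embed_0_asymptotic[OF x])
      show "asym_dist (\<lambda>L. embed L (w, s)) (scaled_ray j 1) (real (length w) - s + 1)"
        using ray[of 1] by simp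
      show "asym_dist (\<lambda>L. 0) (scaled_ray j 1) 1"
        by (rule asym_dist_0_ray) simp
      have "hyp_dist (ray_point (1 * L) (dir j)) (embed L (w', s')) =
          hyp_dist (embed L (v, s')) 0" if L: "0 < L" for L
        using hyp_dist_half_turn[OF L, of 0 "embed L (v, s')" j] half_turn_0[OF L, of j] w' Cons
          embed_in[OF L] by (simp add: hyp_dist_commute[of _ 0])
      then show "asym_dist (scaled_ray j 1) (\<lambda>L. embed L (w', s')) (real (length v) - s')"
        by (rule asym_dist_cong[OF embed_0_asymptotic[OF v]])
      show "asym_dist (\<lambda>L. 0) (\<lambda>L. embed L (w', s')) (1 + (real (length v) - s'))"
        using asym_dist_commute[OF embed_0_asymptotic[OF y]] w' by (simp add: algebra_simps)
    qed (auto intro: embed_in half_turn_in)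
    then show ?thesis using w' by (simp add: algebra_simps)
  qed
qed

section \<open>The metric of the tree\<close>

lemma height_nonneg: "x \<in> tree_pts \<Longrightarrow> 0 \<le> height x"
  by (cases x; cases "fst x") (auto simp: tree_pts_def)

lemma tree_pts_ConsD: "(i # j # w, s) \<in> tree_pts \<Longrightarrow> (j # w, s) \<in> tree_pts \<and> i \<noteq> j"
  by (auto simp: tree_pts_def)

lemma tree_dist_commute: "tree_dist x y = tree_dist y x"
proof -
  have "lcp u v = lcp v u" for u v :: "bool option list"
    by (induction u v rule: lcp.induct) auto
  then show ?thesis by (simp add: tree_dist_def meet_def min.commute)
qed

text \<open>Removing the common letter \<open>i\<close> reverses the root edge that carries the
  first point: its distance from the origin becomes \<open>s * L\<close>, while the other word now
  starts with a letter different from \<open>i\<close>.\<close>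

lemma tree_dist_asymptotic_short:
  assumes "([i], s) \<in> tree_pts" "(i # j # w, s') \<in> tree_pts"
  shows "asym_dist (\<lambda>L. embed L ([i], s)) (\<lambda>L. embed L (i # j # w, s'))
    (tree_dist ([i], s) (i # j # w, s'))"
proof (rule asym_dist_cong)
  show "asym_dist (scaled_ray i s) (\<lambda>L. embed L (j # w, s')) (tree_dist ([i], s) (i # j # w, s'))"
  proof -
    have "asym_dist (\<lambda>L. embed L (j # w, s')) (scaled_ray i s) (real (length (j # w)) - s' + s)"
      by (rule embed_ray_asymptotic) (use assms in \<open>auto simp: tree_pts_def\<close>)
    moreover have "tree_dist ([i], s) (i # j # w, s') = real (length (j # w)) - s' + s"
      using assms by (auto simp: tree_dist_def meet_def tree_pts_def min_def)
    ultimately show ?thesis by (simp add: asym_dist_commute)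
  qed
  fix L :: real assume L: "0 < L"
  have "L - (1 - s) * L = s * L" by (simp add: algebra_simps)
  then show "hyp_dist (embed L ([i], s)) (embed L (i # j # w, s')) =
      hyp_dist (ray_point (s * L) (dir i)) (embed L (j # w, s'))"
    using hyp_dist_half_turn_left[OF L, of "ray_point ((1 - s) * L) (dir i)" "embed L (j # w, s')" i]
      half_turn_ray_point[OF L, of i "(1 - s) * L"] embed_in[OF L] by simp
qed

text \<open>Common first letters are removed by half-turns, which change neither the hyperbolic
  distance nor the formula, until the words branch at the root or one point lies on an edge at the
  root.\<close>

lemma tree_dist_asymptotic:
  assumes "x \<in> tree_pts" "y \<in> tree_pts"
  shows "asym_dist (\<lambda>L. embed L x) (\<lambda>L. embed L y) (tree_dist x y)"
proof -
  have "asym_dist (\<lambda>L. embed L (w, s)) (\<lambda>L. embed L (w', s')) (tree_dist (w, s) (w', s'))"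
    if "(w, s) \<in> tree_pts" "(w', s') \<in> tree_pts" for w s w' s'
    using that
  proof (induction w w' rule: lcp.induct)
    case (1 i w j w')
    show ?case
    proof (cases "i = j")
      case False
      then show ?thesis
        using embed_branch_asymptotic[OF 1(2,3)] height_nonneg[OF 1(2)] height_nonneg[OF 1(3)]
        by (simp add: tree_dist_def meet_def)
    next
      case True
      consider "w = []" "w' = []" | k v where "w = []" "w' = k # v" | k v where "w = k # v" "w' = []"
        | k v k' v' where "w = k # v" "w' = k' # v'" by (metis list.exhaust)
      then show ?thesis
      proof cases
        case 1
        have "tree_dist ([i], s) ([i], s') = \<bar>(1 - s) - (1 - s')\<bar>"
          using "1.prems" True 1 by (auto simp: tree_dist_def meet_def tree_pts_def min_def)
        then show ?thesis using asym_dist_same_ray[of "1 - s" i "1 - s'"] 1 True by simp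
      next
        case 2
        then show ?thesis using tree_dist_asymptotic_short "1.prems" True by simp
      next
        case 3
        then show ?thesis
          using asym_dist_commute[OF tree_dist_asymptotic_short[of i s' k v s]] "1.prems" True tree_dist_commute
          by simp
      next
        case 4
        have "asym_dist (\<lambda>L. embed L (w, s)) (\<lambda>L. embed L (w', s')) (tree_dist (w, s) (w', s'))"
          using "1.IH" "1.prems" True 4 tree_pts_ConsD by blast
        then have "asym_dist (\<lambda>L. embed L (i # w, s)) (\<lambda>L. embed L (i # w', s')) (tree_dist (w, s) (w', s'))"
          by (rule asym_dist_cong) (simp add: 4 hyp_dist_half_turn embed_in)
        moreover have "tree_dist (i # w, s) (i # w', s') = tree_dist (w, s) (w', s')"
          by (simp add: tree_dist_def meet_def min_def)
        ultimately show ?thesis using True by simp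
      qed
    qed
  next
    case ("2_1" w')
    then show ?case
      using asym_dist_commute[OF embed_0_asymptotic] height_nonneg[of "(w', s')"]
      by (simp add: tree_dist_def meet_def tree_pts_def)
  next
    case ("2_2" w)
    then show ?case
      using embed_0_asymptotic height_nonneg[of "(w, s)"]
      by (simp add: tree_dist_def meet_def tree_pts_def)
  qed
  then show ?thesis using assms by (cases x, cases y) simp
qed

lemma tree_dist_nonneg: "0 \<le> tree_dist x y"
  by (simp add: tree_dist_def meet_def)

lemma lcp_self [simp]: "lcp u u = length u"
  by (induction u) auto

lemma lcp_full: "length u = length v \<Longrightarrow> length u \<le> lcp u v \<Longrightarrow> u = v"
  by (induction u v rule: lcp.induct) (auto split: if_splits)

lemma lcp_take: "lcp (take a u) (take b v) = min (min a b) (lcp u v)"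
proof (induction u v arbitrary: a b rule: lcp.induct)
  case (1 x xs y ys)
  then show ?case by (cases a; cases b) auto
qed auto

lemma tree_pts_ceiling: "(w, s) \<in> tree_pts \<Longrightarrow> \<lceil>real (length w) - s\<rceil> = int (length w)"
  by (auto simp: tree_pts_def ceiling_eq_iff)

text \<open>A limit of metrics need not separate points, so definiteness comes from the formula. As
  \<open>0 \<le> s < 1\<close>, rounding the height up recovers the length of the word.\<close>

lemma tree_dist_eq_0_iff:
  assumes x: "x \<in> tree_pts" and y: "y \<in> tree_pts"
  shows "tree_dist x y = 0 \<longleftrightarrow> x = y"
proof
  assume 0: "tree_dist x y = 0"
  obtain w s v t where xy: "x = (w, s)" "y = (v, t)" by (cases x, cases y)
  have h: "height x = height y" "height x \<le> real (lcp w v)"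
    using 0 by (auto simp: tree_dist_def meet_def xy min_def split: if_splits)
  then have len: "length w = length v"
    using tree_pts_ceiling[of w s] tree_pts_ceiling[of v t] x y xy by simp
  then have "s = t" using h xy by simp
  moreover have "w = v"
  proof (rule lcp_full[OF len])
    have "real (length w) < real (lcp w v) + 1" using h(2) x xy by (auto simp: tree_pts_def)
    then show "length w \<le> lcp w v" by linarith
  qed
  ultimately show "x = y" using xy by simp
next
  assume "x = y"
  then show "tree_dist x y = 0" using x by (cases x) (auto simp: tree_dist_def meet_def tree_pts_def)
qed

lemma tree_dist_tendsto:
  "x \<in> tree_pts \<Longrightarrow> y \<in> tree_pts \<Longrightarrow>
    ((\<lambda>L. hyp_dist (embed L x) (embed L y) / L) \<longlongrightarrow> tree_dist x y) at_top"
  using tree_dist_asymptotic by (simp add: asym_dist_def)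

text \<open>The constant \<open>hyp_delta\<close> is divided by \<open>L\<close> and disappears in
  the limit.\<close>

lemma tree_four_point: "four_point tree_pts tree_dist 0"
  unfolding four_point_def
proof (intro ballI)
  fix x y z w assume X: "x \<in> tree_pts" "y \<in> tree_pts" "z \<in> tree_pts" "w \<in> tree_pts"
  let ?d = "\<lambda>x y L. hyp_dist (embed L x) (embed L y) / L"
  note t = tree_dist_tendsto
  have "((\<lambda>L. max (?d x z L + ?d y w L) (?d x w L + ?d y z L) + hyp_delta / L) \<longlongrightarrow>
      max (tree_dist x z + tree_dist y w) (tree_dist x w + tree_dist y z) + 0) at_top"
    by (intro tendsto_add tendsto_max t X const_div_at_top)
  moreover have "((\<lambda>L. ?d x y L + ?d z w L) \<longlongrightarrow> tree_dist x y + tree_dist z w) at_top"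
    by (intro tendsto_add t X)
  moreover have "\<forall>\<^sub>F L in at_top. ?d x y L + ?d z w L \<le>
      max (?d x z L + ?d y w L) (?d x w L + ?d y z L) + hyp_delta / L"
  proof (rule eventually_pos)
    fix L :: real assume L: "0 < L"
    note E = embed_in[OF L]
    show "?d x y L + ?d z w L \<le> max (?d x z L + ?d y w L) (?d x w L + ?d y z L) + hyp_delta / L"
      using divide_right_mono[OF four_pointD[OF four_point_hyp E[of x] E[of y] E[of z] E[of w]], of L] L
      by (simp add: add_divide_distrib max_divide_distrib_right)
  qed
  ultimately show "tree_dist x y + tree_dist z w \<le>
      max (tree_dist x z + tree_dist y w) (tree_dist x w + tree_dist y z) + 0"
    by (intro tendsto_le[of at_top]) auto
qed

lemma tree_dist_triangle:
  assumes "x \<in> tree_pts" "y \<in> tree_pts" "z \<in> tree_pts"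
  shows "tree_dist x z \<le> tree_dist x y + tree_dist y z"
  using four_pointD[OF tree_four_point assms(1,3,2,2)] tree_dist_nonneg[of y y] tree_dist_commute[of z y] by simp

text \<open>By uniqueness of limits, a map of the tree that \<open>embed\<close> intertwines with
  isometries of hyperbolic space is an isometry.\<close>

lemma tree_dist_eqI:
  assumes "x \<in> tree_pts" "y \<in> tree_pts" "x' \<in> tree_pts" "y' \<in> tree_pts"
    and "\<And>L. 0 < L \<Longrightarrow> hyp_dist (embed L x') (embed L y') = hyp_dist (embed L x) (embed L y)"
  shows "tree_dist x' y' = tree_dist x y"
  using asym_dist_cong[OF tree_dist_asymptotic[OF assms(1,2)] assms(5)] tree_dist_asymptotic[OF assms(3,4)]
  unfolding asym_dist_def by (intro tendsto_unique[OF trivial_limit_at_top_linorder])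

lemma tree_dist_flip:
  "x \<in> tree_pts \<Longrightarrow> y \<in> tree_pts \<Longrightarrow> tree_dist (flip i x) (flip i y) = tree_dist x y"
  by (rule tree_dist_eqI) (simp_all add: flip_in embed_flip hyp_dist_half_turn embed_in)

lemma tree_dist_tree_swap:
  "x \<in> tree_pts \<Longrightarrow> y \<in> tree_pts \<Longrightarrow> tree_dist (tree_swap x) (tree_swap y) = tree_dist x y"
  by (rule tree_dist_eqI)
     (simp_all add: tree_swap_in embed_tree_swap orthogonal_hyp_dist orthogonal_turn1 del: tree_swap.simps)

section \<open>Geodesics and convex subsets of the tree\<close>

text \<open>The point at height \<open>r\<close> on the way from the root to \<open>x\<close>;
  rounding \<open>r\<close> up finds the edge on which it lies.\<close>

definition truncate :: "tree_point \<Rightarrow> real \<Rightarrow> tree_point" where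
  "truncate x r = (take (nat \<lceil>r\<rceil>) (fst x), of_int \<lceil>r\<rceil> - r)"

lemma distinct_adj_take: "distinct_adj w \<Longrightarrow> distinct_adj (take n w)"
  by (metis append_take_drop_id distinct_adj_appendD1)

context
  fixes x :: tree_point and r :: real
  assumes x: "x \<in> tree_pts" and r: "0 \<le> r" "r \<le> height x"
begin

lemma truncate_length: "nat \<lceil>r\<rceil> \<le> length (fst x)"
proof -
  have "r \<le> real (length (fst x))" using x r by (cases x) (auto simp: tree_pts_def)
  then have "\<lceil>r\<rceil> \<le> int (length (fst x))" by (simp add: ceiling_le_iff)
  then show ?thesis by (simp only: nat_le_iff)
qed

lemma height_truncate: "height (truncate x r) = r"
  using truncate_length r(1) by (simp add: truncate_def min_absorb2)

lemma truncate_in: "truncate x r \<in> tree_pts"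
proof -
  have "distinct_adj (fst x)" using x by (auto simp: tree_pts_def)
  moreover have "fst x \<noteq> [] \<or> r = 0" using truncate_length r by (cases "fst x") auto
  moreover have "of_int \<lceil>r\<rceil> - r < 1" "0 \<le> of_int \<lceil>r\<rceil> - r" using ceiling_correct[of r] by linarith+
  ultimately show ?thesis
    using r(1) by (auto simp: truncate_def tree_pts_def distinct_adj_take)
qed

end

lemma truncate_height: "x \<in> tree_pts \<Longrightarrow> truncate x (height x) = x"
  by (cases x) (simp add: truncate_def tree_pts_ceiling)

lemma meet_truncate:
  assumes x: "x \<in> tree_pts" and y: "y \<in> tree_pts"
    and r: "0 \<le> r" "r \<le> height x" and t: "0 \<le> t" "t \<le> height y"
  shows "meet (truncate x r) (truncate y t) = min (min r t) (real (lcp (fst x) (fst y)))"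
proof -
  have "r \<le> real (nat \<lceil>r\<rceil>)" "t \<le> real (nat \<lceil>t\<rceil>)" using r t by linarith+
  then show ?thesis
    using height_truncate[OF x r] height_truncate[OF y t]
    by (simp add: meet_def) (simp add: truncate_def lcp_take min_def)
qed

lemma meet_self: "x \<in> tree_pts \<Longrightarrow> height x \<le> real (lcp (fst x) (fst x))"
  by (cases x) (auto simp: tree_pts_def)

lemma meet_bounds:
  assumes "x \<in> tree_pts" "y \<in> tree_pts"
  shows "0 \<le> meet x y" "meet x y \<le> height x" "meet x y \<le> height y"
  using height_nonneg assms by (auto simp: meet_def)

lemma tree_geodesic:
  assumes x: "x \<in> tree_pts" and y: "y \<in> tree_pts"
  shows "\<exists>\<sigma>. geodesic_segment tree_pts tree_dist x y \<sigma>"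
proof -
  let ?m = "meet x y" and ?p = "height x" and ?q = "height y"
  note m = meet_bounds[OF x y]
  have d: "tree_dist x y = ?p + ?q - 2 * ?m" by (simp add: tree_dist_def)
  \<comment> \<open>The path descends from \<open>x\<close> to the branch point at height
    \<open>?m\<close> and climbs from there to \<open>y\<close>.\<close>
  define c where "c u = (if u \<le> ?p - ?m then truncate x (?p - u) else truncate y (u - ?p + 2 * ?m))" for u
  have same: "tree_dist (truncate z r) (truncate z t) = \<bar>r - t\<bar>"
    if "z \<in> tree_pts" "0 \<le> r" "r \<le> height z" "0 \<le> t" "t \<le> height z" for z r t
    using that meet_truncate[OF that(1) that(1) that(2-5)] meet_self[OF that(1)]
      height_truncate[OF that(1,2,3)] height_truncate[OF that(1,4,5)]
    by (simp add: tree_dist_def min_def)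
  have cross: "tree_dist (truncate x r) (truncate y t) = r + t - 2 * ?m"
    if "?m \<le> r" "r \<le> ?p" "?m \<le> t" "t \<le> ?q" for r t
  proof -
    have "min (min r t) (real (lcp (fst x) (fst y))) = ?m"
      using that by (auto simp: meet_def min_def split: if_splits)
    then show ?thesis
      using meet_truncate[OF x y, of r t] height_truncate[OF x, of r] height_truncate[OF y, of t] that m
      by (simp add: tree_dist_def)
  qed
  have range: "c u \<in> tree_pts" if "u \<in> {0..tree_dist x y}" for u
    using that m truncate_in[OF x, of "?p - u"] truncate_in[OF y, of "u - ?p + 2 * ?m"]
    by (auto simp: c_def d)
  have iso: "tree_dist (c u) (c v) = v - u" if "0 \<le> u" "u \<le> v" "v \<le> tree_dist x y" for u v
  proof -
    consider "v \<le> ?p - ?m" | "u \<le> ?p - ?m" "?p - ?m < v" | "?p - ?m < u" by linarith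
    then show ?thesis
    proof cases
      case 1
      then show ?thesis using same[OF x, of "?p - u" "?p - v"] that m by (simp add: c_def)
    next
      case 2
      then show ?thesis using cross[of "?p - u" "v - ?p + 2 * ?m"] that m by (simp add: c_def d)
    next
      case 3
      then show ?thesis using same[OF y, of "u - ?p + 2 * ?m" "v - ?p + 2 * ?m"] that m by (simp add: c_def d)
    qed
  qed
  have "c 0 = x" using m by (simp add: c_def truncate_height[OF x])
  moreover have "c (tree_dist x y) = y"
  proof (cases "tree_dist x y \<le> ?p - ?m")
    case True
    \<comment> \<open>In this case the path only descends: \<open>y\<close> itself is the branch
      point, but is reached as a truncation of \<open>x\<close>.\<close>
    then have q: "?q = ?m" using d m by simp
    have "tree_dist (truncate x ?m) (truncate y ?q) = 0" using cross[of ?m ?q] q m by simp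
    then have "truncate x ?m = y"
      using tree_dist_eq_0_iff[OF truncate_in[OF x m(1,2)] y] truncate_height[OF y] by simp
    moreover have "?p - tree_dist x y = ?m" using d q by simp
    ultimately show ?thesis using True by (simp add: c_def)
  next
    case False
    then show ?thesis using d by (simp add: c_def truncate_height[OF y])
  qed
  moreover have "tree_dist (c u) (c v) = \<bar>u - v\<bar>" if "u \<in> {0..tree_dist x y}" "v \<in> {0..tree_dist x y}" for u v
    using iso[of u v] iso[of v u] that tree_dist_commute[of "c u" "c v"] by (cases "u \<le> v") auto
  ultimately show ?thesis
    using range unfolding geodesic_segment_def by (intro exI[of _ "c ` {0..tree_dist x y}"] exI[of _ c]) auto
qed

lemma tree_dist_root: "x \<in> tree_pts \<Longrightarrow> tree_dist ([], 0) x = height x"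
  using height_nonneg[of x] by (simp add: tree_dist_def meet_def)

lemma root_in: "([], 0) \<in> tree_pts"
  by (simp add: tree_pts_def)

lemma tree_dist_flip_far:
  assumes "(w, s) \<in> tree_pts" "w = [] \<or> hd w \<noteq> i"
  shows "flip i (w, s) = (i # w, s)" "tree_dist (w, s) (flip i (w, s)) = 2 * height (w, s) + 1"
proof -
  show e: "flip i (w, s) = (i # w, s)"
    using assms flip_Cons[of w i s] by (cases w) (auto simp: tree_pts_def)
  have "lcp w (i # w) = 0" using assms(2) by (cases w) auto
  then show "tree_dist (w, s) (flip i (w, s)) = 2 * height (w, s) + 1"
    using height_nonneg[OF assms(1)] unfolding e by (simp add: tree_dist_def meet_def)
qed

text \<open>The midpoints of two edges at the root are at distance \<open>1\<close>, so one of the two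
  flips moves every point by at least \<open>1\<close>.\<close>

lemma tree_dist_flip_ge:
  assumes "x \<in> tree_pts" "i \<noteq> j"
  shows "1 \<le> tree_dist x (flip i x) \<or> 1 \<le> tree_dist x (flip j x)"
proof -
  obtain w s where x: "x = (w, s)" by (cases x)
  show ?thesis
    using tree_dist_flip_far[of w s i] tree_dist_flip_far[of w s j] assms height_nonneg[OF assms(1)] x
    by (cases "w = [] \<or> hd w \<noteq> i") auto
qed

lemma root_between_flip:
  assumes "(w, s) \<in> tree_pts" "w = [] \<or> hd w \<noteq> i"
  shows "tree_dist (w, s) ([], 0) + tree_dist ([], 0) (flip i (w, s)) = tree_dist (w, s) (flip i (w, s))"
  using tree_dist_flip_far[OF assms] tree_dist_root[OF assms(1)] tree_dist_root[OF flip_in[OF assms(1), of i]]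
  by (simp add: tree_dist_commute[of _ "([], 0)"])

lemma tree_point_between:
  assumes "(w, s) \<in> tree_pts"
  shows "tree_dist ([], 0) (w, s) + tree_dist (w, s) (w, 0) = tree_dist ([], 0) (w, 0)"
proof -
  have "(w, 0) \<in> tree_pts" using assms by (auto simp: tree_pts_def)
  then show ?thesis using assms
    by (simp add: tree_dist_root) (auto simp: tree_dist_def meet_def tree_pts_def)
qed

text \<open>Every vertex is obtained from the root by flipping edges, and a convex set containing all
  vertices is everything.\<close>

lemma tree_hull:
  assumes conv: "\<And>p q r. p \<in> Y \<Longrightarrow> q \<in> Y \<Longrightarrow> r \<in> tree_pts \<Longrightarrow> tree_dist p r + tree_dist r q = tree_dist p q \<Longrightarrow> r \<in> Y"
    and inv: "\<And>i p. p \<in> Y \<Longrightarrow> flip i p \<in> Y"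
    and Y: "Y \<subseteq> tree_pts" "Y \<noteq> {}"
  shows "Y = tree_pts"
proof -
  obtain w s where p: "(w, s) \<in> Y" using Y(2) by auto
  obtain i where i: "w = [] \<or> hd w \<noteq> i" by (metis option.distinct(1))
  have root: "([], 0) \<in> Y"
    using conv[OF p inv[OF p] root_in root_between_flip[OF _ i]] p Y(1) by blast
  have vertex: "distinct_adj v \<Longrightarrow> (v, 0) \<in> Y" for v
  proof (induction v)
    case (Cons j v)
    then have "(v, 0) \<in> Y" "(v, 0::real) \<in> tree_pts" "v = [] \<or> hd v \<noteq> j"
      by (auto simp: distinct_adj_Cons tree_pts_def)
    then show ?case using inv[of "(v, 0)" j] tree_dist_flip_far(1)[of v 0 j] by simp
  qed (rule root)
  have "(v, t) \<in> Y" if "(v, t) \<in> tree_pts" for v t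
    using conv[OF root vertex that tree_point_between[OF that]] that by (auto simp: tree_pts_def)
  then show ?thesis using Y(1) by auto
qed

section \<open>Orientation in the hyperbolic plane\<close>

text \<open>Up to a positive factor, the determinant of the hyperboloid coordinates
  \<open>(1 + |x|\<^sup>2, 2 x\<^sub>1, 2 x\<^sub>2) / (1 - |x|\<^sup>2)\<close> of the three points. It vanishes exactly when they
  lie on a geodesic.\<close>

definition det3 :: "real \<Rightarrow> real \<Rightarrow> real \<Rightarrow> real \<Rightarrow> real \<Rightarrow> real \<Rightarrow> real \<Rightarrow> real \<Rightarrow> real \<Rightarrow> real" where
  "det3 a1 a2 a3 b1 b2 b3 c1 c2 c3 =
     a1 * (b2 * c3 - b3 * c2) - b1 * (a2 * c3 - a3 * c2) + c1 * (a2 * b3 - a3 * b2)"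

definition orient :: "real ^ 2 \<Rightarrow> real ^ 2 \<Rightarrow> real ^ 2 \<Rightarrow> real" where
  "orient x y z = det3 (1 + (norm x)\<^sup>2) (x $ 1) (x $ 2) (1 + (norm y)\<^sup>2) (y $ 1) (y $ 2)
     (1 + (norm z)\<^sup>2) (z $ 1) (z $ 2)"

lemma norm_vec2: "(norm (x :: real ^ 2))\<^sup>2 = (x $ 1)\<^sup>2 + (x $ 2)\<^sup>2"
  unfolding power2_norm_eq_inner by (simp add: inner_vec_def sum_2 power2_eq_square)

lemma det3_scale: "det3 (k * a1) (k * a2) (k * a3) (l * b1) (l * b2) (l * b3) (m * c1) (m * c2) (m * c3) =
    k * l * m * det3 a1 a2 a3 b1 b2 b3 c1 c2 c3"
  by (simp add: det3_def algebra_simps)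

text \<open>The Gram determinant for the Lorentz form of signature (1,2). The form has determinant
  +1, so the Gram determinant is the square of \<open>det3\<close>.\<close>

lemma det3_gram:
  fixes a1 :: real
  defines "q \<equiv> \<lambda>x1 x2 x3 y1 y2 y3 :: real. x1 * y1 - x2 * y2 - x3 * y3"
  shows "(det3 a1 a2 a3 b1 b2 b3 c1 c2 c3)\<^sup>2 =
    q a1 a2 a3 a1 a2 a3 * q b1 b2 b3 b1 b2 b3 * q c1 c2 c3 c1 c2 c3
    + 2 * q a1 a2 a3 b1 b2 b3 * q b1 b2 b3 c1 c2 c3 * q a1 a2 a3 c1 c2 c3
    - q a1 a2 a3 a1 a2 a3 * (q b1 b2 b3 c1 c2 c3)\<^sup>2 - q b1 b2 b3 b1 b2 b3 * (q a1 a2 a3 c1 c2 c3)\<^sup>2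
    - q c1 c2 c3 c1 c2 c3 * (q a1 a2 a3 b1 b2 b3)\<^sup>2"
  unfolding q_def det3_def by algebra

text \<open>The Gram determinant of three points of the hyperboloid in terms of their distances. It
  factors as \<open>(cosh (a + b) - cosh c) * (cosh c - cosh (a - b))\<close>, and strict triangle
  inequalities make both factors positive.\<close>

lemma cosh_gram_pos:
  fixes a b c :: real
  assumes "0 \<le> a" "0 \<le> b" "0 \<le> c" "a < b + c" "b < a + c" "c < a + b"
  shows "0 < 1 + 2 * cosh a * cosh b * cosh c - (cosh a)\<^sup>2 - (cosh b)\<^sup>2 - (cosh c)\<^sup>2"
proof -
  have "cosh c < cosh (a + b)" using assms by (intro cosh_real_strict_mono) auto
  moreover have "cosh (a - b) < cosh c"
    using cosh_real_strict_mono[of "\<bar>a - b\<bar>" c] assms by (simp add: abs_less_iff)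
  ultimately have "0 < (cosh (a + b) - cosh c) * (cosh c - cosh (a - b))" by simp
  also have "\<dots> = (sinh a)\<^sup>2 * (sinh b)\<^sup>2 - (cosh a * cosh b - cosh c)\<^sup>2"
    by (simp add: cosh_add cosh_diff power2_eq_square algebra_simps)
  also have "\<dots> = 1 + 2 * cosh a * cosh b * cosh c - (cosh a)\<^sup>2 - (cosh b)\<^sup>2 - (cosh c)\<^sup>2"
    unfolding sinh_square_eq by (simp add: power2_eq_square algebra_simps)
  finally show ?thesis .
qed

lemma orient_nonzero:
  assumes H: "x \<in> hyp_space" "y \<in> hyp_space" "z \<in> hyp_space"
    and T: "hyp_dist x y < hyp_dist y z + hyp_dist x z" "hyp_dist y z < hyp_dist x y + hyp_dist x z"
      "hyp_dist x z < hyp_dist x y + hyp_dist y z"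
  shows "orient x y z \<noteq> 0"
proof -
  let ?p = "\<lambda>x::real^2. 1 - (norm x)\<^sup>2"
  have pos: "0 < ?p x" "0 < ?p y" "0 < ?p z" using H hyp_spaceD by auto
  have diag: "(1 + (norm u)\<^sup>2) * (1 + (norm u)\<^sup>2) - (2 * u $ 1) * (2 * u $ 1) - (2 * u $ 2) * (2 * u $ 2) = (?p u)\<^sup>2"
    for u :: "real ^ 2"
    unfolding norm_vec2 by (simp add: power2_eq_square algebra_simps)
  have off: "(1 + (norm u)\<^sup>2) * (1 + (norm v)\<^sup>2) - (2 * u $ 1) * (2 * v $ 1) - (2 * u $ 2) * (2 * v $ 2) =
      ?p u * ?p v * cosh (hyp_dist u v)" if "u \<in> hyp_space" "v \<in> hyp_space" for u v :: "real ^ 2"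
    using hyp_spaceD[OF that(1)] hyp_spaceD[OF that(2)]
    by (simp add: cosh_hyp_dist_inner[OF that]) (simp add: inner_vec_def sum_2)
  \<comment> \<open>Hyperboloid coordinates contain \<open>2 * x $ 1\<close> and
    \<open>2 * x $ 2\<close>; doubling two of the three coordinates multiplies the determinant by
    4.\<close>
  have "(4 * orient x y z)\<^sup>2 = (det3 (1 + (norm x)\<^sup>2) (2 * x $ 1) (2 * x $ 2) (1 + (norm y)\<^sup>2) (2 * y $ 1) (2 * y $ 2)
     (1 + (norm z)\<^sup>2) (2 * z $ 1) (2 * z $ 2))\<^sup>2"
    by (simp add: orient_def det3_def algebra_simps)
  also have "\<dots> = (?p x * ?p y * ?p z)\<^sup>2 * (1 + 2 * cosh (hyp_dist x y) * cosh (hyp_dist y z) * cosh (hyp_dist x z)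
      - (cosh (hyp_dist x y))\<^sup>2 - (cosh (hyp_dist y z))\<^sup>2 - (cosh (hyp_dist x z))\<^sup>2)"
    unfolding det3_gram diag off[OF H(1,2)] off[OF H(2,3)] off[OF H(1,3)]
    by (simp only: power2_eq_square) algebra
  also have "\<dots> > 0"
    using pos T H by (intro mult_pos_pos cosh_gram_pos hyp_dist_nonneg) auto
  finally show ?thesis by auto
qed

text \<open>On the vectors \<open>(1 + (norm u)^2, u $ 1, u $ 2)\<close> an inversion is a fixed
  linear map, followed by division by the positive number \<open>?D u\<close>. With
  \<open>r = (norm c)^2 - 1\<close> the linear map has determinant \<open>- (r ^ 3)\<close>.\<close>

lemma orient_reflect:
  fixes c x y z :: "real ^ 2"
  assumes c: "1 < norm c" and ne: "x \<noteq> c" "y \<noteq> c" "z \<noteq> c"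
  obtains k where "0 < k" "orient (reflect c x) (reflect c y) (reflect c z) = - k * orient x y z"
proof -
  define r where "r = (norm c)\<^sup>2 - 1"
  have r: "0 < r" "(c $ 1)\<^sup>2 + (c $ 2)\<^sup>2 = r + 1"
    using c one_less_power[OF c, of 2] norm_vec2[of c] by (simp_all add: r_def)
  let ?D = "\<lambda>u. (norm (u - c))\<^sup>2"
  let ?s = "\<lambda>u. c $ 1 * u $ 1 + c $ 2 * u $ 2" and ?a = "\<lambda>u::real^2. 1 + (norm u)\<^sup>2"
  let ?a' = "\<lambda>u. (r + 2) * ?a u - 4 * ?s u" and ?b' = "\<lambda>i u. r * u $ i + c $ i * (?a u - 2 * ?s u)"
  have D: "?D u = ?a u - 2 * ?s u + r" for u
    using r(2) unfolding norm_vec2 by (simp add: power2_eq_square algebra_simps)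
  have lift0: "1 + (norm (reflect c u))\<^sup>2 = 1 / ?D u * ?a' u" if "u \<noteq> c" for u
  proof -
    have "?D u \<noteq> 0" using that by simp
    moreover have "1 + (norm (reflect c u))\<^sup>2 = 2 - r * (1 - (norm u)\<^sup>2) / ?D u"
      using reflect_norm[OF that] by (simp add: r_def)
    moreover have "2 * ?D u - r * (1 - (norm u)\<^sup>2) = ?a' u" unfolding D by (simp add: algebra_simps)
    ultimately show ?thesis by (simp add: field_simps)
  qed
  have lift: "reflect c u $ i = 1 / ?D u * ?b' i u" if "u \<noteq> c" for u i
  proof -
    have "?D u \<noteq> 0" using that by simp
    then have "reflect c u $ i = 1 / ?D u * (c $ i * ?D u + r * (u $ i - c $ i))"
      by (simp add: reflect_def r_def[symmetric] distrib_left)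
    also have "c $ i * ?D u + r * (u $ i - c $ i) = ?b' i u" unfolding D by (simp add: algebra_simps)
    finally show ?thesis .
  qed
  have det: "det3 ((r + 2) * a1 - 4 * (p * a2 + q * a3)) (r * a2 + p * (a1 - 2 * (p * a2 + q * a3)))
      (r * a3 + q * (a1 - 2 * (p * a2 + q * a3)))
      ((r + 2) * b1 - 4 * (p * b2 + q * b3)) (r * b2 + p * (b1 - 2 * (p * b2 + q * b3)))
      (r * b3 + q * (b1 - 2 * (p * b2 + q * b3)))
      ((r + 2) * d1 - 4 * (p * d2 + q * d3)) (r * d2 + p * (d1 - 2 * (p * d2 + q * d3)))
      (r * d3 + q * (d1 - 2 * (p * d2 + q * d3))) = - (r ^ 3) * det3 a1 a2 a3 b1 b2 b3 d1 d2 d3"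
    (is "?lhs = _") if "p\<^sup>2 + q\<^sup>2 = r + 1" for p q a1 a2 a3 b1 b2 b3 d1 d2 d3 :: real
  proof -
    define M where "M = (vector [vector [r + 2, p, q], vector [- 4 * p, r - 2 * p * p, - 2 * p * q],
      vector [- 4 * q, - 2 * p * q, r - 2 * q * q]] :: real ^ 3 ^ 3)"
    define A where "A = (vector [vector [a1, a2, a3], vector [b1, b2, b3], vector [d1, d2, d3]] :: real ^ 3 ^ 3)"
    have dM: "det M = - (r ^ 3)"
    proof -
      have "det M = r ^ 3 + 2 * r\<^sup>2 * (1 - (p\<^sup>2 + q\<^sup>2))"
        by (simp add: M_def det_3 power2_eq_square power3_eq_cube algebra_simps)
      then show ?thesis unfolding that by (simp add: power2_eq_square power3_eq_cube algebra_simps)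
    qed
    have dA: "det A = det3 a1 a2 a3 b1 b2 b3 d1 d2 d3"
      by (simp add: A_def det_3 det3_def algebra_simps)
    have dAM: "det (A ** M) = ?lhs"
    proof -
      have e: "(A ** M) $ i $ 1 = (r + 2) * A $ i $ 1 - 4 * (p * A $ i $ 2 + q * A $ i $ 3)"
        "(A ** M) $ i $ 2 = r * A $ i $ 2 + p * (A $ i $ 1 - 2 * (p * A $ i $ 2 + q * A $ i $ 3))"
        "(A ** M) $ i $ 3 = r * A $ i $ 3 + q * (A $ i $ 1 - 2 * (p * A $ i $ 2 + q * A $ i $ 3))" for i
        by (simp_all add: matrix_matrix_mult_def sum_3 M_def algebra_simps)
      have "det X = det3 (X $ 1 $ 1) (X $ 1 $ 2) (X $ 1 $ 3) (X $ 2 $ 1) (X $ 2 $ 2) (X $ 2 $ 3)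
        (X $ 3 $ 1) (X $ 3 $ 2) (X $ 3 $ 3)" for X :: "real ^ 3 ^ 3"
        by (simp add: det_3 det3_def algebra_simps)
      from this[of "A ** M"] show ?thesis unfolding e by (simp add: A_def)
    qed
    show ?thesis unfolding dAM[symmetric] det_mul dM dA by simp
  qed
  have "orient (reflect c x) (reflect c y) (reflect c z) =
      - (1 / ?D x * (1 / ?D y) * (1 / ?D z) * r ^ 3) * orient x y z"
    unfolding orient_def lift0[OF ne(1)] lift0[OF ne(2)] lift0[OF ne(3)] lift[OF ne(1)] lift[OF ne(2)] lift[OF ne(3)]
      det3_scale det[OF r(2)] by simp
  moreover have "0 < 1 / ?D x * (1 / ?D y) * (1 / ?D z) * r ^ 3" using r ne by simp
  ultimately show ?thesis using that by blast
qed

text \<open>Distances from 0 determine norms, and then mutual distances determine inner products. A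
  map preserving inner products equals its expansion in the orthonormal vectors \<open>u\<close> and
  \<open>v\<close>.\<close>

lemma hyp_isometry_fixing_0:
  fixes f :: "real ^ 2 \<Rightarrow> real ^ 2"
  assumes f: "\<And>x. x \<in> hyp_space \<Longrightarrow> f x \<in> hyp_space" and f0: "f 0 = 0"
    and iso: "\<And>x y. x \<in> hyp_space \<Longrightarrow> y \<in> hyp_space \<Longrightarrow> hyp_dist (f x) (f y) = hyp_dist x y"
  obtains u v where "\<And>x. x \<in> hyp_space \<Longrightarrow> f x = x $ 1 *\<^sub>R u + x $ 2 *\<^sub>R v"
    "\<And>x. x \<in> hyp_space \<Longrightarrow> (norm (f x))\<^sup>2 = (norm x)\<^sup>2"
proof -
  have norm: "(norm (f x))\<^sup>2 = (norm x)\<^sup>2" if x: "x \<in> hyp_space" for x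
  proof -
    have "cosh (hyp_dist (f 0) (f x)) = cosh (hyp_dist 0 x)" using iso[of 0 x] x by simp
    then have "2 * (norm (f x))\<^sup>2 / (1 - (norm (f x))\<^sup>2) = 2 * (norm x)\<^sup>2 / (1 - (norm x)\<^sup>2)"
      using x f[OF x] by (simp add: f0 cosh_hyp_dist)
    then show ?thesis using hyp_spaceD[OF x] hyp_spaceD[OF f[OF x]] by (simp add: field_simps)
  qed
  have inner: "f x \<bullet> f y = x \<bullet> y" if x: "x \<in> hyp_space" and y: "y \<in> hyp_space" for x y
  proof -
    have "cosh (hyp_dist (f x) (f y)) = cosh (hyp_dist x y)" using iso[OF x y] by simp
    then show ?thesis
      using x y f[OF x] f[OF y] hyp_spaceD[OF x] hyp_spaceD[OF y] by (simp add: cosh_hyp_dist_inner norm)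
  qed
  \<comment> \<open>The standard unit vectors lie outside of the open ball, so their halves are
    used.\<close>
  define u v where "u = 2 *\<^sub>R f (axis 1 (1/2))" and "v = 2 *\<^sub>R f (axis 2 (1/2))"
  have half: "axis i (1/2 :: real) \<in> (hyp_space :: (real ^ 2) set)" for i
    by (simp add: hyp_space_def norm_eq_sqrt_inner inner_axis_axis real_sqrt_divide)
  have uv: "u \<bullet> u = 1" "v \<bullet> v = 1" "u \<bullet> v = 0" "v \<bullet> u = 0"
    using inner[OF half half] by (simp_all add: u_def v_def inner_axis_axis)
  have "f x = x $ 1 *\<^sub>R u + x $ 2 *\<^sub>R v" if x: "x \<in> hyp_space" for x
  proof -
    have i: "f x \<bullet> u = x $ 1" "f x \<bullet> v = x $ 2" "u \<bullet> f x = x $ 1" "v \<bullet> f x = x $ 2"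
      using inner[OF x half[of 1]] inner[OF x half[of 2]] inner[OF half[of 1] x] inner[OF half[of 2] x]
      by (simp_all add: u_def v_def inner_axis inner_axis' mult.commute[of 2])
    have n: "f x \<bullet> f x = x $ 1 * x $ 1 + x $ 2 * x $ 2"
      using inner[OF x x] by (simp add: inner_vec_def sum_2)
    let ?g = "x $ 1 *\<^sub>R u + x $ 2 *\<^sub>R v"
    have "(f x - ?g) \<bullet> (f x - ?g) = 0"
      by (simp add: inner_diff_left inner_diff_right inner_add_left inner_add_right i n uv)
    then show ?thesis by simp
  qed
  then show ?thesis using that norm by blast
qed

lemma orient_linear:
  fixes u v :: "real ^ 2"
  assumes "(norm (f x))\<^sup>2 = (norm x)\<^sup>2" "(norm (f y))\<^sup>2 = (norm y)\<^sup>2" "(norm (f z))\<^sup>2 = (norm z)\<^sup>2"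
    and "f x = x $ 1 *\<^sub>R u + x $ 2 *\<^sub>R v" "f y = y $ 1 *\<^sub>R u + y $ 2 *\<^sub>R v" "f z = z $ 1 *\<^sub>R u + z $ 2 *\<^sub>R v"
  shows "orient (f x) (f y) (f z) = (u $ 1 * v $ 2 - v $ 1 * u $ 2) * orient x y z"
proof -
  have "orient (f x) (f y) (f z) = det3 (1 + (norm x)\<^sup>2) (x $ 1 * u $ 1 + x $ 2 * v $ 1) (x $ 1 * u $ 2 + x $ 2 * v $ 2)
     (1 + (norm y)\<^sup>2) (y $ 1 * u $ 1 + y $ 2 * v $ 1) (y $ 1 * u $ 2 + y $ 2 * v $ 2)
     (1 + (norm z)\<^sup>2) (z $ 1 * u $ 1 + z $ 2 * v $ 1) (z $ 1 * u $ 2 + z $ 2 * v $ 2)"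
    unfolding orient_def assms(1-3) unfolding assms(4-6) by simp
  then show ?thesis unfolding orient_def det3_def by (simp add: algebra_simps)
qed

lemma hyp_isometry_orientation:
  fixes f f' :: "real ^ 2 \<Rightarrow> real ^ 2"
  assumes f: "\<And>x. x \<in> hyp_space \<Longrightarrow> f x \<in> hyp_space" and f0: "f 0 = 0"
    and iso: "\<And>x y. x \<in> hyp_space \<Longrightarrow> y \<in> hyp_space \<Longrightarrow> hyp_dist (f x) (f y) = hyp_dist x y"
    and deriv: "(f has_derivative f') (at 0)"
    and X: "x \<in> hyp_space" "y \<in> hyp_space" "z \<in> hyp_space"
  shows "orient (f x) (f y) (f z) = det (matrix f') * orient x y z"
proof -
  obtain u v where lin: "\<And>x. x \<in> hyp_space \<Longrightarrow> f x = x $ 1 *\<^sub>R u + x $ 2 *\<^sub>R v"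
    and norm: "\<And>x. x \<in> hyp_space \<Longrightarrow> (norm (f x))\<^sup>2 = (norm x)\<^sup>2"
    using hyp_isometry_fixing_0[OF f f0 iso] by blast
  let ?g = "\<lambda>x::real^2. x $ 1 *\<^sub>R u + x $ 2 *\<^sub>R v"
  have "(?g has_derivative ?g) (at 0)"
    by (intro bounded_linear_imp_has_derivative bounded_linear_add bounded_linear_scaleR_const bounded_linear_vec_nth)
  then have "(f has_derivative ?g) (at 0)"
    by (rule has_derivative_transform_within_open[OF _ open_hyp_space zero_in_hyp_space]) (simp add: lin)
  then have "f' = ?g" using has_derivative_unique[OF deriv] by simp
  then have det: "det (matrix f') = u $ 1 * v $ 2 - v $ 1 * u $ 2"
    by (simp add: det_2 matrix_def axis_def)
  show ?thesis unfolding det by (rule orient_linear) (use norm lin X in auto)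
qed

text \<open>If \<open>f\<close> moves the origin, a reflection brings the image back. It reverses
  the sign of the Jacobian and that of \<open>orient\<close> alike, so that the two signs still
  agree.\<close>

lemma hyp_isom_plus_orient:
  fixes f :: "real ^ 2 \<Rightarrow> real ^ 2"
  assumes f: "f \<in> hyp_isom_plus" and X: "x \<in> hyp_space" "y \<in> hyp_space" "z \<in> hyp_space"
  obtains k where "0 < k" "orient (f x) (f y) (f z) = k * orient x y z"
proof -
  have H: "f x \<in> hyp_space" if "x \<in> hyp_space" for x
    using Bij_mem[OF hyp_isom_plus_Bij[OF f] that] .
  have iso: "hyp_dist (f x) (f y) = hyp_dist x y" if "x \<in> hyp_space" "y \<in> hyp_space" for x y
    using f that by (simp add: hyp_isom_plus_def hyp_isom_def)
  obtain f' where f': "(f has_derivative f') (at 0)" "det (matrix f') > 0"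
    using f zero_in_hyp_space unfolding hyp_isom_plus_def by blast
  show ?thesis
  proof (cases "f 0 = 0")
    case True
    then show ?thesis using hyp_isometry_orientation[OF H True iso f'(1) X] f'(2) that by blast
  next
    case False
    let ?q = "f 0"
    have q: "?q \<in> hyp_space" using H by simp
    obtain c where c: "1 < norm c" "reflect c ?q = 0" using reflect_to_0[OF q False] .
    have nec: "u \<noteq> c" if "u \<in> hyp_space" for u using c(1) that by (auto simp: hyp_space_def)
    let ?h = "\<lambda>x. reflect c (f x)"
    have h: "?h x \<in> hyp_space" if "x \<in> hyp_space" for x using reflect_in[OF c(1) H[OF that]] .
    have "(reflect c \<circ> f has_derivative reflection_deriv c ?q \<circ> f') (at 0)"
      using diff_chain_at[OF f'(1) has_derivative_reflect[OF nec[OF q]]] .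
    then have h': "(?h has_derivative reflection_deriv c ?q \<circ> f') (at 0)" by (simp add: o_def)
    have h_iso: "hyp_dist (?h u) (?h v) = hyp_dist u v" if "u \<in> hyp_space" "v \<in> hyp_space" for u v
      using hyp_dist_reflect[OF c(1) H[OF that(1)] H[OF that(2)]] iso[OF that] by simp
    have "orient (?h x) (?h y) (?h z) = det (matrix (reflection_deriv c ?q \<circ> f')) * orient x y z"
      by (rule hyp_isometry_orientation[OF h c(2) h_iso h' X])
    moreover have "det (matrix (reflection_deriv c ?q \<circ> f')) = det (matrix (reflection_deriv c ?q)) * det (matrix f')"
      using has_derivative_linear[OF f'(1)] has_derivative_linear[OF has_derivative_reflect[OF nec[OF q]]]
      by (simp add: matrix_compose det_mul)
    moreover obtain k where k: "0 < k" "orient (reflect c (?h x)) (reflect c (?h y)) (reflect c (?h z)) =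
        - k * orient (?h x) (?h y) (?h z)"
      using orient_reflect[OF c(1) nec[OF h[OF X(1)]] nec[OF h[OF X(2)]] nec[OF h[OF X(3)]]] .
    moreover have "reflect c (?h u) = f u" if "u \<in> hyp_space" for u
      using reflect_involution[OF c(1) nec[OF H[OF that]]] .
    ultimately have "orient (f x) (f y) (f z) = (k * (- det (matrix (reflection_deriv c ?q)) * det (matrix f'))) * orient x y z"
      using X by simp
    moreover have "0 < k * (- det (matrix (reflection_deriv c ?q)) * det (matrix f'))"
      using k(1) f'(2) det_reflection_deriv_2[OF c(1) nec[OF q]] by (intro mult_pos_pos) auto
    ultimately show ?thesis using that by blast
  qed
qed

text \<open>A Euclidean segment need not be geodesic, but it suffices as a continuous path that
  never gets farther from \<open>v\<close> than \<open>u\<close> is. In the formula for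
  \<open>cosh\<close> the numerator shrinks by \<open>(1 - t)^2\<close>, and the height in the
  denominator by at most \<open>1 - t\<close>.\<close>

lemma hyp_dist_segment:
  fixes u v :: "real ^ 'n"
  assumes uv: "u \<in> hyp_space" "v \<in> hyp_space" and t: "0 \<le> t" "t \<le> 1"
  shows "(1 - t) *\<^sub>R u + t *\<^sub>R v \<in> hyp_space" "hyp_dist ((1 - t) *\<^sub>R u + t *\<^sub>R v) v \<le> hyp_dist u v"
proof -
  let ?p = "(1 - t) *\<^sub>R u + t *\<^sub>R v"
  show p: "?p \<in> hyp_space"
    using convexD[OF convex_ball[of 0 1] uv[unfolded hyp_space_def], of "1 - t" t] t
    by (simp add: hyp_space_def)
  show "hyp_dist ?p v \<le> hyp_dist u v"
  proof (cases "t = 1")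
    case True
    then show ?thesis using hyp_dist_nonneg[OF uv] hyp_dist_eq_0_iff[OF uv(2) uv(2)] by simp
  next
    case False
    then have t1: "0 < 1 - t" using t by simp
    have "(norm ?p)\<^sup>2 \<le> ((1 - t) * norm u + t * norm v)\<^sup>2"
      using norm_triangle_ineq[of "(1 - t) *\<^sub>R u" "t *\<^sub>R v"] t by (intro power_mono) auto
    also have "\<dots> = (1 - t) * (norm u)\<^sup>2 + t * (norm v)\<^sup>2 - (1 - t) * t * (norm u - norm v)\<^sup>2"
      by (simp add: power2_eq_square algebra_simps)
    also have "\<dots> \<le> (1 - t) * (norm u)\<^sup>2 + t * (norm v)\<^sup>2" using t by simp
    also have "\<dots> \<le> (1 - t) * (norm u)\<^sup>2 + t * 1"
      using hyp_spaceD[OF uv(2)] t by (intro add_left_mono mult_left_mono) auto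
    finally have a: "(1 - t) * (1 - (norm u)\<^sup>2) \<le> 1 - (norm ?p)\<^sup>2" by (simp add: algebra_simps)
    have "?p - v = (1 - t) *\<^sub>R (u - v)" by (simp add: algebra_simps)
    then have "(norm (?p - v))\<^sup>2 = (1 - t)\<^sup>2 * (norm (u - v))\<^sup>2" using t by (simp add: power_mult_distrib)
    also have "\<dots> \<le> (1 - t) * (norm (u - v))\<^sup>2"
      using t by (intro mult_right_mono) (auto simp: power2_eq_square mult_left_le)
    finally have b: "(norm (?p - v))\<^sup>2 \<le> (1 - t) * (norm (u - v))\<^sup>2" .
    let ?B = "1 - (norm v)\<^sup>2"
    have pos: "0 < 1 - (norm u)\<^sup>2" "0 < ?B" using hyp_spaceD uv by auto
    have "2 * (norm (?p - v))\<^sup>2 / ((1 - (norm ?p)\<^sup>2) * ?B) \<le>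
        2 * ((1 - t) * (norm (u - v))\<^sup>2) / ((1 - t) * (1 - (norm u)\<^sup>2) * ?B)"
      using a b pos t1 hyp_spaceD[OF p] by (intro frac_le mult_left_mono mult_right_mono mult_pos_pos) auto
    also have "\<dots> = 2 * (norm (u - v))\<^sup>2 / ((1 - (norm u)\<^sup>2) * ?B)" using t1 by simp
    finally have "cosh (hyp_dist ?p v) \<le> cosh (hyp_dist u v)"
      unfolding cosh_hyp_dist[OF p uv(2)] cosh_hyp_dist[OF uv] by simp
    then show ?thesis by (rule cosh_le_cosh[OF hyp_dist_nonneg[OF uv]])
  qed
qed

lemma orient_swap: "orient x z y = - orient x y z"
  by (simp add: orient_def det3_def algebra_simps)

text \<open>A large tripod cannot be almost mapped to itself with two of its ends exchanged: moving the image
  of the ends to the ends along short segments would reverse the orientation without ever passing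
  through a degenerate triangle.\<close>

lemma hyp_plane_no_swap:
  fixes f :: "real ^ 2 \<Rightarrow> real ^ 2"
  assumes f: "f \<in> hyp_isom_plus" and H: "x \<in> hyp_space" "y \<in> hyp_space" "z \<in> hyp_space"
    and long: "\<bar>hyp_dist x y - 20 * e\<bar> < e" "\<bar>hyp_dist x z - 20 * e\<bar> < e" "\<bar>hyp_dist y z - 20 * e\<bar> < e"
    and near: "hyp_dist (f x) x < e" "hyp_dist (f y) z < e" "hyp_dist (f z) y < e"
  shows False
proof -
  have fH: "f u \<in> hyp_space" if "u \<in> hyp_space" for u
    using Bij_mem[OF hyp_isom_plus_Bij[OF f] that] .
  let ?p = "\<lambda>t. (1 - t) *\<^sub>R f x + t *\<^sub>R x" and ?q = "\<lambda>t. (1 - t) *\<^sub>R f y + t *\<^sub>R z"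
    and ?r = "\<lambda>t. (1 - t) *\<^sub>R f z + t *\<^sub>R y"
  \<comment> \<open>One \<open>e\<close> comes from \<open>long\<close> and one from each moved end.
    Sides between \<open>17 * e\<close> and \<open>23 * e\<close> still satisfy strict triangle
    inequalities, which is what \<open>nz\<close> uses.\<close>
  have move: "\<bar>hyp_dist u' v' - 20 * e\<bar> < 3 * e"
    if "u' \<in> hyp_space" "v' \<in> hyp_space" "u \<in> hyp_space" "v \<in> hyp_space"
      "hyp_dist u' u < e" "hyp_dist v' v < e" "\<bar>hyp_dist u v - 20 * e\<bar> < e" for u v u' v' :: "real ^ 2"
    using hyp_dist_triangle[OF that(1) that(3) that(2)] hyp_dist_triangle[OF that(3) that(4) that(2)]
      hyp_dist_triangle[OF that(3) that(1) that(4)] hyp_dist_triangle[OF that(1) that(2) that(4)]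
      that(5-7) hyp_dist_commute[of u u'] hyp_dist_commute[of v v'] by linarith
  have e: "0 < e" using near(1) hyp_dist_nonneg[OF fH[OF H(1)] H(1)] by linarith
  have nz: "orient u' v' w' \<noteq> 0"
    if "u' \<in> hyp_space" "v' \<in> hyp_space" "w' \<in> hyp_space"
      "\<bar>hyp_dist u' v' - 20 * e\<bar> < 3 * e" "\<bar>hyp_dist u' w' - 20 * e\<bar> < 3 * e" "\<bar>hyp_dist v' w' - 20 * e\<bar> < 3 * e"
    for u' v' w' :: "real ^ 2"
    by (rule orient_nonzero[OF that(1-3)]) (use that(4-6) e in linarith)+
  have path: "orient (?p t) (?q t) (?r t) \<noteq> 0" if t: "0 \<le> t" "t \<le> 1" for t
  proof -
    note P = hyp_dist_segment[OF fH[OF H(1)] H(1) t] and Q = hyp_dist_segment[OF fH[OF H(2)] H(3) t]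
      and R = hyp_dist_segment[OF fH[OF H(3)] H(2) t]
    show ?thesis
    proof (rule nz[OF P(1) Q(1) R(1)])
      show "\<bar>hyp_dist (?p t) (?q t) - 20 * e\<bar> < 3 * e"
        using move[OF P(1) Q(1) H(1,3)] P(2) Q(2) near long by linarith
      show "\<bar>hyp_dist (?p t) (?r t) - 20 * e\<bar> < 3 * e"
        using move[OF P(1) R(1) H(1,2)] P(2) R(2) near long by linarith
      show "\<bar>hyp_dist (?q t) (?r t) - 20 * e\<bar> < 3 * e"
        using move[OF Q(1) R(1) H(3,2)] Q(2) R(2) near long hyp_dist_commute[of y z] by linarith
    qed
  qed
  have cont: "continuous_on {0..1} (\<lambda>t. orient (?p t) (?q t) (?r t))"
    unfolding orient_def det3_def by (intro continuous_intros)
  obtain k where k: "0 < k" "orient (f x) (f y) (f z) = k * orient x y z"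
    using hyp_isom_plus_orient[OF f H] .
  have ends: "orient (?p 0) (?q 0) (?r 0) = k * orient x y z" "orient (?p 1) (?q 1) (?r 1) = - orient x y z"
    using k(2) orient_swap[of x z y] by simp_all
  have "orient x y z \<noteq> 0" using path[of 1] ends(2) by simp
  then consider "orient x y z < 0" | "0 < orient x y z" by linarith
  then show False
  proof cases
    case 1
    then have "\<exists>t\<ge>0. t \<le> 1 \<and> orient (?p t) (?q t) (?r t) = 0"
      using IVT'[OF _ _ _ cont, of 0] k(1) ends by (auto simp: mult_pos_neg less_imp_le)
    then show ?thesis using path by blast
  next
    case 2
    then have "\<exists>t\<ge>0. t \<le> 1 \<and> orient (?p t) (?q t) (?r t) = 0"
      using IVT2'[OF _ _ _ cont, of 0] k(1) ends by (auto simp: less_imp_le)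
    then show ?thesis using path by blast
  qed
qed

section \<open>Invariance of the hyperbolicity constant under isometries\<close>

lemma geodesic_segment_isometric:
  assumes f: "f \<in> X \<rightarrow> Y" "\<And>x y. x \<in> X \<Longrightarrow> y \<in> X \<Longrightarrow> e (f x) (f y) = d x y"
    and \<sigma>: "geodesic_segment X d x y \<sigma>" and xy: "x \<in> X" "y \<in> X"
  shows "geodesic_segment Y e (f x) (f y) (f ` \<sigma>)"
proof -
  obtain c where c: "c ` {0..d x y} = \<sigma>" "\<sigma> \<subseteq> X" "c 0 = x" "c (d x y) = y"
    "\<And>s t. s \<in> {0..d x y} \<Longrightarrow> t \<in> {0..d x y} \<Longrightarrow> d (c s) (c t) = \<bar>s - t\<bar>"
    using \<sigma> unfolding geodesic_segment_def by blast
  have "c t \<in> X" if "t \<in> {0..d x y}" for t using c(1,2) that by blast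
  then show ?thesis unfolding geodesic_segment_def
    using c f xy by (intro exI[of _ "f \<circ> c"]) (auto simp: image_comp[symmetric])
qed

lemma thin_trianglesD:
  assumes "thin_triangles X d \<delta>" "x \<in> X" "y \<in> X" "z \<in> X" "p \<in> \<sigma>"
    and "geodesic_segment X d x y \<sigma>" "geodesic_segment X d y z \<tau>" "geodesic_segment X d z x \<upsilon>"
  obtains q where "q \<in> \<tau> \<union> \<upsilon>" "d p q \<le> \<delta>"
  using assms(1)[unfolded thin_triangles_def, rule_format, OF assms(2-4) conjI[OF assms(6) conjI[OF assms(7,8)]] assms(5)]
  by blast

lemma thin_triangles_isometric:
  assumes f: "f \<in> X \<rightarrow> Y" "\<And>x y. x \<in> X \<Longrightarrow> y \<in> X \<Longrightarrow> e (f x) (f y) = d x y"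
    and thin: "thin_triangles Y e \<delta>"
  shows "thin_triangles X d \<delta>"
  unfolding thin_triangles_def
proof (intro ballI allI impI, elim conjE)
  fix x y z \<sigma> \<tau> \<upsilon> p
  assume X: "x \<in> X" "y \<in> X" "z \<in> X"
    and s: "geodesic_segment X d x y \<sigma>" "geodesic_segment X d y z \<tau>" "geodesic_segment X d z x \<upsilon>"
    and p: "p \<in> \<sigma>"
  have fY: "f u \<in> Y" if "u \<in> X" for u using f(1) that by blast
  have seg: "geodesic_segment Y e (f u) (f v) (f ` s)" if "geodesic_segment X d u v s" "u \<in> X" "v \<in> X" for u v s
    by (rule geodesic_segment_isometric[OF f(1) _ that]) (rule f(2))
  obtain q where q: "q \<in> f ` \<tau> \<union> f ` \<upsilon>" "e (f p) q \<le> \<delta>"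
    by (rule thin_trianglesD[OF thin fY[OF X(1)] fY[OF X(2)] fY[OF X(3)] imageI[OF p, of f]
        seg[OF s(1) X(1,2)] seg[OF s(2) X(2,3)] seg[OF s(3) X(3,1)]])
  then obtain q' where q': "q' \<in> \<tau> \<union> \<upsilon>" "q = f q'" by blast
  then have "q' \<in> X" using s(2,3) geodesic_segment_between(1) by (metis UnE)
  then show "\<exists>q\<in>\<tau> \<union> \<upsilon>. d p q \<le> \<delta>"
    using q q' f(2)[of p q'] geodesic_segment_between(1)[OF s(1) p] by auto
qed

lemma hyperbolicity_constant_isometric:
  assumes f: "bij_betw f X Y" "\<And>x y. x \<in> X \<Longrightarrow> y \<in> X \<Longrightarrow> e (f x) (f y) = d x y"
  shows "hyperbolicity_constant Y e = hyperbolicity_constant X d"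
proof -
  let ?h = "inv_into X f"
  have h: "?h y \<in> X" "f (?h y) = y" if "y \<in> Y" for y
    using that f(1) by (auto simp: bij_betw_def inv_into_into f_inv_into_f)
  have "f \<in> X \<rightarrow> Y" using f(1) by (auto simp: bij_betw_def)
  moreover have "d (?h x) (?h y) = e x y" if "x \<in> Y" "y \<in> Y" for x y
    using f(2)[of "?h x" "?h y"] h that by simp
  ultimately have "thin_triangles Y e \<delta> \<longleftrightarrow> thin_triangles X d \<delta>" for \<delta>
    using thin_triangles_isometric[of f X Y e d \<delta>] thin_triangles_isometric[of ?h Y X d e \<delta>] f(2) h(1)
    by blast
  then show ?thesis by (simp add: hyperbolicity_constant_def)
qed

section \<open>The tree as an action on a subset of the universe\<close>

definition encode :: "tree_point \<Rightarrow> universe" where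
  "encode x n = (if n = 0 then snd x else real (to_nat (fst x)))"

definition decode :: "universe \<Rightarrow> tree_point" where
  "decode = inv_into UNIV encode"

lemma inj_encode: "inj encode"
proof (rule injI)
  fix x y assume "encode x = encode y"
  then have "encode x 0 = encode y 0" "encode x 1 = encode y 1" by auto
  then show "x = y" by (simp add: encode_def prod_eq_iff)
qed

lemma decode_encode [simp]: "decode (encode x) = x"
  by (simp add: decode_def inj_encode)

abbreviation tree_letter :: "letter \<Rightarrow> tree_point \<Rightarrow> tree_point" where
  "tree_letter \<equiv> gen_letters (\<lambda>y. y) tree_swap (flip None) (flip (Some True))"

abbreviation tree_word :: "word \<Rightarrow> tree_point \<Rightarrow> tree_point" where
  "tree_word \<equiv> involution_word tree_swap (flip None) (flip (Some True))"

abbreviation on_code :: "(tree_point \<Rightarrow> tree_point) \<Rightarrow> universe \<Rightarrow> universe" where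
  "on_code h \<equiv> encode \<circ> h \<circ> decode"

definition utree :: "(word set, universe) space_action" where
  "utree = \<lparr>act = involution_action (encode ` tree_pts) (on_code tree_swap)
     (on_code (flip None)) (on_code (flip (Some True))),
   pts = encode ` tree_pts, dst = (\<lambda>x y. tree_dist (decode x) (decode y))\<rparr>"

interpretation universe: three_involutions "encode ` tree_pts" "on_code tree_swap"
  "on_code (flip None)" "on_code (flip (Some True))"
  by unfold_locales
    (auto simp: tree_swap_in flip_in tree_swap_tree_swap flip_flip simp del: tree_swap.simps)

lemma utree_pts: "pts utree = encode ` tree_pts"
  and utree_dst: "dst utree (encode x) (encode y) = tree_dist x y"
  by (simp_all add: utree_def)

lemma tree_word_in: "x \<in> tree_pts \<Longrightarrow> tree_word w x \<in> tree_pts"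
proof (induction w)
  case (Cons l w)
  then show ?case
    by (cases "(\<lambda>y::tree_point. y, tree_swap, flip None, flip (Some True), l)" rule: gen_letters.cases)
       (auto simp: flip_in tree_swap_in)
qed simp

lemma utree_act:
  assumes "w \<in> lists (letters g)" "x \<in> tree_pts"
  shows "act utree (word_rel g `` {w}) (encode x) = encode (tree_word w x)"
proof -
  have "encode (tree_word w x) = involution_word (on_code tree_swap)
      (on_code (flip None)) (on_code (flip (Some True))) w (encode x)"
    by (rule involution_word_equivariant[where S = tree_pts])
       (use assms in \<open>auto simp: flip_in tree_swap_in\<close>)
  then show ?thesis using universe.action_class[OF assms(1), of "encode x"] assms(2)
    by (simp add: utree_def)
qed

lemma tree_dist_tree_word:
  assumes "x \<in> tree_pts" "y \<in> tree_pts"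
  shows "tree_dist (tree_word w x) (tree_word w y) = tree_dist x y"
proof (induction w)
  case (Cons l w)
  then show ?case
    by (cases "(\<lambda>y::tree_point. y, tree_swap, flip None, flip (Some True), l)" rule: gen_letters.cases)
       (use assms tree_word_in in \<open>auto simp: tree_dist_flip tree_dist_tree_swap\<close>)
qed simp

lemma utree_metric: "Metric_space (pts utree) (dst utree)"
proof
  fix x y z
  show "0 \<le> dst utree x y" by (simp add: utree_def tree_dist_nonneg)
  show "dst utree x y = dst utree y x" by (simp add: utree_def tree_dist_commute)
  assume x: "x \<in> pts utree" and y: "y \<in> pts utree"
  then show "dst utree x y = 0 \<longleftrightarrow> x = y"
    by (auto simp: utree_pts utree_dst tree_dist_eq_0_iff)
  assume z: "z \<in> pts utree"
  then show "dst utree x z \<le> dst utree x y + dst utree y z"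
    using x y by (auto simp: utree_pts utree_dst tree_dist_triangle)
qed

lemma utree_four_point: "four_point (pts utree) (dst utree) 0"
  unfolding four_point_def utree_pts
  using tree_four_point by (auto simp: utree_dst four_point_def)

lemma utree_R_tree: "R_tree (pts utree) (dst utree)"
proof (rule zero_hyp_R_tree[OF utree_metric utree_four_point])
  fix x y assume "x \<in> pts utree" "y \<in> pts utree"
  then obtain p q where pq: "p \<in> tree_pts" "q \<in> tree_pts" "x = encode p" "y = encode q"
    by (auto simp: utree_pts)
  obtain \<sigma> where "geodesic_segment tree_pts tree_dist p q \<sigma>" using tree_geodesic[OF pq(1,2)] ..
  then show "\<exists>\<sigma>. geodesic_segment (pts utree) (dst utree) x y \<sigma>"
    using geodesic_segment_isometric[of encode tree_pts "pts utree" "dst utree" tree_dist p q] pq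
    by (auto simp: utree_pts utree_dst)
qed

lemma utree_action: "R_tree_action (surface_group g) utree"
  unfolding R_tree_action_def isometric_action_def
proof (intro conjI ballI utree_metric utree_R_tree)
  show "group_action (surface_group g) (pts utree) (act utree)"
    using universe.group_action by (simp add: utree_def)
  fix \<gamma> x y
  assume "\<gamma> \<in> carrier (surface_group g)"
  then obtain w where w: "w \<in> lists (letters g)" "\<gamma> = word_rel g `` {w}" by (rule surface_group_carrierE)
  assume "x \<in> pts utree" "y \<in> pts utree"
  then obtain p q where pq: "p \<in> tree_pts" "q \<in> tree_pts" "x = encode p" "y = encode q"
    by (auto simp: utree_pts)
  show "dst utree (act utree \<gamma> x) (act utree \<gamma> y) = dst utree x y"
    unfolding pq(3,4) w(2) utree_act[OF w(1) pq(1)] utree_act[OF w(1) pq(2)] utree_dst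
    by (rule tree_dist_tree_word[OF pq(1,2)])
qed

lemma tree_swap_flip: "tree_swap (flip i x) = flip (map_option Not i) (tree_swap x)"
  using map_option_Not_inj by (cases "(i, x)" rule: flip.cases) (auto simp: inj_eq)

text \<open>Only c_0 and c_1 are images of generators; c_2 is the conjugate s c_1 s. With all three
  flips available, \<open>tree_hull\<close> applies to invariant subtrees.\<close>

lemma flip_word:
  assumes "3 \<le> g" "x \<in> tree_pts"
  shows "\<exists>w\<in>lists (letters g). tree_word w x = flip i x"
proof -
  consider "i = None" | "i = Some True" | "i = Some False" by (cases i) auto
  then show ?thesis
  proof cases
    case 1
    then show ?thesis using gens_in[OF assms(1)]
      by (intro bexI[of _ "[(Gen_a 1, False)]"]) auto
  next
    case 2
    then show ?thesis using gens_in[OF assms(1)]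
      by (intro bexI[of _ "[(Gen_a 2, False)]"]) auto
  next
    case 3
    then show ?thesis using gens_in[OF assms(1)]
      by (intro bexI[of _ "[(Gen_a 0, False), (Gen_a 2, False), (Gen_a 0, False)]"])
         (auto simp: tree_swap_flip tree_swap_tree_swap)
  qed
qed

lemma geodesic_segment_mono: "geodesic_segment Y d x y \<sigma> \<Longrightarrow> Y \<subseteq> X \<Longrightarrow> geodesic_segment X d x y \<sigma>"
  unfolding geodesic_segment_def by (elim exE conjE) (intro exI conjI, auto)

lemma utree_minimal:
  assumes g: "3 \<le> g"
  shows "minimal_action (surface_group g) utree"
  unfolding minimal_action_def
proof (intro allI impI, elim conjE)
  fix Y assume Y: "Y \<subseteq> pts utree" "Y \<noteq> {}" and T: "R_tree Y (dst utree)"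
    and inv: "\<forall>\<gamma>\<in>carrier (surface_group g). \<forall>y\<in>Y. act utree \<gamma> y \<in> Y"
  define Z where "Z = {p \<in> tree_pts. encode p \<in> Y}"
  have YZ: "Y = encode ` Z" using Y(1) by (auto simp: Z_def utree_pts)
  have "Z = tree_pts"
  proof (rule tree_hull)
    show "Z \<subseteq> tree_pts" by (auto simp: Z_def)
    show "Z \<noteq> {}" using Y(2) YZ by blast
    fix p q r
    assume pq: "p \<in> Z" "q \<in> Z" and r: "r \<in> tree_pts" "tree_dist p r + tree_dist r q = tree_dist p q"
    have "encode p \<in> Y" "encode q \<in> Y" using pq by (simp_all add: Z_def)
    then obtain \<sigma> where \<sigma>: "geodesic_segment Y (dst utree) (encode p) (encode q) \<sigma>"
      using T unfolding R_tree_def by blast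
    \<comment> \<open>The segment provided by the subtree is a segment of the whole tree, and there
      it contains all points between its ends.\<close>
    have "encode r \<in> \<sigma>"
      by (rule zero_hyp_between_mem[OF utree_metric utree_four_point
            geodesic_segment_mono[OF \<sigma> Y(1)]])
         (use r in \<open>auto simp: utree_pts utree_dst\<close>)
    then have "encode r \<in> Y" by (rule geodesic_segment_between(1)[OF \<sigma>])
    then show "r \<in> Z" using r(1) by (simp add: Z_def)
  next
    fix i p assume p: "p \<in> Z"
    then obtain w where w: "w \<in> lists (letters g)" "tree_word w p = flip i p"
      using flip_word[OF g, of p i] unfolding Z_def by blast
    have "act utree (word_rel g `` {w}) (encode p) \<in> Y"
      using inv word_class_in_carrier[OF w(1)] p by (simp add: Z_def)
    then show "flip i p \<in> Z"
      using p w utree_act[OF w(1), of p] flip_in by (simp add: Z_def)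
  qed
  then show "Y = pts utree" by (simp add: YZ utree_pts)
qed

lemma finite_letters: "finite (letters g)"
  by (simp add: letters_def)

lemma displacement_ge_iff:
  "l \<in> letters g \<Longrightarrow> r \<le> dst A x (act A (word_rel g `` {[l]}) x) \<Longrightarrow> r \<le> displacement (surface_gens g) A x"
  unfolding displacement_def surface_gens_def
  by (rule order_trans[OF _ Max_ge]) (auto simp: finite_letters)

lemma displacement_le:
  assumes "letters g \<noteq> {}" "\<And>l. l \<in> letters g \<Longrightarrow> dst A x (act A (word_rel g `` {[l]}) x) \<le> r"
  shows "displacement (surface_gens g) A x \<le> r"
  unfolding displacement_def surface_gens_def using assms by (subst Max_le_iff) (auto simp: finite_letters)

lemma utree_act_letter:
  "l \<in> letters g \<Longrightarrow> x \<in> tree_pts \<Longrightarrow> act utree (word_rel g `` {[l]}) (encode x) =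
    encode (tree_letter l x)"
  using utree_act[of "[l]" g x] by simp

lemma utree_displacement_ge:
  assumes g: "3 \<le> g" and x: "x \<in> pts utree"
  shows "1 \<le> displacement (surface_gens g) utree x"
proof -
  obtain p where p: "p \<in> tree_pts" "x = encode p" using x by (auto simp: utree_pts)
  have "1 \<le> tree_dist p (flip None p) \<or> 1 \<le> tree_dist p (flip (Some True) p)"
    by (rule tree_dist_flip_ge[OF p(1)]) simp
  then show ?thesis
    using displacement_ge_iff[OF gens_in(2)[OF g], of 1 utree x]
      displacement_ge_iff[OF gens_in(3)[OF g], of 1 utree x] gens_in[OF g] p
    by (auto simp: utree_act_letter utree_dst)
qed

lemma utree_displacement_root:
  assumes g: "3 \<le> g"
  shows "displacement (surface_gens g) utree (encode ([], 0)) = 1"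
proof (rule antisym)
  show "displacement (surface_gens g) utree (encode ([], 0)) \<le> 1"
  proof (rule displacement_le)
    show "letters g \<noteq> {}" using gens_in[OF g] by auto
    fix l assume l: "l \<in> letters g"
    have dist: "tree_dist ([], 0) ([], 0) = 0" "tree_dist ([], 0) ([i], 0) = 1" for i
      by (simp_all add: tree_dist_def meet_def)
    show "dst utree (encode ([], 0)) (act utree (word_rel g `` {[l]}) (encode ([], 0))) \<le> 1"
      by (rule gen_letters_cases[of "\<lambda>y. y" tree_swap "flip None" "flip (Some True)" l])
         (simp_all add: utree_act_letter[OF l root_in] utree_dst dist)
  qed
  show "1 \<le> displacement (surface_gens g) utree (encode ([], 0))"
    by (rule utree_displacement_ge[OF g]) (simp add: utree_pts root_in)
qed

lemma involution_fixes_end: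
  assumes r: "geodesic_ray T d r" and fixed: "same_end (\<lambda>t. a (r t)) r"
    and a: "\<And>t. 0 \<le> t \<Longrightarrow> a (a (r t)) = r t"
  obtains s where "0 \<le> s" "\<And>t. s \<le> t \<Longrightarrow> a (r t) = r t"
proof -
  obtain \<alpha> \<beta> where ab: "0 \<le> \<alpha>" "0 \<le> \<beta>" "\<And>t. 0 \<le> t \<Longrightarrow> a (r (\<alpha> + t)) = r (\<beta> + t)"
    using fixed unfolding same_end_def by blast
  have inj: "s = t" if "0 \<le> s" "0 \<le> t" "r s = r t" for s t
  proof -
    have "d (r s) (r t) = \<bar>s - t\<bar>" "d (r s) (r s) = \<bar>s - s\<bar>"
      using r that unfolding geodesic_ray_def by blast+
    then show ?thesis using that(3) by simp
  qed
  text \<open>A translation towards or away from the end cannot be undone by itself.\<close>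
  have "\<alpha> = \<beta>"
  proof (cases "\<alpha> \<le> \<beta>")
    case True
    have "r (\<beta> + (\<beta> - \<alpha>)) = a (r (\<alpha> + (\<beta> - \<alpha>)))" using ab(3)[of "\<beta> - \<alpha>"] True by simp
    also have "\<dots> = a (a (r \<alpha>))" using ab(3)[of 0] by simp
    finally show ?thesis using inj[of "\<beta> + (\<beta> - \<alpha>)" \<alpha>] a[OF ab(1)] ab(1,2) True by simp
  next
    case False
    have "r (\<alpha> + (\<alpha> - \<beta>)) = a (a (r (\<alpha> + (\<alpha> - \<beta>))))" using a[of "\<alpha> + (\<alpha> - \<beta>)"] ab(1) False by simp
    also have "\<dots> = a (r \<alpha>)" using ab(3)[of "\<alpha> - \<beta>"] False by simp
    also have "\<dots> = r \<beta>" using ab(3)[of 0] by simp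
    finally show ?thesis using inj[of "\<alpha> + (\<alpha> - \<beta>)" \<beta>] ab(1,2) False by simp
  qed
  then have "a (r t) = r t" if "\<alpha> \<le> t" for t using ab(3)[of "t - \<alpha>"] that by simp
  then show ?thesis using that ab(1) by blast
qed

text \<open>If c_0 and c_1 fixed the same end, both would fix all far points of a ray to it, whereas
  one of them moves any given point by at least 1.\<close>

lemma utree_no_fixed_end:
  assumes g: "3 \<le> g"
  shows "\<not> fixes_an_end (surface_group g) utree"
proof
  assume "fixes_an_end (surface_group g) utree"
  then obtain r where r: "geodesic_ray (pts utree) (dst utree) r"
    and ends: "\<And>\<gamma>. \<gamma> \<in> carrier (surface_group g) \<Longrightarrow> same_end (\<lambda>t. act utree \<gamma> (r t)) r"
    unfolding fixes_an_end_def by blast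
  have rp: "\<exists>p\<in>tree_pts. r t = encode p" if "0 \<le> t" for t
    using r that by (auto simp: geodesic_ray_def utree_pts image_subset_iff)
  have fixed: "\<exists>s\<ge>0. \<forall>t\<ge>s. act utree (word_rel g `` {[l]}) (r t) = r t"
    if l: "l \<in> letters g" and
      e: "tree_letter l = flip i" for l i
  proof -
    let ?\<gamma> = "word_rel g `` {[l]}"
    have "?\<gamma> \<in> carrier (surface_group g)" using l by (intro word_class_in_carrier) simp
    moreover have "act utree ?\<gamma> (act utree ?\<gamma> (r t)) = r t" if "0 \<le> t" for t
      using rp[OF that] l by (auto simp: utree_act_letter e flip_in flip_flip)
    ultimately obtain s where "0 \<le> s" "\<And>t. s \<le> t \<Longrightarrow> act utree ?\<gamma> (r t) = r t"
      using involution_fixes_end[OF r ends, of ?\<gamma>] by auto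
    then show ?thesis by blast
  qed
  obtain s1 where s1: "0 \<le> s1" "\<forall>t\<ge>s1. act utree (word_rel g `` {[(Gen_a 1, False)]}) (r t) = r t"
    using fixed[OF gens_in(2)[OF g], of None] by auto
  obtain s2 where s2: "0 \<le> s2" "\<forall>t\<ge>s2. act utree (word_rel g `` {[(Gen_a 2, False)]}) (r t) = r t"
    using fixed[OF gens_in(3)[OF g], of "Some True"] by auto
  obtain p where p: "p \<in> tree_pts" "r (s1 + s2) = encode p" using rp[of "s1 + s2"] s1 s2 by auto
  have "encode (flip None p) = encode p" "encode (flip (Some True) p) = encode p"
    using s1(2)[rule_format, of "s1 + s2"] s2(2)[rule_format, of "s1 + s2"] s1(1) s2(1) p gens_in[OF g]
    by (simp_all add: utree_act_letter)
  then have "flip None p = p" "flip (Some True) p = p" by (metis decode_encode)+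
  then show False using tree_dist_flip_ge[OF p(1), of None "Some True"] tree_dist_eq_0_iff[OF p(1) p(1)] by simp
qed

lemma equivariantly_isometric_refl: "equivariantly_isometric G A A"
  unfolding equivariantly_isometric_def by (rule exI[of _ "\<lambda>x. x"]) (auto simp: bij_betw_def)

lemma utree_class: "3 \<le> g \<Longrightarrow> iso_class (surface_group g) utree \<in> tree_space g"
  unfolding tree_space_def
proof (intro CollectI exI conjI)
  assume g: "3 \<le> g"
  show "R_tree_action (surface_group g) utree" by (rule utree_action)
  show "minimal_action (surface_group g) utree" by (rule utree_minimal[OF g])
  have "encode ([], 0) \<noteq> encode ([None], 0)" by (simp add: inj_eq[OF inj_encode])
  then show "\<exists>x\<in>pts utree. \<exists>y\<in>pts utree. x \<noteq> y"
    by (intro bexI[of _ "encode ([], 0)"] bexI[of _ "encode ([None], 0)"])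
       (auto simp: utree_pts tree_pts_def)
  show "\<exists>x\<in>pts utree. displacement (surface_gens g) utree x = 1"
    using utree_displacement_root[OF g] root_in by (auto simp: utree_pts)
  show "\<forall>x\<in>pts utree. 1 \<le> displacement (surface_gens g) utree x"
    using utree_displacement_ge[OF g] by blast
  show "is_line (pts utree) (dst utree) \<or> \<not> fixes_an_end (surface_group g) utree"
    using utree_no_fixed_end[OF g] by blast
qed simp_all

section \<open>The approximating representations\<close>

abbreviation hyperbolicity :: "('c, 'a) space_action \<Rightarrow> real" where
  "hyperbolicity A \<equiv> hyperbolicity_constant (pts A) (dst A)"

definition hyp_rep :: "real \<Rightarrow> word set \<Rightarrow> real ^ 3 \<Rightarrow> real ^ 3" where
  "hyp_rep L = involution_action hyp_space turn1 (half_turn L None) (half_turn L (Some True))"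

abbreviation hyp_word :: "real \<Rightarrow> word \<Rightarrow> real ^ 3 \<Rightarrow> real ^ 3" where
  "hyp_word L \<equiv> involution_word turn1 (half_turn L None) (half_turn L (Some True))"

abbreviation approx_scale :: "nat \<Rightarrow> real \<Rightarrow> real" where
  "approx_scale g L \<equiv> rep_scale g (hyp_rep L)"

lemma hyp_three_involutions:
  assumes "0 < L"
  shows "three_involutions hyp_space turn1 (half_turn L None) (half_turn L (Some True))"
  by unfold_locales
    (use assms in \<open>auto simp: orthogonal_hyp_space orthogonal_turn1 half_turn_in half_turn_half_turn\<close>)

lemma hyp_rep_class:
  "0 < L \<Longrightarrow> w \<in> lists (letters g) \<Longrightarrow> x \<in> hyp_space \<Longrightarrow> hyp_rep L (word_rel g `` {w}) x = hyp_word L w x"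
  unfolding hyp_rep_def by (rule three_involutions.action_class[OF hyp_three_involutions])

abbreviation hyp_letters :: "real \<Rightarrow> letter \<Rightarrow> real ^ 3 \<Rightarrow> real ^ 3" where
  "hyp_letters L \<equiv> gen_letters \<one>\<^bsub>BijGroup hyp_space\<^esub> (restrict turn1 hyp_space)
     (restrict (half_turn L None) hyp_space) (restrict (half_turn L (Some True)) hyp_space)"

lemma hyp_letters_isom: "0 < L \<Longrightarrow> hyp_letters L l \<in> hyp_isom_plus"
  by (rule gen_letters_cases[of "\<one>\<^bsub>BijGroup hyp_space\<^esub>" "restrict turn1 hyp_space"
        "restrict (half_turn L None) hyp_space" "restrict (half_turn L (Some True)) hyp_space" l])
     (simp_all only: turn1_isom half_turn_isom id_hyp_isom_plus BijGroup_one)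

lemma hyp_rep_eq:
  assumes "0 < L" "w \<in> lists (letters g)"
  shows "hyp_rep L (word_rel g `` {w}) = word_eval (BijGroup hyp_space) (hyp_letters L) w"
  unfolding hyp_rep_def involution_action_def
  by (rule surface_assignment.surface_lift_class[OF three_involutions.assignment[OF hyp_three_involutions[OF assms(1)]] assms(2)])

lemma hyp_rep_letter:
  assumes L: "0 < L" and l: "l \<in> letters g"
  shows "hyp_rep L (word_rel g `` {[l]}) = hyp_letters L l"
proof -
  have "hyp_letters L l \<in> carrier (BijGroup hyp_space)"
    using hyp_isom_plus_Bij[OF hyp_letters_isom[OF L]] by (simp only: BijGroup_carrier)
  then show ?thesis
    using hyp_rep_eq[OF L, of "[l]" g] l monoid.r_one[OF group.is_monoid[OF group_BijGroup]]
    by (simp add: word_eval_def)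
qed

lemma hyp_rep_representation:
  assumes L: "0 < L"
  shows "hyp_rep L \<in> representations g"
proof -
  have mult: "x \<otimes>\<^bsub>hyp_isom_plus_group\<^esub> y = x \<otimes>\<^bsub>BijGroup hyp_space\<^esub> y" for x y :: "real ^ 3 \<Rightarrow> real ^ 3"
    by (simp add: hyp_isom_plus_group_def)
  have eval: "word_eval (BijGroup hyp_space) (hyp_letters L) w \<in> hyp_isom_plus" for w
  proof (induction w)
    case Nil
    show ?case by (simp only: word_eval_def foldr.simps id_apply BijGroup_one id_hyp_isom_plus)
  next
    case (Cons l w)
    have "word_eval (BijGroup hyp_space) (hyp_letters L) (l # w) =
        compose hyp_space (hyp_letters L l) (word_eval (BijGroup hyp_space) (hyp_letters L) w)"
      using BijGroup_mult[OF hyp_isom_plus_Bij[OF hyp_letters_isom[OF L]] hyp_isom_plus_Bij[OF Cons]]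
      by (simp only: word_eval_def foldr.simps o_apply)
    then show ?case using hyp_isom_plus_compose[OF hyp_letters_isom[OF L] Cons] by (simp only:)
  qed
  have "hyp_rep L \<gamma> \<in> hyp_isom_plus" if "\<gamma> \<in> carrier (surface_group g)" for \<gamma>
    using that by (elim surface_group_carrierE) (simp only: hyp_rep_eq[OF L] eval)
  moreover have "hyp_rep L \<in> hom (surface_group g) (BijGroup hyp_space)"
    unfolding hyp_rep_def by (rule three_involutions.hom[OF hyp_three_involutions[OF L]])
  ultimately show ?thesis
    unfolding representations_def hom_def mult by (auto simp: hyp_isom_plus_group_def)
qed

lemma hyp_rep_admissible:
  assumes L: "0 < L" and g: "3 \<le> g"
  shows "hyp_rep L \<in> admissible_reps g"
proof -
  note l = gens_in[OF g]
  have "global_fixed_points g (hyp_rep L) = {}"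
  proof (rule ccontr)
    assume "global_fixed_points g (hyp_rep L) \<noteq> {}"
    then obtain \<xi> where \<xi>: "\<And>\<gamma>. \<gamma> \<in> carrier (surface_group g) \<Longrightarrow> fixes_boundary_point (hyp_rep L \<gamma>) \<xi>"
      unfolding global_fixed_points_def by blast
    have "fixes_boundary_point (hyp_letters L k) \<xi>" if "k \<in> letters g" for k
      using \<xi>[OF word_class_in_carrier, of "[k]"] that hyp_rep_letter[OF L that] by simp
    from this[OF l(1)] this[OF l(2)] show False
      using no_common_boundary_fixed_point[OF L, of \<xi>] by simp
  qed
  then show ?thesis using hyp_rep_representation[OF L] by (simp add: admissible_reps_def)
qed

lemma embed_tree_word:
  assumes L: "0 < L" and x: "x \<in> tree_pts"
  shows "embed L (tree_word w x) = hyp_word L w (embed L x)"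
  by (rule involution_word_equivariant[where S = tree_pts])
     (use x embed_flip[OF L] embed_tree_swap[OF L] tree_swap_in flip_in in \<open>auto simp del: tree_swap.simps\<close>)

text \<open>Choosing the far flipped base point costs \<open>ln 4 + hyp_delta\<close>. This loss is
  doubled because the distance to that point enters twice in the next four-point inequality, which
  costs a further \<open>hyp_delta\<close>.\<close>

definition scale_error :: real where "scale_error = 2 * ln 4 + 3 * hyp_delta"

text \<open>One of the flipped base points is far from \<open>x\<close>, compared to the base point. The corresponding
  half-turn exchanges the base point and its image, so that it moves \<open>x\<close> a lot.\<close>

lemma half_turn_displacement:
  assumes L: "0 < L" and x: "x \<in> hyp_space" and ij: "i \<noteq> j"
  shows "L - scale_error \<le> hyp_dist x (half_turn L i x) \<or> L - scale_error \<le> hyp_dist x (half_turn L j x)"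
proof -
  have \<delta>: "0 \<le> hyp_delta" by (rule hyp_delta_nonneg)
  have ln4: "0 \<le> ln (4::real)" by simp
  let ?p = "\<lambda>k. ray_point L (dir k)"
  have 0: "hyp_dist 0 (?p k) = L" for k using L by (simp add: hyp_dist_0_ray_point)
  have far: "L - scale_error \<le> hyp_dist x (half_turn L k x)"
    if k: "hyp_dist x 0 + L - ln 4 - hyp_delta \<le> hyp_dist x (?p k)" for k
  \<comment> \<open>A large \<open>L\<close> is what excludes the term
    \<open>2 * hyp_dist x 0\<close> of the maximum; for small \<open>L\<close> the claim is just
    that distances are nonnegative.\<close>
  proof (cases "L \<le> scale_error")
    case True
    then show ?thesis using hyp_dist_nonneg[OF x half_turn_in[OF L x]] by (simp add: order_trans[of _ 0])
  next
    case False
    have swap: "hyp_dist (half_turn L k x) 0 = hyp_dist x (?p k)" "hyp_dist (?p k) (half_turn L k x) = hyp_dist x 0"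
      using hyp_dist_half_turn_left[OF L x, of 0 k] hyp_dist_half_turn[OF L _ x, of 0 k] half_turn_0[OF L, of k]
        hyp_dist_commute[of 0 x] by auto
    have "hyp_dist x (?p k) + hyp_dist (half_turn L k x) 0 \<le>
        max (hyp_dist x (half_turn L k x) + hyp_dist (?p k) 0) (hyp_dist x 0 + hyp_dist (?p k) (half_turn L k x)) + hyp_delta"
      by (rule four_pointD[OF four_point_hyp]) (use x half_turn_in[OF L x] in auto)
    then have "2 * hyp_dist x (?p k) \<le> max (hyp_dist x (half_turn L k x) + L) (2 * hyp_dist x 0) + hyp_delta"
      using swap 0[of k] hyp_dist_commute[of 0 "?p k"] by simp
    then show ?thesis
      using k False hyp_dist_nonneg[OF x zero_in_hyp_space] \<delta> ln4 unfolding scale_error_def by linarith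
  qed
  have "hyp_dist x 0 + hyp_dist (?p i) (?p j) \<le>
      max (hyp_dist x (?p i) + hyp_dist 0 (?p j)) (hyp_dist x (?p j) + hyp_dist 0 (?p i)) + hyp_delta"
    by (rule four_pointD[OF four_point_hyp]) (use x in auto)
  moreover have "L + L - ln 4 \<le> hyp_dist (?p i) (?p j)"
    by (rule hyp_dist_ray_point_obtuse) (use L ij dir_obtuse in auto)
  ultimately have "hyp_dist x 0 + L - ln 4 - hyp_delta \<le> hyp_dist x (?p i) \<or>
      hyp_dist x 0 + L - ln 4 - hyp_delta \<le> hyp_dist x (?p j)"
    unfolding 0 by linarith
  then show ?thesis using far by blast
qed

lemma rep_displacement_bounds:
  assumes L: "0 < L" and g: "3 \<le> g"
  shows "L - scale_error \<le> rep_displacement g (hyp_rep L)" "rep_displacement g (hyp_rep L) \<le> L"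
proof -
  note l = gens_in[OF g]
  let ?A = "hyp_action (hyp_rep L)"
  have act: "act ?A (word_rel g `` {[k]}) x = gen_letters (\<lambda>y. y) turn1 (half_turn L None) (half_turn L (Some True)) k x"
    if "k \<in> letters g" "x \<in> hyp_space" for k x
    using hyp_rep_class[OF L, of "[k]" g x] that by (simp add: hyp_action_def)
  have lower: "L - scale_error \<le> displacement (surface_gens g) ?A x" if x: "x \<in> hyp_space" for x
    using half_turn_displacement[OF L x, of None "Some True"]
      displacement_ge_iff[OF l(2), of "L - scale_error" ?A x] displacement_ge_iff[OF l(3), of "L - scale_error" ?A x]
      act[OF l(2) x] act[OF l(3) x] by (auto simp: hyp_action_def)
  show "L - scale_error \<le> rep_displacement g (hyp_rep L)"
    unfolding rep_displacement_def by (rule cINF_greatest) (use lower zero_in_hyp_space in blast)+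
  have "rep_displacement g (hyp_rep L) \<le> displacement (surface_gens g) ?A 0"
    unfolding rep_displacement_def
    by (rule cINF_lower[OF bdd_belowI2[of _ "L - scale_error"] zero_in_hyp_space]) (rule lower)
  also have "\<dots> \<le> L"
  proof (rule displacement_le)
    show "letters g \<noteq> {}" using l by auto
    fix k assume k: "k \<in> letters g"
    have dst: "dst ?A = hyp_dist" by (simp add: hyp_action_def)
    have turn1_0: "turn1 0 = 0" by (simp add: turn1_def vec_eq_iff forall_3)
    have d0: "hyp_dist 0 (0 :: real ^ 3) = 0" by (simp add: hyp_dist_eq_0_iff)
    show "dst ?A 0 (act ?A (word_rel g `` {[k]}) 0) \<le> L"
      unfolding act[OF k zero_in_hyp_space] dst
      by (rule gen_letters_cases[of "\<lambda>y. y" turn1 "half_turn L None" "half_turn L (Some True)" k])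
         (use L in \<open>simp_all add: turn1_0 d0 half_turn_0 hyp_dist_0_ray_point\<close>)
  qed
  finally show "rep_displacement g (hyp_rep L) \<le> L" .
qed

text \<open>The prescribed normalisation can be replaced by division by \<open>L\<close> in the
  limit: the origin is moved by at most \<open>L\<close>, and every point by at least
  \<open>L - scale_error\<close>.\<close>

lemma rep_scale_asymptotic:
  assumes g: "3 \<le> g"
  shows "((\<lambda>L. L / approx_scale g L) \<longlongrightarrow> 1) at_top"
proof -
  have "((\<lambda>L. approx_scale g L / L) \<longlongrightarrow> 1) at_top"
  proof (rule tendsto_sandwich)
    have "((\<lambda>L. 1 - scale_error / L) \<longlongrightarrow> 1 - 0) at_top"
      by (intro tendsto_diff tendsto_const const_div_at_top)
    then show "((\<lambda>L. 1 - scale_error / L) \<longlongrightarrow> 1) at_top" by simp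
    show "((\<lambda>L::real. 1) \<longlongrightarrow> 1) at_top" by simp
    show "\<forall>\<^sub>F L in at_top. 1 - scale_error / L \<le> approx_scale g L / L"
    proof (rule eventually_pos)
      fix L :: real assume L: "0 < L"
      have "L - scale_error \<le> approx_scale g L"
        using rep_displacement_bounds(1)[OF L g] by (simp add: rep_scale_def)
      from divide_right_mono[OF this, of L] show "1 - scale_error / L \<le> approx_scale g L / L"
        using L by (simp add: diff_divide_distrib)
    qed
    show "\<forall>\<^sub>F L in at_top. approx_scale g L / L \<le> 1"
      \<comment> \<open>The maximum with 1 in \<open>rep_scale\<close> is bounded by
        \<open>L\<close> once \<open>L\<close> is at least 1.\<close>
      using eventually_ge_at_top[of 1]
    proof eventually_elim
      case (elim L)
      then show ?case using rep_displacement_bounds(2)[OF _ g, of L] by (simp add: rep_scale_def)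
    qed
  qed
  from tendsto_inverse[OF this] show ?thesis by simp
qed

lemma rep_scale_at_top:
  assumes g: "3 \<le> g"
  shows "((\<lambda>L. c / approx_scale g L) \<longlongrightarrow> 0) at_top"
proof -
  from tendsto_mult[OF const_div_at_top rep_scale_asymptotic[OF g]]
  have "((\<lambda>L. c / L * (L / approx_scale g L)) \<longlongrightarrow> 0) at_top" by simp
  then show ?thesis
    by (rule Lim_transform_eventually) (rule eventually_pos, simp)
qed

lemma rescaled_dist_tendsto:
  assumes g: "3 \<le> g" and xy: "x \<in> tree_pts" "y \<in> tree_pts"
  shows "((\<lambda>L. hyp_dist (embed L x) (embed L y) / approx_scale g L) \<longlongrightarrow> tree_dist x y) at_top"
proof -
  have "((\<lambda>L. hyp_dist (embed L x) (embed L y) / L * (L / approx_scale g L)) \<longlongrightarrow> tree_dist x y) at_top"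
    using tendsto_mult[OF tree_dist_tendsto[OF xy] rep_scale_asymptotic[OF g]] by simp
  then show ?thesis
    by (rule Lim_transform_eventually) (rule eventually_pos, simp)
qed

lemma rep_scale_pos: "0 < rep_scale g \<rho>"
  by (simp add: rep_scale_def)

lemma rescaled_hyperbolicity:
  fixes \<rho> :: "word set \<Rightarrow> real ^ 'n \<Rightarrow> real ^ 'n"
  shows "0 \<le> hyperbolicity (rescaled_action g \<rho>)"
    "hyperbolicity (rescaled_action g \<rho>) \<le> 2 * (hyp_delta / rep_scale g \<rho>)"
proof -
  let ?X = "hyp_space :: (real ^ 'n) set" and ?s = "rep_scale g \<rho>"
  text \<open>\<open>Metric_space\<close> constrains the distance outside of the carrier as well.\<close>
  define d where "d x y = (if x \<in> ?X \<and> y \<in> ?X then hyp_dist x y / ?s else 0)" for x y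
  have s: "0 < ?s" by (rule rep_scale_pos)
  have ne: "?X \<noteq> {}" using zero_in_hyp_space by blast
  have M: "Metric_space ?X d"
  proof
    fix x y z
    show "0 \<le> d x y" using s hyp_dist_nonneg by (auto simp: d_def intro!: divide_nonneg_pos)
    show "d x y = d y x" by (auto simp: d_def hyp_dist_commute)
    assume x: "x \<in> ?X" and y: "y \<in> ?X"
    then show "d x y = 0 \<longleftrightarrow> x = y" using s by (auto simp: d_def hyp_dist_eq_0_iff)
    assume z: "z \<in> ?X"
    show "d x z \<le> d x y + d y z"
      using x y z divide_right_mono[OF hyp_dist_triangle[OF x y z], of ?s] s by (simp add: d_def add_divide_distrib)
  qed
  have F: "four_point ?X d (hyp_delta / ?s)"
    unfolding four_point_def
  proof (intro ballI)
    fix x y z w assume X: "x \<in> ?X" "y \<in> ?X" "z \<in> ?X" "w \<in> ?X"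
    show "d x y + d z w \<le> max (d x z + d y w) (d x w + d y z) + hyp_delta / ?s"
      using divide_right_mono[OF four_pointD[OF four_point_hyp X], of ?s] s X
      by (simp add: d_def add_divide_distrib max_divide_distrib_right)
  qed
  have "hyperbolicity (rescaled_action g \<rho>) = hyperbolicity_constant ?X d"
    by (rule hyperbolicity_constant_isometric[of "\<lambda>x. x"])
       (auto simp: rescaled_action_def d_def bij_betw_def)
  then show "0 \<le> hyperbolicity (rescaled_action g \<rho>)"
    "hyperbolicity (rescaled_action g \<rho>) \<le> 2 * (hyp_delta / ?s)"
    using hyperbolicity_constant_bounds[OF M F _ ne] hyp_delta_nonneg s by auto
qed

text \<open>Classes consist of actions on subsets of \<open>universe\<close>, so a representative of
  the class of a hyperbolic action has to be copied there before neighbourhoods can be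
  tested.\<close>

definition push_action :: "('a \<Rightarrow> 'b) \<Rightarrow> ('c, 'a) space_action \<Rightarrow> ('c, 'b) space_action" where
  "push_action e A = \<lparr>act = (\<lambda>\<gamma> y. e (act A \<gamma> (inv_into UNIV e y))), pts = e ` pts A,
     dst = (\<lambda>x y. dst A (inv_into UNIV e x) (inv_into UNIV e y))\<rparr>"

lemma push_action_simps:
  assumes "inj e"
  shows "act (push_action e A) \<gamma> (e x) = e (act A \<gamma> x)" "dst (push_action e A) (e x) (e y) = dst A x y"
    "pts (push_action e A) = e ` pts A"
  using assms by (simp_all add: push_action_def)

lemma equivariantly_isometric_push:
  assumes "inj e"
  shows "equivariantly_isometric G A (push_action e A)"
  unfolding equivariantly_isometric_def
  by (intro exI[of _ e])
     (simp add: push_action_simps[OF assms] bij_betw_def inj_on_subset[OF assms subset_UNIV])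

lemma hyperbolicity_constant_equivariantly_isometric:
  "equivariantly_isometric G A B \<Longrightarrow>
    hyperbolicity B = hyperbolicity A"
  unfolding equivariantly_isometric_def by (elim exE conjE) (rule hyperbolicity_constant_isometric, auto)

definition encode3 :: "real ^ 3 \<Rightarrow> universe" where
  "encode3 v n = (if n = 0 then v $ 1 else if n = 1 then v $ 2 else v $ 3)"

lemma inj_encode3: "inj encode3"
proof (rule injI)
  fix v w assume "encode3 v = encode3 w"
  then have "encode3 v 0 = encode3 w 0" "encode3 v 1 = encode3 w 1" "encode3 v 2 = encode3 w 2" by auto
  then show "v = w" by (simp add: encode3_def vec_eq_iff forall_3)
qed

section \<open>Convergence to the tree\<close>

abbreviation approx_class :: "nat \<Rightarrow> real \<Rightarrow> point" where
  "approx_class g L \<equiv> iso_class (surface_group g) (rescaled_action g (hyp_rep L))"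

lemma utree_hyperbolicity: "hyperbolicity utree = 0"
proof -
  have "pts utree \<noteq> {}" using root_in unfolding utree_pts by blast
  from hyperbolicity_constant_bounds[OF utree_metric utree_four_point _ this]
  show ?thesis by simp
qed

lemma close_actionsE:
  assumes "close_actions K \<epsilon> P A B"
  obtains f where "f \<in> K \<rightarrow> pts B"
    "\<And>\<gamma> \<eta> x y. \<gamma> \<in> P \<Longrightarrow> \<eta> \<in> P \<Longrightarrow> x \<in> K \<Longrightarrow> y \<in> K \<Longrightarrow>
      \<bar>dst A (act A \<gamma> x) (act A \<eta> y) - dst B (act B \<gamma> (f x)) (act B \<eta> (f y))\<bar> < \<epsilon>"
    "\<bar>hyperbolicity A - hyperbolicity B\<bar> < \<epsilon>"
  using assms unfolding close_actions_def by blast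

text \<open>A basic open set around the tree may be centred at any other action \<open>A'\<close>.
  The points witnessing that the tree belongs to it are carried to hyperbolic space by
  \<open>embed\<close>; being finitely many strict inequalities, the conditions persist for large
  \<open>L\<close>.\<close>

lemma eventually_close_actions:
  assumes g: "3 \<le> g" and B: "equivariantly_isometric (surface_group g) utree B"
    and fin: "finite K" "finite P" "P \<subseteq> carrier (surface_group g)"
    and close: "close_actions K \<epsilon> P A' B"
  shows "\<forall>\<^sub>F L in at_top. \<exists>C\<in>approx_class g L. close_actions K \<epsilon> P A' C"
proof -
  let ?G = "surface_group g"
  obtain h where h: "bij_betw h (pts utree) (pts B)"
    "\<And>x y. x \<in> pts utree \<Longrightarrow> y \<in> pts utree \<Longrightarrow> dst B (h x) (h y) = dst utree x y"
    "\<And>\<gamma> x. \<gamma> \<in> carrier ?G \<Longrightarrow> x \<in> pts utree \<Longrightarrow> h (act utree \<gamma> x) = act B \<gamma> (h x)"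
    using B unfolding equivariantly_isometric_def by blast
  obtain f where f: "f \<in> K \<rightarrow> pts B"
    "\<And>\<gamma> \<eta> x y. \<gamma> \<in> P \<Longrightarrow> \<eta> \<in> P \<Longrightarrow> x \<in> K \<Longrightarrow> y \<in> K \<Longrightarrow>
      \<bar>dst A' (act A' \<gamma> x) (act A' \<eta> y) - dst B (act B \<gamma> (f x)) (act B \<eta> (f y))\<bar> < \<epsilon>"
    and \<epsilon>: "\<bar>hyperbolicity A' - hyperbolicity B\<bar> < \<epsilon>"
    using close unfolding close_actions_def by blast
  have "\<exists>p\<in>tree_pts. h (encode p) = f x" if "x \<in> K" for x
    using f(1) h(1) that by (force simp: bij_betw_def utree_pts)
  then obtain p where p: "\<And>x. x \<in> K \<Longrightarrow> p x \<in> tree_pts" "\<And>x. x \<in> K \<Longrightarrow> h (encode (p x)) = f x" by metis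
  have "\<exists>w. w \<in> lists (letters g) \<and> \<gamma> = word_rel g `` {w}" if "\<gamma> \<in> P" for \<gamma>
    using fin(3) that by (blast elim: surface_group_carrierE)
  then obtain w where w: "\<And>\<gamma>. \<gamma> \<in> P \<Longrightarrow> w \<gamma> \<in> lists (letters g)" "\<And>\<gamma>. \<gamma> \<in> P \<Longrightarrow> \<gamma> = word_rel g `` {w \<gamma>}" by metis
  define C where "C L = push_action encode3 (rescaled_action g (hyp_rep L))" for L
  have C: "C L \<in> approx_class g L" for L
    unfolding iso_class_def C_def using equivariantly_isometric_push[OF inj_encode3] by blast
  have BT: "dst B (act B \<gamma> (f x)) (act B \<eta> (f y)) = tree_dist (tree_word (w \<gamma>) (p x)) (tree_word (w \<eta>) (p y))"
    if "\<gamma> \<in> P" "\<eta> \<in> P" "x \<in> K" "y \<in> K" for \<gamma> \<eta> x y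
  proof -
    have move: "act B \<zeta> (f z) = h (encode (tree_word (w \<zeta>) (p z)))" if "\<zeta> \<in> P" "z \<in> K" for \<zeta> z
    proof -
      have "encode (p z) \<in> pts utree" "\<zeta> \<in> carrier ?G"
        using p(1)[OF that(2)] fin(3) that(1) by (auto simp: utree_pts)
      then have "act B \<zeta> (f z) = h (act utree \<zeta> (encode (p z)))"
        using h(3)[of \<zeta> "encode (p z)"] p(2)[OF that(2)] by simp
      also have "act utree \<zeta> (encode (p z)) = encode (tree_word (w \<zeta>) (p z))"
        using utree_act[OF w(1)[OF that(1)] p(1)[OF that(2)]] w(2)[OF that(1)] by simp
      finally show ?thesis .
    qed
    show ?thesis
      unfolding move[OF that(1,3)] move[OF that(2,4)]
      using h(2)[of "encode (tree_word (w \<gamma>) (p x))" "encode (tree_word (w \<eta>) (p y))"]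
        tree_word_in[OF p(1)[OF that(3)]] tree_word_in[OF p(1)[OF that(4)]]
      by (simp add: utree_pts utree_dst)
  qed
  have CH: "dst (C L) (act (C L) \<gamma> (encode3 (embed L (p x)))) (act (C L) \<eta> (encode3 (embed L (p y)))) =
      hyp_dist (embed L (tree_word (w \<gamma>) (p x))) (embed L (tree_word (w \<eta>) (p y))) / approx_scale g L"
    if L: "0 < L" and "\<gamma> \<in> P" "\<eta> \<in> P" "x \<in> K" "y \<in> K" for L \<gamma> \<eta> x y
  proof -
    have "hyp_rep L \<zeta> (embed L (p z)) = embed L (tree_word (w \<zeta>) (p z))" if "\<zeta> \<in> P" "z \<in> K" for \<zeta> z
      using hyp_rep_class[OF L w(1)[OF that(1)] embed_in[OF L]] w(2)[OF that(1)]
        embed_tree_word[OF L p(1)[OF that(2)]] by simp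
    then show ?thesis using that
      by (simp add: C_def push_action_simps[OF inj_encode3]) (simp add: rescaled_action_def)
  qed
  let ?D = "\<lambda>\<gamma> \<eta> x y L. hyp_dist (embed L (tree_word (w \<gamma>) (p x))) (embed L (tree_word (w \<eta>) (p y))) / approx_scale g L"
  have "\<forall>\<^sub>F L in at_top. \<bar>dst A' (act A' \<gamma> x) (act A' \<eta> y) - ?D \<gamma> \<eta> x y L\<bar> < \<epsilon>"
    if P: "\<gamma> \<in> P" "\<eta> \<in> P" "x \<in> K" "y \<in> K" for \<gamma> \<eta> x y
  proof (rule order_tendstoD)
    show "((\<lambda>L. \<bar>dst A' (act A' \<gamma> x) (act A' \<eta> y) - ?D \<gamma> \<eta> x y L\<bar>) \<longlongrightarrow>
        \<bar>dst A' (act A' \<gamma> x) (act A' \<eta> y) - dst B (act B \<gamma> (f x)) (act B \<eta> (f y))\<bar>) at_top"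
      unfolding BT[OF P]
      by (intro tendsto_rabs tendsto_diff tendsto_const rescaled_dist_tendsto[OF g] tree_word_in p P)
  qed (rule f(2)[OF P])
  then have near: "\<forall>\<^sub>F L in at_top. \<forall>\<gamma>\<in>P. \<forall>\<eta>\<in>P. \<forall>x\<in>K. \<forall>y\<in>K.
      \<bar>dst A' (act A' \<gamma> x) (act A' \<eta> y) - ?D \<gamma> \<eta> x y L\<bar> < \<epsilon>"
    using fin by (intro eventually_ball_finite ballI) auto
  have hB: "hyperbolicity B = 0"
    using hyperbolicity_constant_equivariantly_isometric[OF B] utree_hyperbolicity by simp
  have hC: "0 \<le> hyperbolicity (C L)"
    "hyperbolicity (C L) \<le> 2 * (hyp_delta / approx_scale g L)" for L
    using rescaled_hyperbolicity[of g "hyp_rep L"]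
      hyperbolicity_constant_equivariantly_isometric[OF equivariantly_isometric_push[OF inj_encode3]]
    unfolding C_def by metis+
  let ?H = "\<lambda>L. hyperbolicity (C L)"
  have "(?H \<longlongrightarrow> 0) at_top"
  proof (rule tendsto_sandwich)
    show "((\<lambda>L::real. 0) \<longlongrightarrow> (0::real)) at_top" by simp
    show "((\<lambda>L. 2 * (hyp_delta / approx_scale g L)) \<longlongrightarrow> 0) at_top"
      using tendsto_mult[OF tendsto_const[of 2] rep_scale_at_top[OF g, of hyp_delta]] by simp
  qed (use hC in simp_all)
  then have "((\<lambda>L. \<bar>hyperbolicity A' - ?H L\<bar>) \<longlongrightarrow>
      \<bar>hyperbolicity A' - 0\<bar>) at_top"
    by (intro tendsto_rabs tendsto_diff tendsto_const)
  then have "\<forall>\<^sub>F L in at_top. \<bar>hyperbolicity A' - ?H L\<bar> < \<epsilon>"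
    by (rule order_tendstoD) (use \<epsilon> hB in simp)
  then show ?thesis
    using near eventually_gt_at_top[of 0]
  proof eventually_elim
    case (elim L)
    have "(\<lambda>x. encode3 (embed L (p x))) \<in> K \<rightarrow> pts (C L)"
      using embed_in[OF elim(3)] by (auto simp: C_def push_action_simps[OF inj_encode3] rescaled_action_def)
    then have "close_actions K \<epsilon> P A' (C L)"
      unfolding close_actions_def using elim CH[OF elim(3)]
      by (intro conjI bexI[of _ "\<lambda>x. encode3 (embed L (p x))"]) auto
    then show ?case using C by blast
  qed
qed

lemma approx_class_moduli:
  "0 < L \<Longrightarrow> 3 \<le> g \<Longrightarrow> approx_class g L \<in> moduli_u TYPE(3) g"
  unfolding moduli_u_def using hyp_rep_admissible by blast

lemma utree_mem_nbhd:
  assumes g: "3 \<le> g" and \<epsilon>: "0 < \<epsilon>" and K: "K \<subseteq> pts utree"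
  shows "iso_class (surface_group g) utree \<in> basic_nbhd n g K \<epsilon> P utree"
proof -
  have "close_actions K \<epsilon> P utree utree"
    unfolding close_actions_def using \<epsilon> K by (intro conjI bexI[of _ "\<lambda>x. x"]) auto
  then show ?thesis
    using utree_class[OF g] equivariantly_isometric_refl
    unfolding basic_nbhd_def iso_class_def by blast
qed

lemma open_basic_nbhd_utree:
  assumes "3 \<le> g" "0 < \<epsilon>" "finite K" "K \<subseteq> pts utree" "finite P" "P \<subseteq> carrier (surface_group g)"
  shows "openin (ambient_topology n g) (basic_nbhd n g K \<epsilon> P utree)"
proof -
  have "utree \<in> \<Union> (moduli_u n g \<union> tree_space g)"
    using utree_class[OF assms(1)] equivariantly_isometric_refl unfolding iso_class_def by blast
  then show ?thesis
    unfolding ambient_topology_def using assms by (intro topology_generated_by_Basis) blast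
qed

lemma utree_in_compactification:
  assumes g: "3 \<le> g"
  shows "iso_class (surface_group g) utree \<in> compactification TYPE(3) g"
proof -
  let ?c = "iso_class (surface_group g) utree" and ?T = "ambient_topology TYPE(3) g"
  \<comment> \<open>With \<open>K\<close> and \<open>P\<close> empty this neighbourhood only serves
    to place the class in the space.\<close>
  have "openin ?T (basic_nbhd TYPE(3) g {} 1 {} utree)"
    by (rule open_basic_nbhd_utree[OF g]) auto
  then have top: "?c \<in> topspace ?T"
    using utree_mem_nbhd[OF g, of 1 "{}"] openin_subset by fastforce
  \<comment> \<open>Containing the approximations for all large \<open>L\<close> passes to finite
    intersections and to unions, hence from the generating sets to every open set around the
    class.\<close>
  have ev: "\<forall>\<^sub>F L in at_top. approx_class g L \<in> U" if "openin ?T U" "?c \<in> U" for U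
    using that(1)[unfolded ambient_topology_def openin_topology_generated_by_iff] that(2)
  proof (induction rule: generate_topology_on.induct)
    case (Int a b)
    then show ?case by (simp add: eventually_conj)
  next
    case (UN K)
    then obtain k where k: "k \<in> K" "?c \<in> k" by blast
    show ?case by (rule eventually_mono[OF UN.IH[OF k]]) (use k(1) in blast)
  next
    case (Basis s)
    then obtain K \<epsilon> P A where s: "s = basic_nbhd TYPE(3) g K \<epsilon> P A" "finite K" "finite P" "P \<subseteq> carrier (surface_group g)"
      by blast
    then obtain B where B: "B \<in> ?c" "close_actions K \<epsilon> P A B"
      using Basis(2) unfolding basic_nbhd_def by blast
    have "\<forall>\<^sub>F L in at_top. \<exists>C\<in>approx_class g L. close_actions K \<epsilon> P A C"
      by (rule eventually_close_actions[OF g _ s(2-4) B(2)]) (use B(1) in \<open>simp add: iso_class_def\<close>)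
    then show ?case
      using eventually_gt_at_top[of 0]
      by eventually_elim (use approx_class_moduli g s(1) in \<open>auto simp: basic_nbhd_def\<close>)
  qed simp
  show ?thesis
    unfolding compactification_def in_closure_of
  proof (intro conjI top allI impI)
    fix U assume "?c \<in> U \<and> openin ?T U"
    then have "\<forall>\<^sub>F L in at_top. approx_class g L \<in> U" using ev by blast
    then have "\<forall>\<^sub>F L in at_top. approx_class g L \<in> U \<and> 0 < L"
      using eventually_gt_at_top[of 0] by (rule eventually_conj)
    then obtain L where "approx_class g L \<in> U" "0 < L"
      using eventually_happens'[OF trivial_limit_at_top_linorder] by blast
    then show "\<exists>y. y \<in> moduli_u TYPE(3) g \<and> y \<in> U" using approx_class_moduli[OF _ g] by blast
  qed
qed

section \<open>Tripods that exclude the tree\<close>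

text \<open>With \<open>c\<close> moved to the origin, the ends have a common squared norm
  \<open>n\<close> and pairwise inner products \<open>- n\<close>. Their sum would have squared norm
  3n - 6n < 0.\<close>

lemma hyp_no_tripod:
  fixes c x y z :: "real ^ 'n"
  assumes H: "c \<in> hyp_space" "x \<in> hyp_space" "y \<in> hyp_space" "z \<in> hyp_space" and r: "0 < r"
    and d: "hyp_dist c x = r" "hyp_dist c y = r" "hyp_dist c z = r"
      "hyp_dist x y = 2 * r" "hyp_dist y z = 2 * r" "hyp_dist x z = 2 * r"
  shows False
proof -
  have centred: False
    if H: "x \<in> hyp_space" "y \<in> hyp_space" "z \<in> hyp_space"
      and d: "hyp_dist 0 x = r" "hyp_dist 0 y = r" "hyp_dist 0 z = r"
        "hyp_dist x y = 2 * r" "hyp_dist y z = 2 * r" "hyp_dist x z = 2 * r" for x y z :: "real ^ 'n"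
  proof -
    \<comment> \<open>This is \<open>(tanh (r / 2))^2\<close>, the squared Euclidean norm of a point
      at hyperbolic distance \<open>r\<close> from the origin.\<close>
    define n where "n = (cosh r - 1) / (cosh r + 1)"
    have c: "1 < cosh r" using r cosh_real_strict_mono[of 0 r] by simp
    have n: "0 < n" "n < 1" "cosh r = (1 + n) / (1 - n)" using c by (auto simp: n_def field_simps)
    have norm: "(norm u)\<^sup>2 = n" if u: "u \<in> hyp_space" "hyp_dist 0 u = r" for u :: "real ^ 'n"
    proof -
      have "cosh r = (1 + (norm u)\<^sup>2) / (1 - (norm u)\<^sup>2)"
        using cosh_hyp_dist_inner[OF zero_in_hyp_space u(1)] u(2) by simp
      then have "(norm u)\<^sup>2 * (cosh r + 1) = cosh r - 1"
        using hyp_spaceD[OF u(1)] by (simp add: field_simps)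
      then show ?thesis using c by (simp add: n_def eq_divide_eq)
    qed
    have "u \<bullet> v = - n" if "u \<in> hyp_space" "v \<in> hyp_space" "hyp_dist 0 u = r" "hyp_dist 0 v = r" "hyp_dist u v = 2 * r"
      for u v :: "real ^ 'n"
    proof -
      have "2 * (cosh r)\<^sup>2 - 1 = ((1 + n) * (1 + n) - 4 * (u \<bullet> v)) / ((1 - n) * (1 - n))"
        using cosh_hyp_dist_inner[OF that(1,2)] norm[OF that(1,3)] norm[OF that(2,4)] that(5)
        by (simp add: cosh_double_cosh)
      then have "2 * ((1 + n) * (1 + n)) - (1 - n) * (1 - n) = (1 + n) * (1 + n) - 4 * (u \<bullet> v)"
        using n by (simp add: divide_simps power2_eq_square)
      then show ?thesis by (simp add: algebra_simps)
    qed
    then have "(x + y + z) \<bullet> (x + y + z) = - 3 * n"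
      using norm[OF H(1) d(1)] norm[OF H(2) d(2)] norm[OF H(3) d(3)] H d
      by (simp add: inner_add_left inner_add_right power2_norm_eq_inner inner_commute)
    then show False using n inner_ge_zero[of "x + y + z"] by linarith
  qed
  show False
  proof (cases "c = 0")
    case True
    then show ?thesis using centred[OF H(2-4)] d by simp
  next
    case False
    obtain a where a: "1 < norm a" "reflect a c = 0" using reflect_to_0[OF H(1) False] .
    note R = reflect_in[OF a(1)] and D = hyp_dist_reflect[OF a(1)]
    show ?thesis
      using centred[OF R[OF H(2)] R[OF H(3)] R[OF H(4)]] D[OF H(1,2)] D[OF H(1,3)] D[OF H(1,4)] D[OF H(2,3)]
        D[OF H(3,4)] D[OF H(2,4)] a(2) d by simp
  qed
qed

text \<open>Equality of the classes would give an isometry from the rescaled hyperbolic space onto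
  the tree. The preimages of the root and its three neighbours would form an exact tripod.\<close>

lemma utree_not_in_moduli:
  "iso_class (surface_group g) utree \<notin> moduli_u TYPE('n::finite) g"
proof
  assume "iso_class (surface_group g) utree \<in> moduli_u TYPE('n) g"
  then obtain \<rho> :: "word set \<Rightarrow> real ^ 'n \<Rightarrow> real ^ 'n"
    where "iso_class (surface_group g) utree = iso_class (surface_group g) (rescaled_action g \<rho>)"
    unfolding moduli_u_def by blast
  then have "equivariantly_isometric (surface_group g) (rescaled_action g \<rho>) utree"
    using equivariantly_isometric_refl unfolding iso_class_def by blast
  then obtain f where f: "bij_betw f (hyp_space :: (real ^ 'n) set) (encode ` tree_pts)"
    "\<And>x y. x \<in> hyp_space \<Longrightarrow> y \<in> hyp_space \<Longrightarrow> dst utree (f x) (f y) = hyp_dist x y / rep_scale g \<rho>"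
    unfolding equivariantly_isometric_def by (auto simp: rescaled_action_def utree_pts)
  have ex: "\<exists>x\<in>hyp_space. f x = encode p" if "p \<in> tree_pts" for p
  proof -
    have "encode p \<in> f ` hyp_space" unfolding bij_betw_imp_surj_on[OF f(1)] using that by (rule imageI)
    then show ?thesis by (metis imageE)
  qed
  have t: "([], 0) \<in> tree_pts" "([i], 0) \<in> tree_pts" for i by (auto simp: tree_pts_def)
  obtain c where c: "c \<in> hyp_space" "f c = encode ([], 0)" using ex[OF t(1)] by blast
  obtain v where v: "\<And>i. v i \<in> hyp_space" "\<And>i. f (v i) = encode ([i], 0)" using ex[OF t(2)] by metis
  have s: "0 < rep_scale g \<rho>" by (rule rep_scale_pos)
  have 1: "hyp_dist c (v i) = rep_scale g \<rho>" for i
    using f(2)[OF c(1) v(1)[of i]] s by (simp add: c v utree_dst tree_dist_def meet_def)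
  have 2: "hyp_dist (v i) (v j) = 2 * rep_scale g \<rho>" if "i \<noteq> j" for i j
    using f(2)[OF v(1)[of i] v(1)[of j]] s that by (simp add: v utree_dst tree_dist_def meet_def field_simps)
  show False
    by (rule hyp_no_tripod[OF c(1) v(1)[of None] v(1)[of "Some True"] v(1)[of "Some False"] s])
       (use 1 2 in auto)
qed

text \<open>The neighbourhood tests the three neighbours of the root against 1 and a_1. In units of
  the scale, a plane action in it has three points at mutual distances 2 up to 1/10, which the image
  of a_1 permutes up to 1/10 as s does: the situation of \<open>hyp_plane_no_swap\<close> with
  \<open>e = ?s / 10\<close>.\<close>

lemma utree_not_in_compactification_2:
  assumes g: "3 \<le> g"
  shows "iso_class (surface_group g) utree \<notin> compactification TYPE(2) g"
proof
  let ?c = "iso_class (surface_group g) utree"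
  let ?\<gamma> = "word_rel g `` {[(Gen_a 0, False)]}" and ?e = "word_rel g `` {[]}"
  define K where "K = (\<lambda>i. encode ([i], 0)) ` (UNIV :: bool option set)"
  have t: "([i], 0) \<in> tree_pts" for i by (auto simp: tree_pts_def)
  have K: "finite K" "K \<subseteq> pts utree" using t by (auto simp: K_def utree_pts)
  have car: "?e \<in> carrier (surface_group g)" "?\<gamma> \<in> carrier (surface_group g)"
    using gens_in(1)[OF g] by (auto intro!: word_class_in_carrier)
  let ?U = "basic_nbhd TYPE(2) g K (1/10) {?e, ?\<gamma>} utree"
  assume "?c \<in> compactification TYPE(2) g"
  moreover have "openin (ambient_topology TYPE(2) g) ?U"
    by (rule open_basic_nbhd_utree[OF g]) (use K car in auto)
  moreover have "?c \<in> ?U" by (rule utree_mem_nbhd[OF g _ K(2)]) simp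
  ultimately obtain C where C: "C \<in> moduli_u TYPE(2) g" "C \<in> ?U"
    unfolding compactification_def in_closure_of by blast
  obtain \<rho> :: "word set \<Rightarrow> real ^ 2 \<Rightarrow> real ^ 2" where \<rho>: "\<rho> \<in> admissible_reps g"
    "C = iso_class (surface_group g) (rescaled_action g \<rho>)"
    using C(1) unfolding moduli_u_def by blast
  have "\<exists>B\<in>C. close_actions K (1/10) {?e, ?\<gamma>} utree B"
    using C(2) by (simp only: basic_nbhd_def mem_Collect_eq)
  then obtain B where "B \<in> C" and B2: "close_actions K (1/10) {?e, ?\<gamma>} utree B" ..
  then have B1: "equivariantly_isometric (surface_group g) (rescaled_action g \<rho>) B"
    by (simp only: \<rho>(2) iso_class_def mem_Collect_eq)
  note B = B1 B2
  obtain h where h: "bij_betw h (hyp_space :: (real ^ 2) set) (pts B)"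
    "\<And>x y. x \<in> hyp_space \<Longrightarrow> y \<in> hyp_space \<Longrightarrow> dst B (h x) (h y) = hyp_dist x y / rep_scale g \<rho>"
    "\<And>\<gamma> x. \<gamma> \<in> carrier (surface_group g) \<Longrightarrow> x \<in> hyp_space \<Longrightarrow> h (\<rho> \<gamma> x) = act B \<gamma> (h x)"
    using B(1) unfolding equivariantly_isometric_def by (auto simp: rescaled_action_def)
  obtain f where f: "f \<in> K \<rightarrow> pts B" "\<And>\<gamma> \<eta> x y. \<gamma> \<in> {?e, ?\<gamma>} \<Longrightarrow> \<eta> \<in> {?e, ?\<gamma>} \<Longrightarrow> x \<in> K \<Longrightarrow> y \<in> K \<Longrightarrow>
      \<bar>dst utree (act utree \<gamma> x) (act utree \<eta> y) - dst B (act B \<gamma> (f x)) (act B \<eta> (f y))\<bar> < 1/10"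
    by (rule close_actionsE[OF B(2)]) (rule that, assumption, assumption)
  have "\<exists>x\<in>hyp_space. h x = f (encode ([i], 0))" for i
  proof -
    have "f (encode ([i], 0)) \<in> h ` hyp_space"
      unfolding bij_betw_imp_surj_on[OF h(1)] by (rule funcset_mem[OF f(1)]) (simp add: K_def)
    then show ?thesis by (metis imageE)
  qed
  then obtain v where v: "\<And>i. v i \<in> hyp_space" "\<And>i. h (v i) = f (encode ([i], 0))" by metis
  have isom: "\<rho> \<zeta> \<in> hyp_isom_plus" if "\<zeta> \<in> carrier (surface_group g)" for \<zeta>
    using \<rho>(1) that by (auto simp: admissible_reps_def representations_def hom_def hyp_isom_plus_group_def)
  have mem: "\<rho> \<zeta> (v i) \<in> hyp_space" if "\<zeta> \<in> carrier (surface_group g)" for \<zeta> i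
    using Bij_mem[OF hyp_isom_plus_Bij[OF isom[OF that]] v(1)] .
  let ?s = "rep_scale g \<rho>"
  have s: "0 < ?s" by (rule rep_scale_pos)
  have near: "\<bar>dst utree (act utree \<gamma> (encode ([i], 0))) (act utree \<eta> (encode ([j], 0)))
      - hyp_dist (\<rho> \<gamma> (v i)) (\<rho> \<eta> (v j)) / ?s\<bar> < 1/10"
    if "\<gamma> \<in> {?e, ?\<gamma>}" "\<eta> \<in> {?e, ?\<gamma>}" for \<gamma> \<eta> i j
  proof -
    have c: "\<gamma> \<in> carrier (surface_group g)" "\<eta> \<in> carrier (surface_group g)" using that car by auto
    have "dst B (act B \<gamma> (f (encode ([i], 0)))) (act B \<eta> (f (encode ([j], 0)))) = hyp_dist (\<rho> \<gamma> (v i)) (\<rho> \<eta> (v j)) / ?s"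
      using h(2)[OF mem[OF c(1)] mem[OF c(2)], of i j] h(3)[OF c(1) v(1)[of i]] h(3)[OF c(2) v(1)[of j]]
      by (simp add: v(2))
    then show ?thesis using f(2)[OF that, of "encode ([i], 0)" "encode ([j], 0)"] by (simp add: K_def)
  qed
  have tree_e: "act utree ?e (encode ([i], 0)) = encode ([i], 0)" for i
    using utree_act[of "[]" g, OF _ t] by simp
  have tree_\<gamma>: "act utree ?\<gamma> (encode ([i], 0)) = encode ([map_option Not i], 0)" for i
    using utree_act[of "[(Gen_a 0, False)]" g, OF _ t] gens_in(1)[OF g] by simp
  have e: "\<rho> ?e (v i) = v i" for i
  proof -
    have "\<rho> ?e = \<one>\<^bsub>BijGroup hyp_space\<^esub>"
    proof -
      have hom: "\<rho> \<in> hom (surface_group g) (BijGroup hyp_space)"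
        using \<rho>(1) hyp_isom_plus_Bij
        by (auto simp: admissible_reps_def representations_def hom_def hyp_isom_plus_group_def BijGroup_carrier)
      have "\<rho> \<one>\<^bsub>surface_group g\<^esub> = \<one>\<^bsub>BijGroup hyp_space\<^esub>"
        by (rule hom_one[OF hom surface_group_group group_BijGroup])
      then show ?thesis by (simp add: surface_group_def)
    qed
    then show ?thesis using v(1) by (simp add: BijGroup_one)
  qed
  have d: "tree_dist ([i], 0) ([j], 0) = (if i = j then 0 else 2)" for i j :: "bool option"
    by (simp add: tree_dist_def meet_def)
  have unscale: "\<bar>D - a * ?s\<bar> < ?s / 10" if "\<bar>a - D / ?s\<bar> < 1 / 10" for a D
  proof -
    have "D - a * ?s = - ((a - D / ?s) * ?s)" using s by (simp add: left_diff_distrib)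
    then have "\<bar>D - a * ?s\<bar> = \<bar>a - D / ?s\<bar> * ?s" using s by (simp add: abs_mult)
    then show ?thesis using mult_strict_right_mono[OF that s] by simp
  qed
  have long: "\<bar>hyp_dist (v i) (v j) - 20 * (?s / 10)\<bar> < ?s / 10" if "i \<noteq> j" for i j
  proof -
    have "\<bar>2 - hyp_dist (v i) (v j) / ?s\<bar> < 1 / 10"
      using near[of ?e ?e i j] that by (simp add: e tree_e utree_dst d)
    from unscale[OF this] show ?thesis by simp
  qed
  have short: "hyp_dist (\<rho> ?\<gamma> (v i)) (v (map_option Not i)) < ?s / 10" for i
  proof -
    have "\<bar>0 - hyp_dist (\<rho> ?\<gamma> (v i)) (v (map_option Not i)) / ?s\<bar> < 1 / 10"
      using near[of ?\<gamma> ?e i "map_option Not i"] by (simp add: e tree_e tree_\<gamma> utree_dst d)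
    from unscale[OF this] show ?thesis by simp
  qed
  show False
    by (rule hyp_plane_no_swap[OF isom[OF car(2)] v(1)[of None] v(1)[of "Some True"] v(1)[of "Some False"], of "?s / 10"])
       (use long short[of None] short[of "Some True"] short[of "Some False"] in simp_all)
qed

theorem proposition1p9:
  fixes g :: nat
  assumes "g \<ge> 3"
  shows "\<exists>A :: (word set, universe) space_action.
           R_tree_action (surface_group g) A \<and> minimal_action (surface_group g) A \<and>
           iso_class (surface_group g) A \<in> compactification_boundary TYPE(3) g \<and>
           iso_class (surface_group g) A \<notin> compactification_boundary TYPE(2) g"
  using utree_action utree_minimal[OF assms] utree_in_compactification[OF assms]
    utree_not_in_moduli utree_not_in_compactification_2[OF assms]
  unfolding compactification_boundary_def by blast

end
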